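(* Let $T>0$. For every $(t,x)\in[0,T]\times[-1,1]$ the numerical solution $\rho^{\delta}$ constructed by the moving-mesh Godunov-type scheme (described in the context, under the CFL condition stated there) from the initial datum $\rho_0$ satisfies $$0\le \rho^{\delta}(x,t)\le \|\rho_0\|_\infty .$$
   Context: **Data.** $f:[0,1]\to[0,\infty)$ is concave, $f(0)=f(1)=0$, $\max f>0$, $\lim_{\rho\to0+}f(\rho)/\rho\in\mathbb R$; $\|f'\|_\infty$ denotes the Lipschitz constant of $f$ (finite). $v(\rho):=f(\rho)/\rho$ for $\rho\in(0,1]$, $v(0):=\lim_{\rho\to0+}f(\rho)/\rho$. $\xi:[0,\infty)\to(-1,1)$ is Lipschitz continuous with $[\inf\xi,\sup\xi]\subset(-1,1)$ and $\|\xi'\|_\infty$ is its Lipschitz constant. The equation is $\partial_t\rho+\partial_x(\mathrm{sign}(x-\xi(t))f(\rho))=0$ on $(-1,1)$, with initial datum $\rho_0\in L^\infty((-1,1);[0,1])$ (extended by $0$ outside $(-1,1)$) and boundary datum $0$. **Mesh.** $\delta=2^{-N}$ is the space step, with $N\in\mathbb N$ so large that $\|\xi\|_\infty<1-\delta'/2$ for $\delta'=2^{-N'}$, all $N'\ge N$. $x_{j+1/2}=(j+\tfrac12)\delta$, $C_j=[x_{j-1/2},x_{j+1/2})$, $j\in\mathbb Z$. $\tau>0$ is the time step, $t^n=n\tau$, and the CFL condition $\tau\max\{\|f'\|_\infty,\|\xi'\|_\infty\}\le\delta/2$ holds. $\xi^n=\xi(t^n)$, $\alpha_n=(\xi^{n+1}-\xi^n)/\tau$;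 $\xi^\tau$ is the piecewise linear interpolation of the points $(t^n,\xi^n)$. $m(n)$ is the index with $\xi^n\in[x_{m(n)-1/2},x_{m(n)+1/2})$; one has $|m(n)|\le 1/\delta-1$ and $m(n+1)\in\{m(n),m(n)\pm1\}$. At time $t^n$ the cells $\mathsf C^n_j$, $|j|\le1/\delta$, $j\ne m(n)$, are: $\mathsf C^n_j=C_j$ if $|j-m(n)|\ge2$; $\mathsf C^n_{m(n)-1}=D^n_L=[x_{m(n)-3/2},\xi^n)$; $\mathsf C^n_{m(n)+1}=D^n_R=[\xi^n,x_{m(n)+3/2})$. $\Delta^n_L=|D^n_L|$, $\Delta^n_R=|D^n_R|$ (so $\delta\le\Delta_L^n,\Delta_R^n\le2\delta$, $\Delta_L^n+\Delta_R^n=3\delta$). **Numerical fluxes.** $h^\pm(a,b)=\min_{[a,b]}(\pm f)$ if $a\le b$, $h^\pm(a,b)=\max_{[b,a]}(\pm f)$ if $a\ge b$; $h_0(a,b,\alpha)=f(b)-\alpha b$ if $\alpha\ge v(b)$, $=-f(a)-\alpha a$ if $\alpha\le-v(a)$, $=0$ otherwise. **Scheme.** Initialization: $\rho^0_j=|\mathsf C^0_j|^{-1}\int_{\mathsf C^0_j}\rho_0\,dx$ for $|j|\le1/\delta$, $j\neq m(0)$. For all $n$, $\rho^n_{\pm(1+1/\delta)}=0$. Write $\rho^n_L=\rho^n_{m(n)-1}$, $\rho^n_R=\rho^n_{m(n)+1}$. Define the standard updates $(S^\pm)$: $\rho^{n+1}_j=\rho^n_j-\frac{\tau}{\delta}[h^\pm(\rho^n_j,\rho^n_{j+1})-h^\pm(\rho^n_{j-1},\rho^n_j)]$.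 Case A, $m(n+1)=m(n)$: $(S^-)$ for $-1/\delta\le j\le m(n+1)-2$, $(S^+)$ for $m(n+1)+2\le j\le1/\delta$, and $\Delta_L^{n+1}\rho_L^{n+1}=\Delta_L^n\rho_L^n-\tau[h_0(\rho_L^n,\rho_R^n,\alpha_n)-h^-(\rho^n_{m(n)-2},\rho_L^n)]$, $\Delta_R^{n+1}\rho_R^{n+1}=\Delta_R^n\rho_R^n-\tau[h^+(\rho_R^n,\rho^n_{m(n)+2})-h_0(\rho_L^n,\rho_R^n,\alpha_n)]$. Case B, $m(n+1)=m(n)+1$: $(S^-)$ for $-1/\delta\le j\le m(n+1)-3$, $(S^+)$ for $m(n+1)+2\le j\le1/\delta$; $\rho^{n+1}_{m(n+1)-2}=\rho^{n+1}_L=\bar\rho$ with $(\delta+\Delta_L^{n+1})\bar\rho=\Delta_L^n\rho_L^n-\tau[h_0(\rho_L^n,\rho_R^n,\alpha_n)-h^-(\rho^n_{m(n)-2},\rho_L^n)]$, and $\Delta_R^{n+1}\rho_R^{n+1}=\Delta_R^n\rho_R^n+\delta\rho^n_{m(n)+2}-\tau[h^+(\rho^n_{m(n)+2},\rho^n_{m(n)+3})-h_0(\rho_L^n,\rho_R^n,\alpha_n)]$. Case C, $m(n+1)=m(n)-1$: $(S^-)$ for $-1/\delta\le j\le m(n+1)-2$, $(S^+)$ for $m(n+1)+3\le j\le1/\delta$; $\Delta_L^{n+1}\rho_L^{n+1}=\Delta_L^n\rho_L^n+\delta\rho^n_{m(n)-2}-\tau[h_0(\rho_L^n,\rho_R^n,\alpha_n)-h^-(\rho^n_{m(n)-3},\rho^n_{m(n)-2})]$,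 and $\rho^{n+1}_R=\rho^{n+1}_{m(n+1)+2}=\bar\rho$ with $(\delta+\Delta_R^{n+1})\bar\rho=\Delta_R^n\rho_R^n-\tau[h^+(\rho_R^n,\rho^n_{m(n)+2})-h_0(\rho_L^n,\rho_R^n,\alpha_n)]$. **Numerical solution.** $\rho^\delta(x,t^n)=\rho^n_j$ for $x\in\mathsf C^n_j$ ($|j|\le1/\delta$, $j\ne m(n)$), and $\rho^\delta(x,t^n)=0$ on the two extra cells $C_{\pm(1+1/\delta)}$. For $t\in(t^n,t^{n+1})$, $\rho^\delta$ is the exact entropy solution on $(-1-\tfrac32\delta,1+\tfrac32\delta)$ of $\partial_t\rho+\partial_x(\mathrm{sign}(x-\xi^\tau(t))f(\rho))=0$ with datum $\rho^\delta(\cdot,t^n)$ (extended by $0$) at $t=t^n$, that is, the $[0,1]$-valued weak solution which is a Kruzhkov entropy solution on each side of the curve $x=\xi^\tau(t)$. *)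

theory Defs
  imports "HOL-Analysis.Analysis" "HOL-Probability.Essential_Supremum"
begin

section \<open>Data\<close>

text \<open>The least Lipschitz constant; meaningful only if \<open>g\<close> is Lipschitz on \<open>S\<close>.\<close>

definition lip_const :: "(real \<Rightarrow> real) \<Rightarrow> real set \<Rightarrow> real" where
  "lip_const g S = Inf {L. L-lipschitz_on S g}"

definition speed :: "(real \<Rightarrow> real) \<Rightarrow> real \<Rightarrow> real" where
  "speed f \<rho> = (if \<rho> = 0 then Lim (at_right 0) (\<lambda>r. f r / r) else f \<rho> / \<rho>)"

definition flux_data :: "(real \<Rightarrow> real) \<Rightarrow> bool" where
  "flux_data f \<longleftrightarrow>
     (\<forall>\<rho>\<in>{0..1}. 0 \<le> f \<rho>) \<and> concave_on {0..1} f \<and> f 0 = 0 \<and> f 1 = 0 \<and>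
     (SUP \<rho>\<in>{0..1}. f \<rho>) > 0 \<and>
     (\<exists>l. ((\<lambda>\<rho>. f \<rho> / \<rho>) \<longlongrightarrow> l) (at_right 0)) \<and>
     (\<exists>L. L-lipschitz_on {0..1} f)"

definition curve_data :: "(real \<Rightarrow> real) \<Rightarrow> bool" where
  "curve_data \<xi> \<longleftrightarrow>
     (\<forall>t\<ge>0. \<xi> t \<in> {-1<..<1}) \<and> (\<exists>L. L-lipschitz_on {0..} \<xi>) \<and>
     {(INF t\<in>{0..}. \<xi> t)..(SUP t\<in>{0..}. \<xi> t)} \<subseteq> {-1<..<1}"

definition initial_data :: "(real \<Rightarrow> real) \<Rightarrow> bool" where
  "initial_data \<rho>0 \<longleftrightarrow>
     \<rho>0 \<in> borel_measurable (lebesgue_on {-1<..<1}) \<and>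
     (AE x in lebesgue_on {-1<..<1}. \<rho>0 x \<in> {0..1})"

definition ext0 :: "real set \<Rightarrow> (real \<Rightarrow> real) \<Rightarrow> real \<Rightarrow> real" where
  "ext0 S g x = (if x \<in> S then g x else 0)"

section \<open>Mesh\<close>

definition dx :: "nat \<Rightarrow> real" where
  "dx N = 1 / 2 ^ N"

text \<open>\<open>edge N j\<close> is $x_{j+1/2}$.\<close>

definition edge :: "nat \<Rightarrow> int \<Rightarrow> real" where
  "edge N j = (of_int j + 1 / 2) * dx N"

definition cell :: "nat \<Rightarrow> int \<Rightarrow> real set" where
  "cell N j = {edge N (j - 1)..<edge N j}"

definition fine_mesh :: "(real \<Rightarrow> real) \<Rightarrow> nat \<Rightarrow> bool" where
  "fine_mesh \<xi> N \<longleftrightarrow> (\<forall>N'\<ge>N. (SUP t\<in>{0..}. \<bar>\<xi> t\<bar>) < 1 - dx N' / 2)"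

definition CFL :: "(real \<Rightarrow> real) \<Rightarrow> (real \<Rightarrow> real) \<Rightarrow> nat \<Rightarrow> real \<Rightarrow> bool" where
  "CFL f \<xi> N \<tau> \<longleftrightarrow> \<tau> * max (lip_const f {0..1}) (lip_const \<xi> {0..}) \<le> dx N / 2"

definition tm :: "real \<Rightarrow> nat \<Rightarrow> real" where
  "tm \<tau> n = real n * \<tau>"

definition slope :: "(real \<Rightarrow> real) \<Rightarrow> real \<Rightarrow> nat \<Rightarrow> real" where
  "slope \<xi> \<tau> n = (\<xi> (tm \<tau> (Suc n)) - \<xi> (tm \<tau> n)) / \<tau>"

definition interp :: "(real \<Rightarrow> real) \<Rightarrow> real \<Rightarrow> real \<Rightarrow> real" where
  "interp \<xi> \<tau> t =
     (let n = nat \<lfloor>t / \<tau>\<rfloor> in \<xi> (tm \<tau> n) + slope \<xi> \<tau> n * (t - tm \<tau> n))"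

definition curve_idx :: "(real \<Rightarrow> real) \<Rightarrow> nat \<Rightarrow> real \<Rightarrow> nat \<Rightarrow> int" where
  "curve_idx \<xi> N \<tau> n = (THE j. \<xi> (tm \<tau> n) \<in> cell N j)"

text \<open>The cells at time \<open>tm \<tau> n\<close>; there is no cell with index \<open>curve_idx \<xi> N \<tau> n\<close>, and the
  value for that index is never used.\<close>

definition mcell :: "(real \<Rightarrow> real) \<Rightarrow> nat \<Rightarrow> real \<Rightarrow> nat \<Rightarrow> int \<Rightarrow> real set" where
  "mcell \<xi> N \<tau> n j =
     (let m = curve_idx \<xi> N \<tau> n in
      if j = m - 1 then {edge N (m - 2)..<\<xi> (tm \<tau> n)}
      else if j = m + 1 then {\<xi> (tm \<tau> n)..<edge N (m + 1)}
      else cell N j)"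

definition mesh_idx :: "(real \<Rightarrow> real) \<Rightarrow> nat \<Rightarrow> real \<Rightarrow> nat \<Rightarrow> int set" where
  "mesh_idx \<xi> N \<tau> n = {-(2 ^ N)..2 ^ N} - {curve_idx \<xi> N \<tau> n}"

section \<open>Numerical fluxes\<close>

text \<open>For continuous \<open>g\<close> the infimum and supremum are a minimum and a maximum; the fluxes
  $h^\pm$ are obtained with \<open>g = f\<close> and \<open>g = (\<lambda>\<rho>. - f \<rho>)\<close>.\<close>

definition godunov :: "(real \<Rightarrow> real) \<Rightarrow> real \<Rightarrow> real \<Rightarrow> real" where
  "godunov g a b = (if a \<le> b then INF r\<in>{a..b}. g r else SUP r\<in>{b..a}. g r)"

definition curve_flux :: "(real \<Rightarrow> real) \<Rightarrow> real \<Rightarrow> real \<Rightarrow> real \<Rightarrow> real" where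
  "curve_flux f a b \<alpha> =
     (if \<alpha> \<ge> speed f b then f b - \<alpha> * b
      else if \<alpha> \<le> - speed f a then - f a - \<alpha> * a
      else 0)"

section \<open>Scheme\<close>

definition scheme_init ::
    "(real \<Rightarrow> real) \<Rightarrow> nat \<Rightarrow> real \<Rightarrow> (real \<Rightarrow> real) \<Rightarrow> (int \<Rightarrow> real) \<Rightarrow> bool" where
  "scheme_init \<xi> N \<tau> \<rho>0 r \<longleftrightarrow>
     (\<forall>j\<in>mesh_idx \<xi> N \<tau> 0.
        r j = (LINT x:mcell \<xi> N \<tau> 0 j|lebesgue. ext0 {-1<..<1} \<rho>0 x)
                / measure lebesgue (mcell \<xi> N \<tau> 0 j))"

definition scheme_step ::
    "(real \<Rightarrow> real) \<Rightarrow> (real \<Rightarrow> real) \<Rightarrow> nat \<Rightarrow> real \<Rightarrow> nat \<Rightarrow> (int \<Rightarrow> real) \<Rightarrow> (int \<Rightarrow> real) \<Rightarrow> bool"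
  where
  "scheme_step f \<xi> N \<tau> n r r' \<longleftrightarrow>
    (let \<delta> = dx N; J = 2 ^ N;
         m = curve_idx \<xi> N \<tau> n; m' = curve_idx \<xi> N \<tau> (Suc n);
         \<Delta>L = measure lebesgue (mcell \<xi> N \<tau> n (m - 1));
         \<Delta>R = measure lebesgue (mcell \<xi> N \<tau> n (m + 1));
         \<Delta>L' = measure lebesgue (mcell \<xi> N \<tau> (Suc n) (m' - 1));
         \<Delta>R' = measure lebesgue (mcell \<xi> N \<tau> (Suc n) (m' + 1));
         hp = godunov f; hm = godunov (\<lambda>\<rho>. - f \<rho>);
         h0 = curve_flux f (r (m - 1)) (r (m + 1)) (slope \<xi> \<tau> n);
         S = (\<lambda>h j. r j - \<tau> / \<delta> * (h (r j) (r (j + 1)) - h (r (j - 1)) (r j)))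
     in
      (m' = m \<longrightarrow>
         (\<forall>j\<in>{-J..m' - 2}. r' j = S hm j) \<and>
         (\<forall>j\<in>{m' + 2..J}. r' j = S hp j) \<and>
         \<Delta>L' * r' (m' - 1) = \<Delta>L * r (m - 1) - \<tau> * (h0 - hm (r (m - 2)) (r (m - 1))) \<and>
         \<Delta>R' * r' (m' + 1) = \<Delta>R * r (m + 1) - \<tau> * (hp (r (m + 1)) (r (m + 2)) - h0)) \<and>
      (m' = m + 1 \<longrightarrow>
         (\<forall>j\<in>{-J..m' - 3}. r' j = S hm j) \<and>
         (\<forall>j\<in>{m' + 2..J}. r' j = S hp j) \<and>
         r' (m' - 2) = r' (m' - 1) \<and>
         (\<delta> + \<Delta>L') * r' (m' - 1) =
           \<Delta>L * r (m - 1) - \<tau> * (h0 - hm (r (m - 2)) (r (m - 1))) \<and>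
         \<Delta>R' * r' (m' + 1) =
           \<Delta>R * r (m + 1) + \<delta> * r (m + 2) - \<tau> * (hp (r (m + 2)) (r (m + 3)) - h0)) \<and>
      (m' = m - 1 \<longrightarrow>
         (\<forall>j\<in>{-J..m' - 2}. r' j = S hm j) \<and>
         (\<forall>j\<in>{m' + 3..J}. r' j = S hp j) \<and>
         \<Delta>L' * r' (m' - 1) =
           \<Delta>L * r (m - 1) + \<delta> * r (m - 2) - \<tau> * (h0 - hm (r (m - 3)) (r (m - 2))) \<and>
         r' (m' + 2) = r' (m' + 1) \<and>
         (\<delta> + \<Delta>R') * r' (m' + 1) =
           \<Delta>R * r (m + 1) - \<tau> * (hp (r (m + 1)) (r (m + 2)) - h0)))"

definition scheme ::
    "(real \<Rightarrow> real) \<Rightarrow> (real \<Rightarrow> real) \<Rightarrow> nat \<Rightarrow> real \<Rightarrow> (real \<Rightarrow> real) \<Rightarrow> (nat \<Rightarrow> int \<Rightarrow> real) \<Rightarrow> bool"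
  where
  "scheme f \<xi> N \<tau> \<rho>0 r \<longleftrightarrow>
     scheme_init \<xi> N \<tau> \<rho>0 (r 0) \<and>
     (\<forall>n. r n (1 + 2 ^ N) = 0 \<and> r n (-(1 + 2 ^ N)) = 0) \<and>
     (\<forall>n. scheme_step f \<xi> N \<tau> n (r n) (r (Suc n)))"

section \<open>Exact entropy solutions\<close>

text \<open>Points of the plane are pairs \<open>(x, t)\<close>. Test functions are $C^1$ with compact support in
  \<open>\<Omega>\<close>; \<open>\<phi>x\<close> and \<open>\<phi>t\<close> are the partial derivatives of \<open>\<phi>\<close>.\<close>

definition test_fun ::
    "(real \<times> real) set \<Rightarrow> (real \<times> real \<Rightarrow> real) \<Rightarrow> (real \<times> real \<Rightarrow> real) \<Rightarrow> (real \<times> real \<Rightarrow> real) \<Rightarrow> bool"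
  where
  "test_fun \<Omega> \<phi> \<phi>x \<phi>t \<longleftrightarrow>
     (\<forall>p. (\<phi> has_derivative (\<lambda>h. \<phi>x p * fst h + \<phi>t p * snd h)) (at p)) \<and>
     continuous_on UNIV \<phi>x \<and> continuous_on UNIV \<phi>t \<and>
     (\<exists>K. compact K \<and> K \<subseteq> \<Omega> \<and> (\<forall>p. p \<notin> K \<longrightarrow> \<phi> p = 0))"

definition weak_solution_on ::
    "(real \<times> real) set \<Rightarrow> (real \<Rightarrow> real \<Rightarrow> real \<Rightarrow> real) \<Rightarrow> (real \<Rightarrow> real \<Rightarrow> real) \<Rightarrow> bool" where
  "weak_solution_on \<Omega> F w \<longleftrightarrow>
     (\<forall>\<phi> \<phi>x \<phi>t. test_fun \<Omega> \<phi> \<phi>x \<phi>t \<longrightarrow>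
        (LINT (x, t)|lborel. w x t * \<phi>t (x, t) + F x t (w x t) * \<phi>x (x, t)) = 0)"

text \<open>The constants are restricted to \<open>{0..1}\<close>, where the flux is defined.\<close>

definition kruzhkov_on ::
    "(real \<times> real) set \<Rightarrow> (real \<Rightarrow> real) \<Rightarrow> (real \<Rightarrow> real \<Rightarrow> real) \<Rightarrow> bool" where
  "kruzhkov_on \<Omega> g w \<longleftrightarrow>
     (\<forall>k\<in>{0..1}. \<forall>\<phi> \<phi>x \<phi>t. test_fun \<Omega> \<phi> \<phi>x \<phi>t \<and> (\<forall>p. 0 \<le> \<phi> p) \<longrightarrow>
        (LINT (x, t)|lborel. \<bar>w x t - k\<bar> * \<phi>t (x, t)
           + sgn (w x t - k) * (g (w x t) - g k) * \<phi>x (x, t)) \<ge> 0)"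

text \<open>Entropy solution on the whole line, for \<open>t\<close> in \<open>{s<..<e}\<close>, of
  $\partial_t w + \partial_x (\mathrm{sign}(x - \gamma(t)) f(w)) = 0$ with initial datum \<open>w0\<close> at
  time \<open>s\<close>. As usual it is taken continuous in time with values in $L^1$, with the datum attained
  in $L^1$. So that point values make sense, the representative of \<open>w\<close> at each time is the one
  which is right-continuous with left limits in space (matching the half-open cells); it exists
  for piecewise constant data, for which solutions are of bounded variation in space.\<close>

definition entropy_solution ::
    "(real \<Rightarrow> real) \<Rightarrow> (real \<Rightarrow> real) \<Rightarrow> real \<Rightarrow> real \<Rightarrow> (real \<Rightarrow> real) \<Rightarrow> (real \<Rightarrow> real \<Rightarrow> real) \<Rightarrow> bool"
  where
  "entropy_solution f \<gamma> s e w0 w \<longleftrightarrow>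
     set_borel_measurable borel (UNIV \<times> {s<..<e}) (\<lambda>(x, t). w x t) \<and>
     (\<forall>t\<in>{s<..<e}. \<forall>x. w x t \<in> {0..1}) \<and>
     weak_solution_on (UNIV \<times> {s<..<e}) (\<lambda>x t u. sgn (x - \<gamma> t) * f u) w \<and>
     kruzhkov_on {(x, t). t \<in> {s<..<e} \<and> x < \<gamma> t} (\<lambda>u. - f u) w \<and>
     kruzhkov_on {(x, t). t \<in> {s<..<e} \<and> x > \<gamma> t} f w \<and>
     integrable lborel w0 \<and>
     (\<forall>t\<in>{s<..<e}. integrable lborel (\<lambda>x. w x t)) \<and>
     (\<forall>t\<in>{s<..<e}. ((\<lambda>t'. LINT x|lborel. \<bar>w x t' - w x t\<bar>) \<longlongrightarrow> 0) (at t)) \<and>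
     ((\<lambda>t. LINT x|lborel. \<bar>w x t - w0 x\<bar>) \<longlongrightarrow> 0) (at_right s) \<and>
     (\<forall>t\<in>{s<..<e}. \<forall>x. ((\<lambda>y. w y t) \<longlongrightarrow> w x t) (at_right x) \<and>
                           (\<exists>l. ((\<lambda>y. w y t) \<longlongrightarrow> l) (at_left x)))"

section \<open>Numerical solution\<close>

text \<open>\<open>u x t\<close> is $\rho^\delta(x,t)$. Only its values for \<open>x\<close> in the domain, which is the union of
  the cells and of the two extra cells up to its left endpoint, are relevant.\<close>

definition domain :: "nat \<Rightarrow> real set" where
  "domain N = {- 1 - 3 / 2 * dx N<..<1 + 3 / 2 * dx N}"

definition numerical_solution ::
    "(real \<Rightarrow> real) \<Rightarrow> (real \<Rightarrow> real) \<Rightarrow> nat \<Rightarrow> real \<Rightarrow> (real \<Rightarrow> real) \<Rightarrow> (real \<Rightarrow> real \<Rightarrow> real) \<Rightarrow> bool"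
  where
  "numerical_solution f \<xi> N \<tau> \<rho>0 u \<longleftrightarrow>
     (\<exists>r. scheme f \<xi> N \<tau> \<rho>0 r \<and>
       (\<forall>n.
          (\<forall>j\<in>mesh_idx \<xi> N \<tau> n. \<forall>x\<in>mcell \<xi> N \<tau> n j. u x (tm \<tau> n) = r n j) \<and>
          (\<forall>x\<in>cell N (1 + 2 ^ N) \<union> cell N (-(1 + 2 ^ N)). u x (tm \<tau> n) = 0) \<and>
          (\<exists>w. entropy_solution f (interp \<xi> \<tau>) (tm \<tau> n) (tm \<tau> (Suc n))
                 (ext0 (domain N) (\<lambda>x. u x (tm \<tau> n))) w \<and>
               (\<forall>t\<in>{tm \<tau> n<..<tm \<tau> (Suc n)}. \<forall>x\<in>domain N. u x t = w x t))))"

end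

theory Submission
  imports Defs
begin

text \<open>At the mesh times every new value is a balance over its cell; bounding the Godunov fluxes and the
  flux across the curve by their values at a constant state, up to the Lipschitz constant times the
  distance to that state, the CFL condition keeps all values between the states \<open>0\<close> and \<open>M\<close>.
  Between the mesh times the entropy solution has one-sided traces \<open>a\<close>, \<open>b\<close> at the curve. The Kruzhkov
  inequalities for \<open>M\<close> on the two sides, tested up to the curve, show that the integral of \<open>(w - M)\<^sup>+\<close>
  grows at most at a rate determined by \<open>a\<close>, \<open>b\<close> and the slope of the curve. The Rankine-Hugoniot
  relation, which is all that the weak formulation gives across the curve, and the concavity of the
  flux make this rate nonpositive. So the excess above \<open>M\<close>, initially zero, stays zero.\<close>

section \<open>A continuously differentiable cut-off\<close>

text \<open>No entropy condition is imposed at the curve, and the Kruzhkov inequalities admit only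
  test functions vanishing near it. The interface is therefore reached through traces, which exist
  because the chosen representative has one-sided limits in space at every time. Between mesh times
  the interpolated curve is affine: a shear straightens it, and products of a function of time with
  a function of the distance to the curve remain C1 test functions. The line has infinite measure,
  so away from the curve the dominating functions are multiples of the solution itself rather than
  constants. The lower bound between mesh times is part of the notion of entropy solution; only the
  upper bound needs an argument. In the scheme the constant state \<open>M\<close> need not be
  stationary next to the curve; there the nonnegativity of \<open>f\<close> supplies the sign that
  an exact balance would otherwise give.\<close>

lemma DERIV_pos_part_power:
  fixes t :: real
  shows "((\<lambda>t. max 0 t ^ Suc (Suc k)) has_real_derivative real (k + 2) * max 0 t ^ Suc k) (at t)"
proof -
  consider "t < 0" | "t = 0" | "t > 0" by linarith
  then show ?thesis
  proof cases
    case 1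
    have "((\<lambda>_. 0) has_real_derivative real (k + 2) * max 0 t ^ Suc k) (at t)"
      using 1 by (simp add: max_def)
    moreover have "eventually (\<lambda>u. 0 = max 0 u ^ Suc (Suc k)) (nhds t)"
      using order_tendstoD(2)[OF tendsto_ident_at 1] 1
      by (intro eventually_nhds_in_open[of "{..<0}" t, THEN eventually_mono]) (auto simp: max_def)
    ultimately show ?thesis
      by (rule DERIV_cong_ev[OF refl _ refl, THEN iffD1, rotated])
  next
    case 2
    \<comment> \<open>At the corner the difference quotient is at most a positive power of
      \<open>\<bar>h\<bar>\<close>, because the exponent is at least 2.\<close>
    have "((\<lambda>h::real. max 0 h ^ Suc (Suc k) / h) \<longlongrightarrow> 0) (at 0)"
    proof (rule Lim_null_comparison[where g = "\<lambda>h. \<bar>h\<bar> ^ Suc k"])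
      show "eventually (\<lambda>h::real. norm (max 0 h ^ Suc (Suc k) / h) \<le> \<bar>h\<bar> ^ Suc k) (at 0)"
        
      proof (intro always_eventually allI)
        fix h :: real
        show "norm (max 0 h ^ Suc (Suc k) / h) \<le> \<bar>h\<bar> ^ Suc k"
        proof (cases "h > 0")
          case False
          then have "norm (max 0 h ^ Suc (Suc k) / h) = 0" by simp
          then show ?thesis using zero_le_power[of "\<bar>h\<bar>" "Suc k"] by linarith
        qed (simp add: max_def)
      qed
      have "isCont (\<lambda>h::real. \<bar>h\<bar> ^ Suc k) 0" by (intro continuous_intros)
      then show "((\<lambda>h::real. \<bar>h\<bar> ^ Suc k) \<longlongrightarrow> 0) (at 0)"
        unfolding isCont_def by simp
    qed
    then show ?thesis using 2 by (simp add: DERIV_def)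
  next
    case 3
    have "((\<lambda>u. u ^ Suc (Suc k)) has_real_derivative real (k + 2) * max 0 t ^ Suc k) (at t)"
      using DERIV_pow[of "Suc (Suc k)" t] 3 by (simp add: max_def add.commute)
    moreover have "eventually (\<lambda>u. u ^ Suc (Suc k) = max 0 u ^ Suc (Suc k)) (nhds t)"
      using 3 by (intro eventually_nhds_in_open[of "{0<..}" t, THEN eventually_mono]) (auto simp: max_def)
    ultimately show ?thesis
      by (rule DERIV_cong_ev[OF refl _ refl, THEN iffD1, rotated])
  qed
qed

text \<open>The polynomial \<open>3 z\<^sup>2 - 2 z\<^sup>3\<close> on the unit interval, written with positive parts so that
  differentiability at the end points comes for free.\<close>

definition smoothstep :: "real \<Rightarrow> real" where
  "smoothstep z = 3 * max 0 z ^ 2 - 2 * max 0 z ^ 3 + 3 * max 0 (z - 1) ^ 2 + 2 * max 0 (z - 1) ^ 3"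

definition smoothstep' :: "real \<Rightarrow> real" where
  "smoothstep' z = max 0 (6 * (z * (1 - z)))"

lemma smoothstep_eq_0 [simp]: "z \<le> 0 \<Longrightarrow> smoothstep z = 0"
  by (simp add: smoothstep_def max_def)

lemma smoothstep_eq_1 [simp]: "z \<ge> 1 \<Longrightarrow> smoothstep z = 1"
  by (simp add: smoothstep_def max_def power2_eq_square power3_eq_cube algebra_simps)

lemma smoothstep'_nonneg [simp]: "0 \<le> smoothstep' z"
  by (simp add: smoothstep'_def)

lemma smoothstep'_eq_0 [simp]: "z \<le> 0 \<or> 1 \<le> z \<Longrightarrow> smoothstep' z = 0"
  using mult_nonneg_nonpos[of z "1 - z"] mult_nonpos_nonneg[of z "1 - z"]
  by (auto simp: smoothstep'_def max_def simp del: mult_le_0_iff zero_le_mult_iff)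

lemma smoothstep'_le: "smoothstep' z \<le> 2"
proof -
  have "0 \<le> (z - 1 / 2) ^ 2" by simp
  then show ?thesis by (simp add: smoothstep'_def power2_eq_square algebra_simps)
qed

lemma DERIV_smoothstep: "(smoothstep has_real_derivative smoothstep' z) (at z)"
proof -
  have 2: "((\<lambda>t. max 0 t ^ 2) has_real_derivative 2 * max 0 t) (at t)" for t :: real
    using DERIV_pos_part_power[of 0 t] by (simp add: numeral_2_eq_2)
  have 3: "((\<lambda>t. max 0 t ^ 3) has_real_derivative 3 * max 0 t ^ 2) (at t)" for t :: real
    using DERIV_pos_part_power[of 1 t] by (simp add: numeral_3_eq_3 numeral_2_eq_2)
  have "((\<lambda>z. 3 * max 0 z ^ 2 - 2 * max 0 z ^ 3 + 3 * max 0 (z - 1) ^ 2 + 2 * max 0 (z - 1) ^ 3)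
      has_real_derivative 3 * (2 * max 0 z) - 2 * (3 * max 0 z ^ 2) +
        3 * (2 * max 0 (z - 1)) + 2 * (3 * max 0 (z - 1) ^ 2)) (at z)"
    by (intro DERIV_add DERIV_diff DERIV_cmult 2 3 DERIV_chain2[OF 2, of _ 1, simplified]
        DERIV_chain2[OF 3, of _ 1, simplified]) (auto intro!: derivative_eq_intros)
  moreover have "3 * (2 * max 0 z) - 2 * (3 * max 0 z ^ 2) +
        3 * (2 * max 0 (z - 1)) + 2 * (3 * max 0 (z - 1) ^ 2) = smoothstep' z"
  proof -
    consider "z \<le> 0" | "0 < z" "z < 1" | "1 \<le> z" by linarith
    then show ?thesis
    proof cases
      case 2
      then have "smoothstep' z = 6 * (z * (1 - z))" by (simp add: smoothstep'_def max_def)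
      with 2 show ?thesis by (simp add: max_def power2_eq_square algebra_simps)
    qed (auto simp: max_def power2_eq_square algebra_simps)
  qed
  ultimately show ?thesis unfolding smoothstep_def[abs_def] by simp
qed

lemma continuous_smoothstep' [continuous_intros]:
  "continuous_on S g \<Longrightarrow> continuous_on S (\<lambda>x. smoothstep' (g x))"
  unfolding smoothstep'_def by (intro continuous_intros)

lemma continuous_smoothstep [continuous_intros]:
  "continuous_on S g \<Longrightarrow> continuous_on S (\<lambda>x. smoothstep (g x))"
  unfolding smoothstep_def by (intro continuous_intros)

lemma smoothstep_mono: "x \<le> y \<Longrightarrow> smoothstep x \<le> smoothstep y"
  by (rule DERIV_nonneg_imp_nondecreasing[of x y]) (auto intro!: exI DERIV_smoothstep)

lemma smoothstep_nonneg [simp]: "0 \<le> smoothstep z"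
  using smoothstep_mono[of "min z 0" z] by simp

lemma smoothstep_le_1 [simp]: "smoothstep z \<le> 1"
  using smoothstep_mono[of z "max z 1"] by simp

lemma borel_measurable_smoothstep [measurable]: "smoothstep \<in> borel_measurable borel"
  by (intro borel_measurable_continuous_onI continuous_intros)

lemma borel_measurable_smoothstep' [measurable]: "smoothstep' \<in> borel_measurable borel"
  by (intro borel_measurable_continuous_onI continuous_intros)

text \<open>Unit mass makes rescaled copies of \<open>smoothstep'\<close> averaging kernels, both
  for the traces at the curve and for averages in time.\<close>

lemma has_bochner_integral_smoothstep':
  "has_bochner_integral lborel smoothstep' 1"
proof -
  have "has_bochner_integral lborel (\<lambda>z. smoothstep' z * indicator {0..1} z) (smoothstep 1 - smoothstep 0)"
    by (rule has_bochner_integral_FTC_Icc_nonneg) (auto intro: DERIV_smoothstep)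
  moreover have "(\<lambda>z. smoothstep' z * indicator {0..1} z) = smoothstep'"
  proof
    show "smoothstep' z * indicator {0..1} z = smoothstep' z" for z
      by (cases "z \<in> {0..1}") auto
  qed
  ultimately show ?thesis by simp
qed

text \<open>A one-dimensional factor of a product test function. The derivative is carried as a
  separate function because \<open>test_fun\<close> lists the partial derivatives
  explicitly.\<close>

definition C1_supp :: "(real \<Rightarrow> real) \<Rightarrow> (real \<Rightarrow> real) \<Rightarrow> real \<Rightarrow> real \<Rightarrow> bool" where
  "C1_supp g g' a b \<longleftrightarrow> (\<forall>x. (g has_real_derivative g' x) (at x)) \<and> continuous_on UNIV g' \<and>
     (\<forall>x. x \<notin> {a..b} \<longrightarrow> g x = 0 \<and> g' x = 0)"

lemma C1_suppD:
  assumes "C1_supp g g' a b"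
  shows "(g has_real_derivative g' x) (at x)" "continuous_on S g" "continuous_on S g'"
    "x \<notin> {a..b} \<Longrightarrow> g x = 0" "x \<notin> {a..b} \<Longrightarrow> g' x = 0"
    "g \<in> borel_measurable borel" "g' \<in> borel_measurable borel"
proof -
  show *: "continuous_on S g" for S
    using assms DERIV_isCont by (intro continuous_at_imp_continuous_on) (auto simp: C1_supp_def)
  show "g \<in> borel_measurable borel" "g' \<in> borel_measurable borel"
    using assms by (auto intro!: borel_measurable_continuous_onI * simp: C1_supp_def)
qed (use assms in \<open>auto simp: C1_supp_def intro: continuous_on_subset\<close>)

lemma C1_supp_bounded:
  assumes "C1_supp g g' a b"
  obtains C where "C \<ge> 0" "\<And>x. \<bar>g x\<bar> \<le> C" "\<And>x. \<bar>g' x\<bar> \<le> C"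
proof -
  have "compact (g ` {a..b})" "compact (g' ` {a..b})"
    using C1_suppD[OF assms] by (auto intro!: compact_continuous_image)
  then obtain C1 C2 where 1: "\<forall>x\<in>g ` {a..b}. norm x \<le> C1" and 2: "\<forall>x\<in>g' ` {a..b}. norm x \<le> C2"
    using compact_imp_bounded[of "g ` {a..b}"] compact_imp_bounded[of "g' ` {a..b}"]
    unfolding bounded_iff by auto
  show ?thesis
  proof
    show "\<bar>g x\<bar> \<le> max 0 (max C1 C2)" for x
      using 1 C1_suppD(4)[OF assms, of x] by (cases "x \<in> {a..b}") (auto simp: le_max_iff_disj)
    show "\<bar>g' x\<bar> \<le> max 0 (max C1 C2)" for x
      using 2 C1_suppD(5)[OF assms, of x] by (cases "x \<in> {a..b}") (auto simp: le_max_iff_disj)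
  qed simp
qed

lemma C1_supp_integral:
  assumes "C1_supp g g' a b"
  shows "(\<integral>x. g' x \<partial>lborel) = 0"
proof -
  \<comment> \<open>Widening makes the interval nonempty and puts both end points outside the
    support.\<close>
  define a' b' where "a' = min a b - 1" and "b' = max a b + 1"
  have "(\<integral>x. g' x * indicator {a'..b'} x \<partial>lborel) = g b' - g a'"
    using C1_suppD(1)[OF assms] C1_suppD(3)[OF assms, of UNIV]
    by (intro integral_FTC_Icc_real) (auto simp: a'_def b'_def continuous_on_eq_continuous_at)
  moreover have "(\<lambda>x. g' x * indicator {a'..b'} x) = g'"
  proof
    show "g' x * indicator {a'..b'} x = g' x" for x
      using C1_suppD(5)[OF assms, of x] by (cases "x \<in> {a..b}") (auto simp: indicator_def a'_def b'_def)
  qed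
  moreover have "g b' = 0" "g a' = 0"
    by (rule C1_suppD(4)[OF assms], simp add: a'_def b'_def, arith)+
  ultimately show ?thesis by simp
qed

text \<open>Every one-dimensional test function below has this shape: an upward ramp of width
  \<open>1 / p\<close> starting at \<open>c\<close> and a downward ramp of width
  \<open>1 / q\<close> starting at \<open>d\<close>.\<close>

lemma C1_supp_smoothstep_diff:
  assumes "p > 0" "q > 0" "c \<le> d" "a \<le> c" "c + 1 / p \<le> b" "d + 1 / q \<le> b"
  shows "C1_supp (\<lambda>x. smoothstep (p * (x - c)) - smoothstep (q * (x - d)))
     (\<lambda>x. p * smoothstep' (p * (x - c)) - q * smoothstep' (q * (x - d))) a b"
proof -
  have *: "((\<lambda>x. smoothstep (p * (x - c))) has_real_derivative smoothstep' (p * (x - c)) * p) (at x)" for p c x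
    by (rule DERIV_chain2[OF DERIV_smoothstep]) (auto intro!: derivative_eq_intros)
  have "((\<lambda>x. smoothstep (p * (x - c)) - smoothstep (q * (x - d))) has_real_derivative
         p * smoothstep' (p * (x - c)) - q * smoothstep' (q * (x - d))) (at x)" for x
    using DERIV_diff[OF *[of p c] *[of q d]] by (simp add: mult.commute)
  moreover have "smoothstep (p * (x - c)) - smoothstep (q * (x - d)) = 0 \<and>
     p * smoothstep' (p * (x - c)) - q * smoothstep' (q * (x - d)) = 0" if x: "x \<notin> {a..b}" for x
  proof (cases "x < a")
    case True
    then have "p * (x - c) \<le> 0" "q * (x - d) \<le> 0"
      using assms by (auto simp: mult_le_0_iff)
    then show ?thesis by simp
  next
    case False
    then have "p * (x - c) \<ge> p * (1 / p)" "q * (x - d) \<ge> q * (1 / q)"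
      using x assms by (auto intro!: mult_left_mono simp del: times_divide_eq_right)
    then have "p * (x - c) \<ge> 1" "q * (x - d) \<ge> 1"
      using assms by auto
    then show ?thesis by simp
  qed
  moreover have "continuous_on UNIV (\<lambda>x. p * smoothstep' (p * (x - c)) - q * smoothstep' (q * (x - d)))"
    by (intro continuous_intros)
  ultimately show ?thesis unfolding C1_supp_def by blast
qed

section \<open>Integration in sheared coordinates\<close>

text \<open>On each slice with fixed second coordinate the map is an affine substitution with factor
  \<open>s\<close>, so Tonelli gives the Jacobian \<open>\<bar>s\<bar>\<close>. The function
  \<open>g\<close> only translates the slices, which is why measurability of \<open>g\<close> is
  enough.\<close>

lemma lborel_shear:
  assumes [measurable]: "g \<in> borel_measurable borel" and s: "s \<noteq> 0"
  shows "(lborel :: (real \<times> real) measure) =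
    density (distr lborel borel (\<lambda>p. (g (snd p) + s * fst p, snd p))) (\<lambda>_. ennreal \<bar>s\<bar>)"
    (is "_ = density (distr _ _ ?T) _")
proof (rule measure_eqI)
  fix A :: "(real \<times> real) set" assume "A \<in> sets lborel"
  then have A [measurable]: "A \<in> sets borel" by simp
  have [measurable]: "A \<in> sets (lborel \<Otimes>\<^sub>M lborel)" "A \<in> sets (borel \<Otimes>\<^sub>M borel)"
    unfolding lborel_prod borel_prod using A by auto
  have T: "?T \<in> borel \<rightarrow>\<^sub>M borel"
    unfolding borel_prod[symmetric] by measurable
  have "emeasure lborel A = emeasure (lborel \<Otimes>\<^sub>M lborel) A" by (simp add: lborel_prod)
  also have "\<dots> = (\<integral>\<^sup>+ p. indicator A p \<partial>(lborel \<Otimes>\<^sub>M lborel))" by simp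
  also have "\<dots> = (\<integral>\<^sup>+ t. \<integral>\<^sup>+ x. indicator A (x, t) \<partial>lborel \<partial>lborel)"
    by (rule lborel_pair.nn_integral_snd[symmetric]) simp
  also have "\<dots> = (\<integral>\<^sup>+ t. ennreal \<bar>s\<bar> * (\<integral>\<^sup>+ z. indicator A (g t + s * z, t) \<partial>lborel) \<partial>lborel)"
    by (intro nn_integral_cong nn_integral_real_affine s) measurable
  also have "\<dots> = ennreal \<bar>s\<bar> * (\<integral>\<^sup>+ t. (\<integral>\<^sup>+ z. indicator A (g t + s * z, t) \<partial>lborel) \<partial>lborel)"
    by (intro nn_integral_cmult) measurable
  also have "(\<integral>\<^sup>+ t. (\<integral>\<^sup>+ z. indicator A (g t + s * z, t) \<partial>lborel) \<partial>lborel) =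
     (\<integral>\<^sup>+ p. indicator A (?T p) \<partial>(lborel \<Otimes>\<^sub>M lborel))"
    by (subst lborel_pair.nn_integral_snd[symmetric]) auto
  also have "ennreal \<bar>s\<bar> * \<dots> = (\<integral>\<^sup>+ p. ennreal \<bar>s\<bar> * indicator A (?T p) \<partial>lborel)"
    unfolding lborel_prod using measurable_compose[OF T, of "\<lambda>p. indicator A p :: ennreal" borel]
    by (intro nn_integral_cmult[symmetric]) simp
  also have "\<dots> = (\<integral>\<^sup>+ p. ennreal \<bar>s\<bar> * indicator A p \<partial>distr lborel borel ?T)"
    using T by (subst nn_integral_distr) auto
  also have "\<dots> = emeasure (density (distr lborel borel ?T) (\<lambda>_. ennreal \<bar>s\<bar>)) A"
    using T by (subst emeasure_density) auto
  finally show "emeasure lborel A = \<dots>" .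
qed auto

text \<open>Serves three purposes: straightening the curve (\<open>g\<close> affine), stretching a
  boundary layer (\<open>g = 0\<close>, small \<open>s\<close>), and reflecting the left side onto
  the right (\<open>s = -1\<close>).\<close>

lemma integral_shear:
  fixes F :: "real \<times> real \<Rightarrow> real"
  assumes [measurable]: "g \<in> borel_measurable borel" "F \<in> borel_measurable borel" and s: "s \<noteq> 0"
  shows "(\<integral>p. F p \<partial>lborel) = \<bar>s\<bar> * (\<integral>p. F (g (snd p) + s * fst p, snd p) \<partial>lborel)"
    and "integrable lborel F \<longleftrightarrow> integrable lborel (\<lambda>p. F (g (snd p) + s * fst p, snd p))"
proof -
  let ?T = "\<lambda>p. (g (snd p) + s * fst p, snd p)"
  have T [measurable]: "?T \<in> borel \<rightarrow>\<^sub>M borel"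
    unfolding borel_prod[symmetric] by measurable
  show "(\<integral>p. F p \<partial>lborel) = \<bar>s\<bar> * (\<integral>p. F (?T p) \<partial>lborel)"
    using s by (subst lborel_shear[OF assms(1) s]) (simp add: integral_density integral_distr)
  show "integrable lborel F \<longleftrightarrow> integrable lborel (\<lambda>p. F (?T p))"
    using s by (subst lborel_shear[OF assms(1) s])
      (simp add: integrable_density integrable_distr_eq)
qed

text \<open>Half-open intervals are stable under intersection and generate the Borel sets, so a
  Dynkin argument extends the vanishing to all Borel sets; uniqueness of densities then compares
  \<open>h\<close> with 0.\<close>

lemma AE_eq_0_if_interval_integrals_0:
  fixes h :: "real \<Rightarrow> real"
  assumes h: "integrable lborel h"
    and 0: "\<And>c d. c \<le> d \<Longrightarrow> (\<integral>t. indicator {c<..d} t * h t \<partial>lborel) = 0"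
  shows "AE t in lborel. h t = 0"
proof (rule density_unique_real[OF h])
  have [measurable]: "h \<in> borel_measurable borel" using h by auto
  have si: "set_integrable lborel A h" if "A \<in> sets borel" for A
    using that h unfolding set_integrable_def by (intro integrable_mult_indicator) auto
  let ?E = "range (\<lambda>(c, d). {c<..d::real})"
  have E: "sets borel = sigma_sets UNIV ?E"
    by (subst borel_sigma_sets_Ioc) simp
  \<comment> \<open>The complement step of the Dynkin induction needs the integral over the whole
    line, obtained by exhausting it with intervals.\<close>
  have U: "(\<integral>t\<in>UNIV. h t \<partial>lborel) = 0"
  proof -
    have "(\<lambda>n::nat. \<integral>t. indicator {- real n<..real n} t * h t \<partial>lborel) \<longlonglongrightarrow> (\<integral>t. h t \<partial>lborel)"
    proof (rule integral_dominated_convergence[where w = "\<lambda>t. \<bar>h t\<bar>"])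
      show "AE x in lborel. (\<lambda>n. indicat_real {- real n<..real n} x * h x) \<longlonglongrightarrow> h x"
      proof (rule AE_I2)
        fix x
        obtain n0 where "\<bar>x\<bar> < real n0" using reals_Archimedean2 by blast
        then have "eventually (\<lambda>n. indicat_real {- real n<..real n} x * h x = h x) sequentially"
          by (intro eventually_sequentiallyI[of n0]) (auto simp: indicator_def)
        then show "(\<lambda>n. indicat_real {- real n<..real n} x * h x) \<longlonglongrightarrow> h x"
          by (rule tendsto_eventually)
      qed
    qed (use h in \<open>auto simp: indicator_def\<close>)
    moreover have "(\<integral>t. indicator {- real n<..real n} t * h t \<partial>lborel) = 0" for n
      by (rule 0) simp
    ultimately show ?thesis by (simp add: set_lebesgue_integral_def LIMSEQ_unique)
  qed
  fix A :: "real set" assume "A \<in> sets lborel"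
  then have "A \<in> sigma_sets UNIV ?E" using E by simp
  then have "(\<integral>t\<in>A. h t \<partial>lborel) = 0"
  proof (induction rule: sigma_sets_induct_disjoint[rotated 2, consumes 1])
    case (1 A)
    then obtain c d where A: "A = {c<..d}" by auto
    show ?case
    proof (cases "c \<le> d")
      case True
      from 0[OF this] show ?thesis by (simp add: A set_lebesgue_integral_def)
    qed (simp add: A set_lebesgue_integral_def)
  next
    case 2 show ?case by (simp add: set_lebesgue_integral_def)
  next
    case (3 A)
    then have [measurable]: "A \<in> sets borel" using E by simp
    have "(\<integral>t\<in>UNIV. h t \<partial>lborel) = (\<integral>t\<in>A \<union> (UNIV - A). h t \<partial>lborel)" by simp
    also have "\<dots> = (\<integral>t\<in>A. h t \<partial>lborel) + (\<integral>t\<in>UNIV - A. h t \<partial>lborel)"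
      by (intro set_integral_Un si) auto
    finally show ?case using U 3 by simp
  next
    case (4 A)
    then have "A i \<in> sets borel" for i using E by auto
    then have "(\<integral>t\<in>(\<Union>i. A i). h t \<partial>lborel) = (\<Sum>i. \<integral>t\<in>A i. h t \<partial>lborel)"
      using 4 by (intro lebesgue_integral_countable_add si) (auto simp: disjoint_family_on_def)
    with 4 show ?case by simp
  next
    show "Int_stable ?E"
    proof (rule Int_stableI)
      fix A B assume "A \<in> ?E" "B \<in> ?E"
      then obtain a b c d where "A = {a<..b}" "B = {c<..d}" by auto
      then have "A \<inter> B = {max a c<..min b d}" by auto
      then show "A \<inter> B \<in> ?E" by auto
    qed
  qed auto
  then show "(\<integral>t\<in>A. h t \<partial>lborel) = (\<integral>t\<in>A. 0 \<partial>lborel)" by simp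
qed simp

lemma tensor_integral:
  fixes g h :: "real \<Rightarrow> real"
  assumes g: "integrable lborel g" and h: "integrable lborel h"
  shows "integrable lborel (\<lambda>p. h (snd p) * g (fst p))"
    and "(\<integral>p. h (snd p) * g (fst p) \<partial>lborel) = (\<integral>t. h t \<partial>lborel) * (\<integral>y. g y \<partial>lborel)"
proof -
  have [measurable]: "g \<in> borel_measurable borel" "h \<in> borel_measurable borel"
    using g h by auto
  have *: "integrable (lborel \<Otimes>\<^sub>M lborel) (\<lambda>p. h (snd p) * g (fst p))"
  proof (rule lborel_pair.Fubini_integrable)
    show "integrable lborel (\<lambda>x. \<integral>y. norm (h (snd (x, y)) * g (fst (x, y))) \<partial>lborel)"
      using g h by (simp add: abs_mult)
  qed (use g h in auto)
  then show "integrable lborel (\<lambda>p. h (snd p) * g (fst p))"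
    by (simp add: lborel_prod)
  have "(\<integral>x. \<integral>y. h (snd (x, y)) * g (fst (x, y)) \<partial>lborel \<partial>lborel) =
      (\<integral>p. h (snd p) * g (fst p) \<partial>(lborel \<Otimes>\<^sub>M lborel))"
    by (rule lborel_pair.integral_fst'[OF *])
  then show "(\<integral>p. h (snd p) * g (fst p) \<partial>lborel) = (\<integral>t. h t \<partial>lborel) * (\<integral>y. g y \<partial>lborel)"
    by (simp add: lborel_prod)
qed

lemma tensor_integrable_bounded:
  fixes g h :: "real \<Rightarrow> real"
  assumes g: "integrable lborel g" and h: "integrable lborel h"
    and [measurable]: "G \<in> borel_measurable borel" and C: "\<And>p. \<bar>G p\<bar> \<le> C"
  shows "integrable lborel (\<lambda>p. G p * (h (snd p) * g (fst p)))"
proof (rule Bochner_Integration.integrable_bound)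
  show "integrable lborel (\<lambda>p. C * (h (snd p) * g (fst p)))"
    using tensor_integral(1)[OF g h] by simp
  show "(\<lambda>p. G p * (h (snd p) * g (fst p))) \<in> borel_measurable lborel"
    using borel_measurable_times[OF assms(3), of "\<lambda>p. h (snd p) * g (fst p)"] tensor_integral(1)[OF g h]
    by auto
  have "\<bar>G p\<bar> \<le> \<bar>C\<bar>" for p using C[of p] by linarith
  then show "AE p in lborel. norm (G p * (h (snd p) * g (fst p))) \<le> norm (C * (h (snd p) * g (fst p)))"
    by (intro AE_I2) (simp add: abs_mult mult_right_mono)
qed

lemma C1_supp_integrable:
  assumes "C1_supp g g' a b"
  shows "integrable lborel g" "integrable lborel g'"
proof -
  have *: "integrable lborel h" if "continuous_on UNIV h" "\<And>x. x \<notin> {a..b} \<Longrightarrow> h x = 0" for h :: "real \<Rightarrow> real"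
  proof -
    have "integrable lborel (\<lambda>x. indicator {a..b} x *\<^sub>R h x)"
      by (rule borel_integrable_compact) (use that in \<open>auto intro: continuous_on_subset\<close>)
    moreover have "(\<lambda>x. indicator {a..b} x *\<^sub>R h x) = h"
    proof
      show "indicator {a..b} x *\<^sub>R h x = h x" for x
        using that(2)[of x] by (cases "x \<in> {a..b}") auto
    qed
    ultimately show ?thesis by simp
  qed
  show "integrable lborel g" "integrable lborel g'"
    using C1_suppD[OF assms] by (auto intro!: *)
qed

text \<open>The flux is controlled on the unit interval only; composing with the clamp onto
  \<open>{0..1}\<close> extends it continuously to the line without changing the values in
  question.\<close>

lemma borel_measurable_continuous_comp_unit:
  fixes F :: "real \<Rightarrow> real" and V :: "'a \<Rightarrow> real"
  assumes F: "continuous_on {0..1} F" and V: "V \<in> borel_measurable M" and r: "\<And>p. V p \<in> {0..1}"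
  shows "(\<lambda>p. F (V p)) \<in> borel_measurable M"
proof -
  have "continuous_on UNIV (\<lambda>u. F (max 0 (min 1 u)))"
    by (intro continuous_on_compose2[OF F] continuous_intros) auto
  then have "(\<lambda>p. F (max 0 (min 1 (V p)))) \<in> borel_measurable M"
    by (intro measurable_compose[OF V] borel_measurable_continuous_onI)
  moreover have "max 0 (min 1 (V p)) = V p" for p
    using r[of p] by auto
  ultimately show ?thesis by simp
qed

lemma tendsto_continuous_comp_unit:
  fixes F :: "real \<Rightarrow> real"
  assumes "continuous_on {0..1} F" "(\<lambda>n. X n) \<longlonglongrightarrow> l" "\<And>n. X n \<in> {0..1}" "l \<in> {0..1}"
  shows "(\<lambda>n. F (X n)) \<longlonglongrightarrow> F l"
  by (rule continuous_on_tendsto_compose[OF assms(1,2,4)]) (use assms(3) in auto)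

text \<open>Chain rule for a product in the coordinates \<open>t\<close> and
  \<open>y = (x - c - \<alpha> * t) / s\<close>. The extra term in the time derivative comes from
  the motion of the curve and later turns the flux \<open>f u\<close> into the relative flux
  \<open>f u - \<alpha> * u\<close>.\<close>

lemma test_fun_tensor:
  assumes \<psi>: "C1_supp \<psi> \<psi>' a b" and \<eta>: "C1_supp \<eta> \<eta>' a' b'" and s: "s \<noteq> 0"
    and \<Omega>: "\<And>y t. t \<in> {a..b} \<Longrightarrow> y \<in> {a'..b'} \<Longrightarrow> (c + \<alpha> * t + s * y, t) \<in> \<Omega>"
  shows "test_fun \<Omega> (\<lambda>p. \<psi> (snd p) * \<eta> ((fst p - (c + \<alpha> * snd p)) / s))
    (\<lambda>p. \<psi> (snd p) * \<eta>' ((fst p - (c + \<alpha> * snd p)) / s) / s)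
    (\<lambda>p. \<psi>' (snd p) * \<eta> ((fst p - (c + \<alpha> * snd p)) / s)
        - \<alpha> * \<psi> (snd p) * \<eta>' ((fst p - (c + \<alpha> * snd p)) / s) / s)"
  unfolding test_fun_def
proof (intro conjI allI)
  fix p :: "real \<times> real"
  define Y where "Y = (\<lambda>p. (fst p - (c + \<alpha> * snd p)) / s)"
  have Y: "(Y has_derivative (\<lambda>h. (fst h - \<alpha> * snd h) / s)) (at p)"
    unfolding Y_def using s by (auto intro!: derivative_eq_intros simp: field_simps)
  have "((\<lambda>p. \<eta> (Y p)) has_derivative (\<lambda>h. \<eta>' (Y p) * ((fst h - \<alpha> * snd h) / s))) (at p)"
    using has_derivative_compose[OF Y, of \<eta> "\<lambda>h. \<eta>' (Y p) * h"] C1_suppD(1)[OF \<eta>, of "Y p"]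
    by (simp add: has_field_derivative_def)
  moreover have "((\<lambda>p. \<psi> (snd p)) has_derivative (\<lambda>h. \<psi>' (snd p) * snd h)) (at p)"
    using has_derivative_compose[of snd snd p UNIV \<psi> "\<lambda>h. \<psi>' (snd p) * h"] C1_suppD(1)[OF \<psi>, of "snd p"]
    by (simp add: has_field_derivative_def has_derivative_snd)
  ultimately have "((\<lambda>p. \<psi> (snd p) * \<eta> (Y p)) has_derivative
    (\<lambda>h. \<psi> (snd p) * (\<eta>' (Y p) * ((fst h - \<alpha> * snd h) / s)) + \<psi>' (snd p) * snd h * \<eta> (Y p))) (at p)"
    by (rule has_derivative_mult[rotated])
  moreover have "(\<lambda>h. \<psi> (snd p) * (\<eta>' (Y p) * ((fst h - \<alpha> * snd h) / s)) + \<psi>' (snd p) * snd h * \<eta> (Y p))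
    = (\<lambda>h. \<psi> (snd p) * \<eta>' (Y p) / s * fst h + (\<psi>' (snd p) * \<eta> (Y p) - \<alpha> * \<psi> (snd p) * \<eta>' (Y p) / s) * snd h)"
    using s by (auto simp: fun_eq_iff field_simps)
  ultimately show "((\<lambda>p. \<psi> (snd p) * \<eta> ((fst p - (c + \<alpha> * snd p)) / s)) has_derivative
      (\<lambda>h. \<psi> (snd p) * \<eta>' ((fst p - (c + \<alpha> * snd p)) / s) / s * fst h +
        (\<psi>' (snd p) * \<eta> ((fst p - (c + \<alpha> * snd p)) / s)
        - \<alpha> * \<psi> (snd p) * \<eta>' ((fst p - (c + \<alpha> * snd p)) / s) / s) * snd h)) (at p)"
    unfolding Y_def by simp
next
  have *: "continuous_on UNIV (\<lambda>p::real \<times> real. h ((fst p - (c + \<alpha> * snd p)) / s))"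
    "continuous_on UNIV (\<lambda>p::real \<times> real. h (snd p))"
    if "continuous_on UNIV h" for h :: "real \<Rightarrow> real"
    using s by (auto intro!: continuous_on_compose2[OF that] continuous_intros)
  show "continuous_on UNIV (\<lambda>p. \<psi> (snd p) * \<eta>' ((fst p - (c + \<alpha> * snd p)) / s) / s)"
    "continuous_on UNIV (\<lambda>p. \<psi>' (snd p) * \<eta> ((fst p - (c + \<alpha> * snd p)) / s)
        - \<alpha> * \<psi> (snd p) * \<eta>' ((fst p - (c + \<alpha> * snd p)) / s) / s)"
    using C1_suppD[OF \<psi>] C1_suppD[OF \<eta>] s by (auto intro!: continuous_intros *)
next
  let ?K = "(\<lambda>q. (c + \<alpha> * snd q + s * fst q, snd q)) ` ({a'..b'} \<times> {a..b})"
  have "compact ?K"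
    by (intro compact_continuous_image compact_Times continuous_intros) auto
  moreover have "?K \<subseteq> \<Omega>" using \<Omega> by auto
  moreover have "\<psi> (snd p) * \<eta> ((fst p - (c + \<alpha> * snd p)) / s) = 0" if "p \<notin> ?K" for p
  proof (rule ccontr)
    assume "\<psi> (snd p) * \<eta> ((fst p - (c + \<alpha> * snd p)) / s) \<noteq> 0"
    then have "snd p \<in> {a..b}" "(fst p - (c + \<alpha> * snd p)) / s \<in> {a'..b'}"
      using C1_suppD(4)[OF \<psi>] C1_suppD(4)[OF \<eta>] by force+
    then have "p \<in> ?K"
      using s by (intro image_eqI[of _ _ "((fst p - (c + \<alpha> * snd p)) / s, snd p)"]) (auto simp: prod_eq_iff)
    with that show False by simp
  qed
  ultimately show "\<exists>K. compact K \<and> K \<subseteq> \<Omega> \<and>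
      (\<forall>p. p \<notin> K \<longrightarrow> \<psi> (snd p) * \<eta> ((fst p - (c + \<alpha> * snd p)) / s) = 0)"
    by (intro exI[of _ ?K]) blast
qed

lemma borel_measurable_fst_snd [measurable]:
  "(fst :: real \<times> real \<Rightarrow> real) \<in> borel_measurable borel"
  "(snd :: real \<times> real \<Rightarrow> real) \<in> borel_measurable borel"
  by (intro borel_measurable_continuous_onI continuous_intros)+

text \<open>Subtracting a linear function preserves concavity, and a concave function on a segment
  is at least the smaller of its end values.\<close>

lemma concave_on_diff_linear_between:
  fixes f :: "real \<Rightarrow> real"
  assumes f: "concave_on {0..1} f" and ab: "a \<in> {0..1}" "b \<in> {0..1}" "a < b" "k \<in> {a..b}"
    and m: "m \<le> f a - \<beta> * a" "m \<le> f b - \<beta> * b"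
  shows "m \<le> f k - \<beta> * k"
proof -
  define l where "l = (k - a) / (b - a)"
  have l: "0 \<le> l" "l \<le> 1"
    using ab by (auto simp: l_def)
  have "l * (b - a) = k - a" using ab by (simp add: l_def)
  then have k: "k = (1 - l) * a + l * b" by (simp add: algebra_simps)
  have "(1 - l) * f a + l * f b \<le> f k"
    using concave_onD[OF f l ab(1,2)] unfolding k by simp
  moreover have "(1 - l) * m \<le> (1 - l) * (f a - \<beta> * a)" "l * m \<le> l * (f b - \<beta> * b)"
    using l m by (auto intro!: mult_left_mono)
  moreover have "m = (1 - l) * m + l * m" by (simp add: algebra_simps)
  moreover have "\<beta> * k = (1 - l) * (\<beta> * a) + l * (\<beta> * b)" unfolding k by (simp add: algebra_simps)
  ultimately show ?thesis by (simp add: right_diff_distrib)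
qed

section \<open>Entropy solutions across a straight curve\<close>

text \<open>One strip between consecutive mesh times. There the interpolated curve is affine, so
  test functions of the distance to it are C1 in the plane.\<close>

locale entropy_strip =
  fixes f \<gamma> w0 :: "real \<Rightarrow> real" and w :: "real \<Rightarrow> real \<Rightarrow> real" and s e c \<alpha> L :: real
  assumes lip: "L-lipschitz_on {0..1} f"
    and f0: "f 0 = 0"
    and sol: "entropy_solution f \<gamma> s e w0 w"
    and curve: "\<And>t. t \<in> {s<..<e} \<Longrightarrow> \<gamma> t = c + \<alpha> * t"
begin

text \<open>The entropy solution is constrained only at times in the open strip; the value 0
  elsewhere makes it measurable and \<open>{0..1}\<close>-valued on the whole plane.\<close>

definition v :: "real \<times> real \<Rightarrow> real" where
  "v p = (if snd p \<in> {s<..<e} then w (fst p) (snd p) else 0)"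

text \<open>The solution in coordinates moving with the curve, scaled by \<open>r\<close>; a negative \<open>r\<close> reflects
  the left side of the curve onto the right half-plane.\<close>

definition V :: "real \<Rightarrow> real \<times> real \<Rightarrow> real" where
  "V r p = v (c + \<alpha> * snd p + r * fst p, snd p)"

text \<open>The trace from the right of the curve for \<open>r = 1\<close> and from the left for
  \<open>r = -1\<close>. Outside the strip it is 0, as \<open>V\<close> is, so that traces are
  limits of \<open>V\<close> at every time.\<close>

definition tr :: "real \<Rightarrow> real \<Rightarrow> real" where
  "tr r t = (if t \<in> {s<..<e} then Lim (at_right 0) (\<lambda>y. V r (y, t)) else 0)"

section \<open>Range and measurability of the straightened solution\<close>

lemma f_continuous: "continuous_on {0..1} f"
  using lip by (rule lipschitz_on_continuous_on)

lemma L_nonneg: "L \<ge> 0"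
  using lip by (rule lipschitz_on_nonneg)

lemma f_lip: "u \<in> {0..1} \<Longrightarrow> u' \<in> {0..1} \<Longrightarrow> \<bar>f u - f u'\<bar> \<le> L * \<bar>u - u'\<bar>"
  using lipschitz_onD[OF lip, of u u'] by (simp add: dist_real_def)

lemma v_measurable [measurable]: "v \<in> borel_measurable borel"
proof -
  have "set_borel_measurable borel (UNIV \<times> {s<..<e}) (\<lambda>(x, t). w x t)"
    using sol by (simp add: entropy_solution_def)
  moreover have "v = (\<lambda>p. indicator (UNIV \<times> {s<..<e}) p *\<^sub>R (case p of (x, t) \<Rightarrow> w x t))"
    by (auto simp: v_def fun_eq_iff indicator_def)
  ultimately show ?thesis by (simp add: set_borel_measurable_def)
qed

lemma v_range: "v p \<in> {0..1}"
  using sol by (auto simp: v_def entropy_solution_def)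

lemma V_range: "V r p \<in> {0..1}"
  unfolding V_def by (rule v_range)

lemma shear_measurable [measurable]: "(\<lambda>p::real \<times> real. (c + \<alpha> * snd p + r * fst p, snd p)) \<in> borel \<rightarrow>\<^sub>M borel"
  unfolding borel_prod[symmetric] by measurable

lemma V_measurable [measurable]: "V r \<in> borel_measurable borel"
  unfolding V_def[abs_def] by (rule measurable_compose[OF shear_measurable v_measurable])

lemma V_Pair_measurable [measurable]: "(\<lambda>t. V r (y, t)) \<in> borel_measurable borel"
  by (rule measurable_compose[OF _ V_measurable]) (simp add: borel_prod[symmetric])

text \<open>After clearing the \<open>1 / r\<close> of the space derivative, the factor
  \<open>r\<close> survives only in front of the time derivative of the test function. Letting
  \<open>r\<close> tend to 0 therefore isolates the flux balance at the curve.\<close>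

lemma weak_sheared:
  assumes \<psi>: "C1_supp \<psi> \<psi>' a b" "s < a" "b < e" and \<eta>: "C1_supp \<eta> \<eta>' a' b'" and r: "r > 0"
  shows "(\<integral>p. r * V r p * (\<psi>' (snd p) * \<eta> (fst p)) +
    (sgn (fst p) * f (V r p) - \<alpha> * V r p) * (\<psi> (snd p) * \<eta>' (fst p)) \<partial>lborel) = 0"
proof -
  note [measurable] = C1_suppD(6,7)[OF \<psi>(1)] C1_suppD(6,7)[OF \<eta>]
  have [measurable]: "(\<lambda>p. f (v p)) \<in> borel_measurable borel"
    by (rule borel_measurable_continuous_comp_unit[OF f_continuous v_measurable v_range])
  let ?y = "\<lambda>p. (fst p - (c + \<alpha> * snd p)) / r"
  define F where "F = (\<lambda>p. v p * (\<psi>' (snd p) * \<eta> (?y p) - \<alpha> * \<psi> (snd p) * \<eta>' (?y p) / r)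
     + sgn (?y p) * f (v p) * (\<psi> (snd p) * \<eta>' (?y p) / r))"
  have F [measurable]: "F \<in> borel_measurable borel"
    unfolding F_def by measurable
  let ?\<phi>x = "\<lambda>p. \<psi> (snd p) * \<eta>' (?y p) / r"
  let ?\<phi>t = "\<lambda>p. \<psi>' (snd p) * \<eta> (?y p) - \<alpha> * \<psi> (snd p) * \<eta>' (?y p) / r"
  have tf: "test_fun (UNIV \<times> {s<..<e}) (\<lambda>p. \<psi> (snd p) * \<eta> (?y p)) ?\<phi>x ?\<phi>t"
    by (rule test_fun_tensor[OF \<psi>(1) \<eta>]) (use \<psi> r in auto)
  have "(LINT (x, t)|lborel. w x t * ?\<phi>t (x, t) + sgn (x - \<gamma> t) * f (w x t) * ?\<phi>x (x, t)) = 0"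
    using sol tf unfolding entropy_solution_def weak_solution_on_def by blast
  also have "(\<lambda>(x, t). w x t * ?\<phi>t (x, t) + sgn (x - \<gamma> t) * f (w x t) * ?\<phi>x (x, t)) = F"
  proof
    fix p :: "real \<times> real"
    show "(case p of (x, t) \<Rightarrow> w x t * ?\<phi>t (x, t) + sgn (x - \<gamma> t) * f (w x t) * ?\<phi>x (x, t)) = F p"
    proof (cases "snd p \<in> {s<..<e}")
      case True
      then show ?thesis using r by (cases p) (simp add: F_def v_def curve sgn_divide)
    next
      case False
      then have "\<psi> (snd p) = 0" "\<psi>' (snd p) = 0" using C1_suppD(4,5)[OF \<psi>(1), of "snd p"] \<psi> by auto
      then show ?thesis by (cases p) (simp add: F_def)
    qed
  qed
  finally have "(\<integral>p. F p \<partial>lborel) = 0" .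
  moreover have "(\<integral>p. F p \<partial>lborel) = \<bar>r\<bar> * (\<integral>p. F ((\<lambda>t. c + \<alpha> * t) (snd p) + r * fst p, snd p) \<partial>lborel)"
    by (rule integral_shear) (use r in auto)
  ultimately have "r * (r * (\<integral>p. F (c + \<alpha> * snd p + r * fst p, snd p) \<partial>lborel)) = 0"
    by simp
  then have "(\<integral>p. r * F (c + \<alpha> * snd p + r * fst p, snd p) \<partial>lborel) = 0"
    using r by simp
  also have "(\<lambda>p. r * F (c + \<alpha> * snd p + r * fst p, snd p)) = (\<lambda>p. r * V r p * (\<psi>' (snd p) * \<eta> (fst p)) +
    (sgn (fst p) * f (V r p) - \<alpha> * V r p) * (\<psi> (snd p) * \<eta>' (fst p)))"
    using r by (auto simp: fun_eq_iff F_def V_def field_simps sgn_mult)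
  finally show ?thesis .
qed

text \<open>Reflecting the left side turns its flux \<open>- f\<close> into \<open>f\<close>, so
  both sides obey the same inequality up to the sign of \<open>\<alpha>\<close>. The condition
  \<open>a' > 0\<close> keeps the support off the curve.\<close>

lemma kruzhkov_sheared:
  assumes \<psi>: "C1_supp \<psi> \<psi>' a b" "s < a" "b < e" "\<And>t. \<psi> t \<ge> 0"
    and \<eta>: "C1_supp \<eta> \<eta>' a' b'" "a' > 0" "\<And>y. \<eta> y \<ge> 0"
    and r: "r = 1 \<or> r = -1" and k: "k \<in> {0..1}"
  shows "0 \<le> (\<integral>p. \<bar>V r p - k\<bar> * (\<psi>' (snd p) * \<eta> (fst p)) +
    (sgn (V r p - k) * (f (V r p) - f k) - r * \<alpha> * \<bar>V r p - k\<bar>) * (\<psi> (snd p) * \<eta>' (fst p)) \<partial>lborel)"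
proof -
  note [measurable] = C1_suppD(6,7)[OF \<psi>(1)] C1_suppD(6,7)[OF \<eta>(1)]
  have [measurable]: "(\<lambda>p. f (v p)) \<in> borel_measurable borel"
    by (rule borel_measurable_continuous_comp_unit[OF f_continuous v_measurable v_range])
  let ?y = "\<lambda>p. (fst p - (c + \<alpha> * snd p)) / r"
  define F where "F = (\<lambda>p. \<bar>v p - k\<bar> * (\<psi>' (snd p) * \<eta> (?y p) - \<alpha> * \<psi> (snd p) * \<eta>' (?y p) / r)
     + sgn (v p - k) * (r * f (v p) - r * f k) * (\<psi> (snd p) * \<eta>' (?y p) / r))"
  have F [measurable]: "F \<in> borel_measurable borel"
    unfolding F_def by measurable
  let ?\<Omega> = "{(x, t). t \<in> {s<..<e} \<and> r * (x - \<gamma> t) > 0}"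
  let ?\<phi>x = "\<lambda>p. \<psi> (snd p) * \<eta>' (?y p) / r"
  let ?\<phi>t = "\<lambda>p. \<psi>' (snd p) * \<eta> (?y p) - \<alpha> * \<psi> (snd p) * \<eta>' (?y p) / r"
  have tf: "test_fun ?\<Omega> (\<lambda>p. \<psi> (snd p) * \<eta> (?y p)) ?\<phi>x ?\<phi>t"
    by (rule test_fun_tensor[OF \<psi>(1) \<eta>(1)]) (use \<psi> r \<eta> curve in auto)
  have "kruzhkov_on ?\<Omega> (\<lambda>u. r * f u) w"
    using sol r by (auto simp: entropy_solution_def)
  from this[unfolded kruzhkov_on_def, rule_format, OF k conjI[OF tf]]
  have "0 \<le> (LINT (x, t)|lborel. \<bar>w x t - k\<bar> * ?\<phi>t (x, t) + sgn (w x t - k) * (r * f (w x t) - r * f k) * ?\<phi>x (x, t))"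
    using \<psi>(4) \<eta>(3) by simp
  also have "(\<lambda>(x, t). \<bar>w x t - k\<bar> * ?\<phi>t (x, t) + sgn (w x t - k) * (r * f (w x t) - r * f k) * ?\<phi>x (x, t)) = F"
  proof
    fix p :: "real \<times> real"
    show "(case p of (x, t) \<Rightarrow> \<bar>w x t - k\<bar> * ?\<phi>t (x, t) + sgn (w x t - k) * (r * f (w x t) - r * f k) * ?\<phi>x (x, t)) = F p"
    proof (cases "snd p \<in> {s<..<e}")
      case True
      then show ?thesis by (cases p) (simp add: F_def v_def)
    next
      case False
      then have "\<psi> (snd p) = 0" "\<psi>' (snd p) = 0" using C1_suppD(4,5)[OF \<psi>(1), of "snd p"] \<psi> by auto
      then show ?thesis by (cases p) (simp add: F_def)
    qed
  qed
  also have "(\<integral>p. F p \<partial>lborel) = \<bar>r\<bar> * (\<integral>p. F ((\<lambda>t. c + \<alpha> * t) (snd p) + r * fst p, snd p) \<partial>lborel)"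
    by (rule integral_shear) (use r in auto)
  also have "\<dots> = (\<integral>p. F (c + \<alpha> * snd p + r * fst p, snd p) \<partial>lborel)" using r by auto
  also have "(\<lambda>p. F (c + \<alpha> * snd p + r * fst p, snd p)) = (\<lambda>p. \<bar>V r p - k\<bar> * (\<psi>' (snd p) * \<eta> (fst p)) +
    (sgn (V r p - k) * (f (V r p) - f k) - r * \<alpha> * \<bar>V r p - k\<bar>) * (\<psi> (snd p) * \<eta>' (fst p)))"
    using r by (elim disjE) (simp_all add: fun_eq_iff F_def V_def algebra_simps)
  finally show ?thesis .
qed

section \<open>The one-sided entropy pair\<close>

definition P :: "real \<Rightarrow> real \<Rightarrow> real" where
  "P k u = max u k - k"

text \<open>\<open>P k\<close> is the entropy \<open>(u - k)\<^sup>+\<close>, and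
  \<open>Q r k\<close> is its flux relative to the moving curve on the side \<open>r\<close>.
  Writing both with \<open>max\<close> makes their continuity in \<open>u\<close> evident, which
  passing to the traces requires.\<close>

definition Q :: "real \<Rightarrow> real \<Rightarrow> real \<Rightarrow> real" where
  "Q r k u = f (max u k) - f k - r * \<alpha> * (max u k - k)"

lemma P_bounds: "0 \<le> P k u" "k \<ge> 0 \<Longrightarrow> u \<ge> 0 \<Longrightarrow> P k u \<le> u" "\<bar>P k u - P k u'\<bar> \<le> \<bar>u - u'\<bar>"
  by (auto simp: P_def max_def abs_if)

lemma P_continuous: "continuous_on S (P k)"
  unfolding P_def[abs_def] by (intro continuous_intros)

lemma Q_continuous: "k \<in> {0..1} \<Longrightarrow> continuous_on {0..1} (Q r k)"
  unfolding Q_def[abs_def]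
  by (intro continuous_intros continuous_on_compose2[OF f_continuous, of _ "\<lambda>u. max u k"]) auto

text \<open>For \<open>k \<ge> 0\<close> the excess over \<open>k\<close> is at most
  \<open>u\<close>. Linearity in \<open>u\<close> matters: on the unbounded line the solution is
  integrable while a constant is not.\<close>

lemma Q_bound:
  assumes "r = 1 \<or> r = -1" "k \<in> {0..1}" "u \<in> {0..1}"
  shows "\<bar>Q r k u\<bar> \<le> (L + \<bar>\<alpha>\<bar>) * u"
proof -
  have "\<bar>f (max u k) - f k\<bar> \<le> L * \<bar>max u k - k\<bar>"
    by (rule f_lip) (use assms in auto)
  moreover have "\<bar>r * \<alpha> * (max u k - k)\<bar> = \<bar>\<alpha>\<bar> * \<bar>max u k - k\<bar>"
    using assms by (auto simp: abs_mult)
  ultimately have "\<bar>Q r k u\<bar> \<le> (L + \<bar>\<alpha>\<bar>) * \<bar>max u k - k\<bar>"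
    unfolding Q_def distrib_right using abs_triangle_ineq4[of "f (max u k) - f k" "r * \<alpha> * (max u k - k)"]
    by linarith
  also have "\<dots> \<le> (L + \<bar>\<alpha>\<bar>) * u"
    using assms L_nonneg by (intro mult_left_mono) auto
  finally show ?thesis .
qed

lemma P_V_measurable [measurable]: "(\<lambda>p. P k (V r p)) \<in> borel_measurable borel"
  by (rule borel_measurable_continuous_comp_unit[OF P_continuous V_measurable V_range])

lemma Q_V_measurable: "k \<in> {0..1} \<Longrightarrow> (\<lambda>p. Q r' k (V r p)) \<in> borel_measurable borel"
  by (rule borel_measurable_continuous_comp_unit[OF Q_continuous V_measurable V_range])

lemma f_V_measurable [measurable]: "(\<lambda>p. f (V r p)) \<in> borel_measurable borel"
  by (rule borel_measurable_continuous_comp_unit[OF f_continuous V_measurable V_range])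

lemma f_bound: "u \<in> {0..1} \<Longrightarrow> \<bar>f u\<bar> \<le> L"
  using f_lip[of u 0] f0 mult_left_le[of "\<bar>u\<bar>" L] L_nonneg by simp

text \<open>The average of the Kruzhkov inequalities for the constants \<open>k\<close> and \<open>0\<close>.\<close>

lemma half_kruzhkov_sheared:
  assumes \<psi>: "C1_supp \<psi> \<psi>' a b" "s < a" "b < e" "\<And>t. \<psi> t \<ge> 0"
    and \<eta>: "C1_supp \<eta> \<eta>' a' b'" "a' > 0" "\<And>y. \<eta> y \<ge> 0"
    and r: "r = 1 \<or> r = -1" and k: "k \<in> {0..1}"
  shows "0 \<le> (\<integral>p. P k (V r p) * (\<psi>' (snd p) * \<eta> (fst p)) +
    Q r k (V r p) * (\<psi> (snd p) * \<eta>' (fst p)) \<partial>lborel)"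
proof -
  note int = C1_supp_integrable[OF \<psi>(1)] C1_supp_integrable[OF \<eta>(1)]
  define T1 T2 where "T1 = (\<lambda>p::real \<times> real. \<psi>' (snd p) * \<eta> (fst p))"
    and "T2 = (\<lambda>p::real \<times> real. \<psi> (snd p) * \<eta>' (fst p))"
  have T: "integrable lborel (\<lambda>p. G p * T1 p)" "integrable lborel (\<lambda>p. G p * T2 p)"
    if "G \<in> borel_measurable borel" "\<And>p. \<bar>G p\<bar> \<le> C" for G C
    unfolding T1_def T2_def by (rule tensor_integrable_bounded[OF _ _ that]; rule int)+
  \<comment> \<open>Constant multiples of the test terms drop out, since \<open>\<psi>'\<close> and
    \<open>\<eta>'\<close> both have integral 0.\<close>
  have int0: "integrable lborel T1" "integrable lborel T2" "(\<integral>p. T1 p \<partial>lborel) = 0" "(\<integral>p. T2 p \<partial>lborel) = 0"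
    unfolding T1_def T2_def
    using tensor_integral[of \<eta> \<psi>'] tensor_integral[of \<eta>' \<psi>] int C1_supp_integral[OF \<psi>(1)] C1_supp_integral[OF \<eta>(1)]
    by auto
  define K where "K j p = \<bar>V r p - j\<bar> * T1 p + (sgn (V r p - j) * (f (V r p) - f j) - r * \<alpha> * \<bar>V r p - j\<bar>) * T2 p"
    for j p
  have K: "0 \<le> (\<integral>p. K j p \<partial>lborel)" if "j \<in> {0..1}" for j
    unfolding K_def T1_def T2_def by (rule kruzhkov_sheared[OF \<psi> \<eta> r that])
  have Kint: "integrable lborel (K j)" if j: "j \<in> {0..1}" for j
    unfolding K_def
  proof (intro Bochner_Integration.integrable_add T)
    fix p
    have V01: "V r p \<in> {0..1}" by (rule V_range)
    then have 1: "\<bar>V r p - j\<bar> \<le> 1" using j by auto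
    then show "\<bar>\<bar>V r p - j\<bar>\<bar> \<le> 1" by simp
    have "\<bar>sgn (V r p - j) * (f (V r p) - f j)\<bar> \<le> \<bar>f (V r p)\<bar> + \<bar>f j\<bar>"
      by (simp add: abs_mult sgn_if abs_triangle_ineq4)
    then have 2: "\<bar>sgn (V r p - j) * (f (V r p) - f j)\<bar> \<le> 2 * L"
      using f_bound[OF V01] f_bound[OF j] by linarith
    have "\<bar>r * \<alpha> * \<bar>V r p - j\<bar>\<bar> \<le> \<bar>\<alpha>\<bar>"
      using r 1 by (auto simp: abs_mult mult_left_le)
    then show "\<bar>sgn (V r p - j) * (f (V r p) - f j) - r * \<alpha> * \<bar>V r p - j\<bar>\<bar> \<le> 2 * L + \<bar>\<alpha>\<bar>"
      using 2 by linarith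
  qed measurable
  have eq: "P k (V r p) * T1 p + Q r k (V r p) * T2 p =
      (K k p + K 0 p - k * T1 p - (f k - r * \<alpha> * k) * T2 p) / 2" for p
  proof -
    \<comment> \<open>As the solution is nonnegative, the entropies for \<open>k\<close> and 0 add
      up to twice the positive part plus a constant; the next identity is the same for the
      fluxes.\<close>
    have "\<bar>V r p - k\<bar> + \<bar>V r p - 0\<bar> = 2 * P k (V r p) + k"
      using V_range[of r p] by (auto simp: P_def max_def abs_if)
    moreover have "sgn (V r p - k) * (f (V r p) - f k) + sgn (V r p - 0) * (f (V r p) - f 0) =
        2 * (f (max (V r p) k) - f k) + f k"
      using V_range[of r p] k f0 by (auto simp: max_def sgn_if)
    moreover have "K k p + K 0 p = (\<bar>V r p - k\<bar> + \<bar>V r p - 0\<bar>) * T1 p +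
        ((sgn (V r p - k) * (f (V r p) - f k) + sgn (V r p - 0) * (f (V r p) - f 0))
          - r * \<alpha> * (\<bar>V r p - k\<bar> + \<bar>V r p - 0\<bar>)) * T2 p"
      unfolding K_def by (simp only: ring_distribs)
    ultimately have "K k p + K 0 p = (2 * P k (V r p) + k) * T1 p +
        (2 * (f (max (V r p) k) - f k) + f k - r * \<alpha> * (2 * P k (V r p) + k)) * T2 p"
      by simp
    then show ?thesis by (simp add: Q_def P_def algebra_simps)
  qed
  have "0 \<le> ((\<integral>p. K k p \<partial>lborel) + (\<integral>p. K 0 p \<partial>lborel)) / 2"
    using K[OF k] K[of 0] by simp
  also have "\<dots> = (\<integral>p. (K k p + K 0 p - k * T1 p - (f k - r * \<alpha> * k) * T2 p) / 2 \<partial>lborel)"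
    using Kint[OF k] Kint[of 0] int0 by simp
  finally show ?thesis by (simp only: eq[symmetric]) (simp only: T1_def T2_def)
qed

section \<open>One-sided traces along the curve\<close>

lemma tr_tendsto:
  assumes t: "t \<in> {s<..<e}" and r: "r = 1 \<or> r = -1"
  shows "((\<lambda>y. V r (y, t)) \<longlongrightarrow> tr r t) (at_right 0)"
proof -
  have reg: "\<exists>l. ((\<lambda>y. w y t) \<longlongrightarrow> l) (at_right x)" "\<exists>l. ((\<lambda>y. w y t) \<longlongrightarrow> l) (at_left x)" for x
    using sol t unfolding entropy_solution_def by blast+
  let ?x = "c + \<alpha> * t"
  have V: "V r (y, t) = w (?x + r * y) t" for y
    using t by (simp add: V_def v_def)
  obtain l where "((\<lambda>y. w (?x + r * y) t) \<longlongrightarrow> l) (at_right 0)"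
    using r
  proof
    assume "r = 1"
    moreover obtain l where "((\<lambda>y. w y t) \<longlongrightarrow> l) (at_right ?x)" using reg by blast
    ultimately show ?thesis
      using that[of l] by (subst (asm) filterlim_at_right_to_0) (simp add: add.commute)
  next
    assume "r = -1"
    moreover obtain l where "((\<lambda>y. w y t) \<longlongrightarrow> l) (at_left ?x)" using reg by blast
    ultimately show ?thesis
      using that[of l]
      by (subst (asm) filterlim_at_left_to_right, subst (asm) filterlim_at_right_to_0) (simp add: algebra_simps)
  qed
  then have "((\<lambda>y. V r (y, t)) \<longlongrightarrow> l) (at_right 0)" by (simp add: V)
  moreover from this have "tr r t = l"
    using t by (auto simp: tr_def intro!: tendsto_Lim)
  ultimately show ?thesis by simp
qed

lemma V_outside: "t \<notin> {s<..<e} \<Longrightarrow> V r (y, t) = 0"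
  by (auto simp: V_def v_def)

text \<open>A sequential version valid at every time, from which measurability and range of the
  trace follow; the free factor \<open>y\<close> is what the blow-up arguments need.\<close>

lemma tr_LIMSEQ:
  assumes r: "r = 1 \<or> r = -1" and y: "y > 0"
  shows "(\<lambda>n. V r (y / real (n + 2), t)) \<longlonglongrightarrow> tr r t"
proof (cases "t \<in> {s<..<e}")
  case True
  have "filterlim (\<lambda>n. y / real (n + 2)) (at_right 0) sequentially"
    unfolding filterlim_at
  proof
    show "(\<lambda>n. y / real (n + 2)) \<longlonglongrightarrow> 0"
      using LIMSEQ_ignore_initial_segment[OF lim_const_over_n[of y], of 2] by simp
    show "\<forall>\<^sub>F n in sequentially. y / real (n + 2) \<in> {0<..} \<and> y / real (n + 2) \<noteq> 0"
      using y by auto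
  qed
  then show ?thesis by (rule filterlim_compose[OF tr_tendsto[OF True r]])
next
  case False
  then have "tr r t = 0" unfolding tr_def by (rule if_not_P)
  moreover have "V r (y / real (n + 2), t) = 0" for n
    by (rule V_outside) fact
  ultimately show ?thesis by simp
qed

lemma tr_measurable:
  assumes r: "r = 1 \<or> r = -1"
  shows "tr r \<in> borel_measurable borel"
proof (rule borel_measurable_LIMSEQ_real)
  show "(\<lambda>n. V r (1 / real (n + 2), t)) \<longlonglongrightarrow> tr r t" for t
    by (rule tr_LIMSEQ[OF r]) simp
qed measurable

lemma tr_range:
  assumes r: "r = 1 \<or> r = -1"
  shows "tr r t \<in> {0..1}"
proof (rule closed_sequentially[of "{0..1}" "\<lambda>n. V r (1 / real (n + 2), t)"])
  show "(\<lambda>n. V r (1 / real (n + 2), t)) \<longlonglongrightarrow> tr r t"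
    by (rule tr_LIMSEQ[OF r]) simp
qed (use V_range in auto)

section \<open>The excess functional and integrability in space and time\<close>

definition E :: "real \<Rightarrow> real \<Rightarrow> real" where
  "E k t = (\<integral>x. P k (v (x, t)) \<partial>lborel)"

lemma P_0: "u \<ge> 0 \<Longrightarrow> P 0 u = u"
  by (simp add: P_def)

lemma v_slice: "integrable lborel (\<lambda>x. v (x, t))"
  using sol by (cases "t \<in> {s<..<e}") (auto simp: v_def entropy_solution_def)

lemma v_Pair_measurable [measurable]: "(\<lambda>x. v (x, t)) \<in> borel_measurable borel"
  using v_slice[of t] by auto

lemma P_v_measurable [measurable]: "(\<lambda>p. P k (v p)) \<in> borel_measurable borel"
  by (rule borel_measurable_continuous_comp_unit[OF P_continuous v_measurable v_range])

lemma P_v_slice: "k \<in> {0..1} \<Longrightarrow> integrable lborel (\<lambda>x. P k (v (x, t)))"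
proof (rule Bochner_Integration.integrable_bound[OF v_slice[of t]])
  assume k: "k \<in> {0..1}"
  show "AE x in lborel. norm (P k (v (x, t))) \<le> norm (v (x, t))"
    using v_range k by (auto simp: P_bounds)
  show "(\<lambda>x. P k (v (x, t))) \<in> borel_measurable lborel"
    unfolding P_def by measurable
qed

lemma E_nonneg: "0 \<le> E k t"
  unfolding E_def by (intro integral_nonneg_AE AE_I2 P_bounds)

text \<open>\<open>P k\<close> is 1-Lipschitz, so the continuity of the solution in time with values
  in L1 carries over to the excess.\<close>

lemma E_isCont:
  assumes k: "k \<in> {0..1}" and t: "t \<in> {s<..<e}"
  shows "isCont (E k) t"
proof -
  have "((\<lambda>t'. LINT x|lborel. \<bar>w x t' - w x t\<bar>) \<longlongrightarrow> 0) (at t)"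
    using sol t unfolding entropy_solution_def by blast
  moreover have "\<forall>\<^sub>F t' in at t. norm (E k t' - E k t) \<le> (LINT x|lborel. \<bar>w x t' - w x t\<bar>)"
  proof -
    have "\<forall>\<^sub>F t' in at t. t' \<in> {s<..<e}"
      using t by (intro eventually_at_in_open') auto
    then show ?thesis
    proof eventually_elim
      case (elim t')
      have *: "E k t' - E k t = (\<integral>x. P k (v (x, t')) - P k (v (x, t)) \<partial>lborel)"
        unfolding E_def by (rule Bochner_Integration.integral_diff[symmetric]; rule P_v_slice[OF k])
      have "norm (E k t' - E k t) \<le> (\<integral>x. norm (P k (v (x, t')) - P k (v (x, t))) \<partial>lborel)"
        unfolding * by (rule integral_norm_bound)
      also have "\<dots> \<le> (\<integral>x. \<bar>v (x, t') - v (x, t)\<bar> \<partial>lborel)"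
      proof (rule integral_mono)
        show "integrable lborel (\<lambda>x. norm (P k (v (x, t')) - P k (v (x, t))))"
          by (intro integrable_norm Bochner_Integration.integrable_diff P_v_slice[OF k])
        show "integrable lborel (\<lambda>x. \<bar>v (x, t') - v (x, t)\<bar>)"
          by (intro integrable_abs Bochner_Integration.integrable_diff v_slice)
        show "norm (P k (v (x, t')) - P k (v (x, t))) \<le> \<bar>v (x, t') - v (x, t)\<bar>" for x
          unfolding real_norm_def by (rule P_bounds(3))
      qed
      also have "\<dots> = (LINT x|lborel. \<bar>w x t' - w x t\<bar>)"
        using elim t by (simp only: v_def fst_conv snd_conv if_True)
      finally show ?case .
    qed
  qed
  ultimately have "((\<lambda>t'. E k t' - E k t) \<longlongrightarrow> 0) (at t)"
    by (rule Lim_null_comparison[rotated])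
  then show ?thesis unfolding isCont_def by (rule LIM_zero_cancel)
qed

text \<open>The mass at time \<open>t\<close> is \<open>E 0 t\<close>, which is continuous and so
  bounded on the compact interval \<open>{a..b}\<close>; Tonelli then gives integrability in the
  plane, starting from integrable time slices only.\<close>

lemma v_time_integrable:
  assumes h: "h \<in> borel_measurable borel" "\<And>t. \<bar>h t\<bar> \<le> C" "\<And>t. t \<notin> {a..b} \<Longrightarrow> h t = 0"
    and ab: "s < a" "b < e"
  shows "integrable lborel (\<lambda>p. v p * h (snd p))"
proof -
  note h(1) [measurable]
  have "compact (E 0 ` {a..b})"
    using E_isCont[of 0] ab by (intro compact_continuous_image continuous_at_imp_continuous_on) auto
  then obtain B where "\<forall>x\<in>E 0 ` {a..b}. norm x \<le> B"
    using compact_imp_bounded[of "E 0 ` {a..b}"] unfolding bounded_iff by blast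
  then have B: "\<bar>E 0 t\<bar> \<le> B" if "t \<in> {a..b}" for t
    using that by simp
  have B0: "(\<integral>\<^sup>+ x. ennreal (norm (v (x, t) * h t)) \<partial>lborel) \<le> ennreal (B * C) * indicator {a..b} t" for t
  proof (cases "t \<in> {a..b}")
    case True
    have "(\<integral>\<^sup>+ x. ennreal (norm (v (x, t) * h t)) \<partial>lborel) = ennreal (\<integral>x. norm (v (x, t) * h t) \<partial>lborel)"
      using v_slice by (intro nn_integral_eq_integral) auto
    also have "(\<integral>x. norm (v (x, t) * h t) \<partial>lborel) = E 0 t * \<bar>h t\<bar>"
      using v_range v_slice by (simp add: E_def abs_mult P_0)
    also have "\<dots> \<le> B * C"
      using B[OF True] h(2)[of t] E_nonneg[of 0 t] by (intro mult_mono) auto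
    finally show ?thesis using True by (simp add: ennreal_leI)
  next
    case False
    then show ?thesis using h(3) by simp
  qed
  have "(\<integral>\<^sup>+ p. ennreal (norm (v p * h (snd p))) \<partial>lborel) =
      (\<integral>\<^sup>+ t. \<integral>\<^sup>+ x. ennreal (norm (v (x, t) * h t)) \<partial>lborel \<partial>lborel)"
    unfolding lborel_prod[symmetric]
    by (subst lborel_pair.nn_integral_snd[symmetric]) (simp_all add: lborel_prod)
  also have "\<dots> \<le> (\<integral>\<^sup>+ t. ennreal (B * C) * indicator {a..b} t \<partial>lborel)"
    by (intro nn_integral_mono B0)
  also have "\<dots> < \<infinity>"
    by (simp add: nn_integral_cmult ennreal_mult_less_top emeasure_lborel_Icc_eq)
  finally show ?thesis
    by (intro integrableI_bounded) auto
qed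

lemma V_time_integrable:
  assumes h: "h \<in> borel_measurable borel" "\<And>t. \<bar>h t\<bar> \<le> C" "\<And>t. t \<notin> {a..b} \<Longrightarrow> h t = 0"
    and ab: "s < a" "b < e" and r: "r \<noteq> 0"
  shows "integrable lborel (\<lambda>p. V r p * h (snd p))"
proof -
  note h(1) [measurable]
  have "integrable lborel (\<lambda>p. v ((\<lambda>t. c + \<alpha> * t) (snd p) + r * fst p, snd p) * h (snd ((\<lambda>t. c + \<alpha> * t) (snd p) + r * fst p, snd p)))"
    by (rule integral_shear(2)[THEN iffD1, OF _ _ _ v_time_integrable[OF h ab]]) (use r in auto)
  then show ?thesis by (simp add: V_def)
qed

lemma Q_bound_const:
  assumes "r = 1 \<or> r = -1" "k \<in> {0..1}" "u \<in> {0..1}"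
  shows "\<bar>Q r k u\<bar> \<le> L + \<bar>\<alpha>\<bar>"
  using Q_bound[OF assms] mult_left_le[of u "L + \<bar>\<alpha>\<bar>"] assms L_nonneg by auto

lemma Q_tr_integrable:
  assumes \<psi>: "integrable lborel \<psi>" and r: "r = 1 \<or> r = -1" and k: "k \<in> {0..1}"
  shows "integrable lborel (\<lambda>t. \<psi> t * Q r k (tr r t))"
proof (rule Bochner_Integration.integrable_bound)
  show "integrable lborel (\<lambda>t. (L + \<bar>\<alpha>\<bar>) * \<psi> t)" using \<psi> by simp
  show "AE t in lborel. norm (\<psi> t * Q r k (tr r t)) \<le> norm ((L + \<bar>\<alpha>\<bar>) * \<psi> t)"
  proof (rule AE_I2)
    fix t
    have "\<bar>Q r k (tr r t)\<bar> * \<bar>\<psi> t\<bar> \<le> (L + \<bar>\<alpha>\<bar>) * \<bar>\<psi> t\<bar>"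
      by (intro mult_right_mono Q_bound_const tr_range r k) simp
    then show "norm (\<psi> t * Q r k (tr r t)) \<le> norm ((L + \<bar>\<alpha>\<bar>) * \<psi> t)"
      using L_nonneg by (simp add: abs_mult mult.commute)
  qed
  show "(\<lambda>t. \<psi> t * Q r k (tr r t)) \<in> borel_measurable lborel"
    using borel_measurable_continuous_comp_unit[OF Q_continuous[OF k] tr_measurable[OF r] tr_range[OF r]] \<psi>
    by simp
qed

text \<open>The test functions in space vanish near the curve and near infinity; in the limit the curve
  contributes the flux of the trace.\<close>

lemma trace_inequality:
  assumes \<psi>: "C1_supp \<psi> \<psi>' a b" "s < a" "b < e" "\<And>t. \<psi> t \<ge> 0"
    and r: "r = 1 \<or> r = -1" and k: "k \<in> {0..1}"
  shows "0 \<le> (\<integral>p. indicator {0<..} (fst p) * (P k (V r p) * \<psi>' (snd p)) \<partial>lborel)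
      + (\<integral>t. \<psi> t * Q r k (tr r t) \<partial>lborel)"
proof -
  have r0: "r \<noteq> 0" using r by auto
  note [measurable] = C1_suppD(6,7)[OF \<psi>(1)] Q_V_measurable[OF k] tr_measurable[OF r]
  obtain C where C: "C \<ge> 0" "\<And>t. \<bar>\<psi> t\<bar> \<le> C" "\<And>t. \<bar>\<psi>' t\<bar> \<le> C"
    using C1_supp_bounded[OF \<psi>(1)] by metis
  have V\<psi>: "integrable lborel (\<lambda>p. V r p * \<psi> (snd p))" "integrable lborel (\<lambda>p. V r p * \<psi>' (snd p))"
    using C C1_suppD[OF \<psi>(1)] r0 by (auto intro!: V_time_integrable[OF _ _ _ \<psi>(2,3)])
  \<comment> \<open>The cut-off rises on \<open>[1/(n+2), 2/(n+2)]\<close> and falls on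
    \<open>[n+2, n+3]\<close>, so it tends to the indicator of the open half-line. The offset 2
    keeps the two ramps apart for every \<open>n\<close>.\<close>
  define \<eta> \<eta>' where "\<eta> n y = smoothstep (real (n + 2) * (y - 1 / real (n + 2))) - smoothstep (1 * (y - real (n + 2)))"
    and "\<eta>' n y = real (n + 2) * smoothstep' (real (n + 2) * (y - 1 / real (n + 2))) - 1 * smoothstep' (1 * (y - real (n + 2)))"
    for n :: nat and y :: real
  have [measurable]: "\<eta> n \<in> borel_measurable borel" for n unfolding \<eta>_def by measurable
  have \<eta>: "C1_supp (\<eta> n) (\<eta>' n) (1 / real (n + 2)) (real (n + 3))" for n
  proof -
    have *: "1 / N \<le> 1" if "N \<ge> 2" for N :: real using that by simp
    have "C1_supp (\<lambda>y. smoothstep (N * (y - 1 / N)) - smoothstep (1 * (y - N)))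
        (\<lambda>y. N * smoothstep' (N * (y - 1 / N)) - 1 * smoothstep' (1 * (y - N))) (1 / N) (N + 1)"
      if "N \<ge> 2" for N :: real
      using that *[OF that] by (intro C1_supp_smoothstep_diff; linarith)
    from this[of "real (n + 2)"] show ?thesis unfolding \<eta>_def[abs_def] \<eta>'_def[abs_def]
      by (simp add: add.commute)
  qed
  have \<eta>_nonneg: "\<eta> n y \<ge> 0" for n y
  proof (cases "y \<le> real (n + 2)")
    case True
    then show ?thesis by (simp add: \<eta>_def)
  next
    case False
    then have "real (n + 2) * y \<ge> 2 * 1" by (intro mult_mono) auto
    then show ?thesis by (simp add: \<eta>_def right_diff_distrib)
  qed
  have \<eta>_le: "\<bar>\<eta> n y\<bar> \<le> 1" for n y
    using \<eta>_nonneg[of n y] smoothstep_nonneg[of "1 * (y - real (n + 2))"]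
      smoothstep_le_1[of "real (n + 2) * (y - 1 / real (n + 2))"] unfolding \<eta>_def by linarith
  define K where "K = L + \<bar>\<alpha>\<bar>"
  have K0: "K \<ge> 0" unfolding K_def using L_nonneg by simp
  \<comment> \<open>\<open>?I1\<close> is the bulk term, \<open>?I2\<close> the ramp far away,
    \<open>?I3\<close> the ramp near the curve. \<open>?J3\<close> is \<open>?I3\<close> after
    stretching distances by \<open>n + 2\<close>: its kernel is then fixed, supported in
    \<open>[1, 2]\<close>, and its limit is the trace term.\<close>
  let ?I1 = "\<lambda>n p. P k (V r p) * (\<psi>' (snd p) * \<eta> n (fst p))"
  let ?I2 = "\<lambda>n p. Q r k (V r p) * \<psi> (snd p) * smoothstep' (fst p - real (n + 2))"
  let ?I3 = "\<lambda>n p. Q r k (V r p) * \<psi> (snd p) * (real (n + 2) * smoothstep' (real (n + 2) * fst p - 1))"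
  let ?J3 = "\<lambda>n p. Q r k (V r (fst p / real (n + 2), snd p)) * \<psi> (snd p) * smoothstep' (fst p - 1)"
  have PV: "\<bar>P k (V r p)\<bar> \<le> \<bar>V r p\<bar>" for p
    using P_bounds(1,2)[of k "V r p"] k V_range[of r p] by auto
  have QV: "\<bar>Q r k (V r p)\<bar> \<le> K * V r p" for p
    unfolding K_def by (rule Q_bound[OF r k V_range])
  have Q1: "\<bar>Q r k u\<bar> \<le> K" if "u \<in> {0..1}" for u
    unfolding K_def by (rule Q_bound_const[OF r k that])
  have Vbound: "norm (V r p * x) = V r p * \<bar>x\<bar>" for p x
    using V_range[of r p] by (auto simp: abs_mult)
  have dom1: "AE p in lborel. norm (?I1 n p) \<le> norm (V r p * \<psi>' (snd p))" for n
  proof (rule AE_I2)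
    fix p
    have "\<bar>P k (V r p)\<bar> * (\<bar>\<psi>' (snd p)\<bar> * \<bar>\<eta> n (fst p)\<bar>) \<le> \<bar>V r p\<bar> * (\<bar>\<psi>' (snd p)\<bar> * 1)"
      by (intro mult_mono PV \<eta>_le) auto
    then show "norm (?I1 n p) \<le> norm (V r p * \<psi>' (snd p))" by (simp add: abs_mult)
  qed
  have dom2: "AE p in lborel. norm (?I2 n p) \<le> K * 2 * norm (V r p * \<psi> (snd p))" for n
  proof (rule AE_I2)
    fix p
    have "\<bar>Q r k (V r p)\<bar> * \<bar>\<psi> (snd p)\<bar> * smoothstep' (fst p - real (n + 2)) \<le> (K * V r p) * \<bar>\<psi> (snd p)\<bar> * 2"
      using V_range[of r p] K0 by (intro mult_mono QV smoothstep'_le) auto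
    then show "norm (?I2 n p) \<le> K * 2 * norm (V r p * \<psi> (snd p))"
      unfolding Vbound by (simp add: abs_mult mult_ac)
  qed
  have I1: "(\<lambda>n. \<integral>p. ?I1 n p \<partial>lborel) \<longlonglongrightarrow> (\<integral>p. indicator {0<..} (fst p) * (P k (V r p) * \<psi>' (snd p)) \<partial>lborel)"
  proof (rule integral_dominated_convergence[OF _ _ integrable_norm[OF V\<psi>(2)] _ dom1])
    show "AE p in lborel. (\<lambda>n. ?I1 n p) \<longlonglongrightarrow> indicator {0<..} (fst p) * (P k (V r p) * \<psi>' (snd p))"
    proof (rule AE_I2)
      fix p :: "real \<times> real"
      have "\<forall>\<^sub>F n in sequentially. \<eta> n (fst p) = indicator {0<..} (fst p)"
      proof (cases "fst p > 0")
        case True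
        obtain n0 where n0: "2 / fst p + fst p < real n0" using reals_Archimedean2 by blast
        have "\<eta> n (fst p) = 1" if "n \<ge> n0" for n
        proof -
          have 1: "2 / fst p \<le> real (n + 2)" "fst p \<le> real (n + 2)"
            using n0 that True divide_pos_pos[of 2 "fst p"] by linarith+
          then have "real (n + 2) * fst p \<ge> 2" using True by (simp add: divide_le_eq)
          then show ?thesis using 1 by (simp add: \<eta>_def right_diff_distrib)
        qed
        then show ?thesis using True by (intro eventually_sequentiallyI[of n0]) simp
      next
        case False
        have "\<eta> n (fst p) = 0" for n
          using False C1_suppD(4)[OF \<eta>, of "fst p" n] by (simp add: not_le)
            (smt (verit) divide_pos_pos of_nat_0_le_iff)
        then show ?thesis using False by simp
      qed
      then have "\<forall>\<^sub>F n in sequentially. ?I1 n p = indicator {0<..} (fst p) * (P k (V r p) * \<psi>' (snd p))"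
        by eventually_elim simp
      then show "(\<lambda>n. ?I1 n p) \<longlonglongrightarrow> indicator {0<..} (fst p) * (P k (V r p) * \<psi>' (snd p))"
        by (rule tendsto_eventually)
    qed
  qed measurable
  have I2: "(\<lambda>n. \<integral>p. ?I2 n p \<partial>lborel) \<longlonglongrightarrow> (\<integral>p. 0 \<partial>(lborel :: (real \<times> real) measure))"
  proof (rule integral_dominated_convergence[OF _ _ integrable_mult_right[OF integrable_norm[OF V\<psi>(1)]] _ dom2])
    show "AE p in lborel. (\<lambda>n. ?I2 n p) \<longlonglongrightarrow> 0"
    proof (rule AE_I2)
      fix p :: "real \<times> real"
      obtain n0 where "fst p < real n0" using reals_Archimedean2 by blast
      then have "\<forall>\<^sub>F n in sequentially. ?I2 n p = 0"
        by (intro eventually_sequentiallyI[of n0]) auto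
      then show "(\<lambda>n. ?I2 n p) \<longlonglongrightarrow> 0" by (rule tendsto_eventually)
    qed
  qed measurable
  have int\<psi>: "integrable lborel \<psi>" by (rule C1_supp_integrable[OF \<psi>(1)])
  have ints: "has_bochner_integral lborel (\<lambda>y. smoothstep' (y - 1)) 1"
    using has_bochner_integral_smoothstep' lborel_integrable_real_affine[of smoothstep' 1 "-1"]
      lborel_integral_real_affine[of 1 smoothstep' "-1"]
    by (simp add: has_bochner_integral_iff)
  have J3: "(\<lambda>n. \<integral>p. ?J3 n p \<partial>lborel) \<longlonglongrightarrow> (\<integral>p. (\<psi> (snd p) * Q r k (tr r (snd p))) * smoothstep' (fst p - 1) \<partial>lborel)"
  proof (rule integral_dominated_convergence)
    show "integrable lborel (\<lambda>p. K * (\<psi> (snd p) * smoothstep' (fst p - 1)))"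
      using ints int\<psi> by (intro integrable_mult_right tensor_integral) (auto simp: has_bochner_integral_iff)
    show "AE p in lborel. norm (?J3 n p) \<le> K * (\<psi> (snd p) * smoothstep' (fst p - 1))" for n
      using Q1[OF V_range] \<psi>(4) by (intro AE_I2) (auto simp: abs_mult mult.assoc intro!: mult_right_mono)
    show "AE p in lborel. (\<lambda>n. ?J3 n p) \<longlonglongrightarrow> (\<psi> (snd p) * Q r k (tr r (snd p))) * smoothstep' (fst p - 1)"
    proof (rule AE_I2)
      fix p :: "real \<times> real"
      show "(\<lambda>n. ?J3 n p) \<longlonglongrightarrow> (\<psi> (snd p) * Q r k (tr r (snd p))) * smoothstep' (fst p - 1)"
      proof (cases "fst p > 0")
        case True
        have "(\<lambda>n. Q r k (V r (fst p / real (n + 2), snd p))) \<longlonglongrightarrow> Q r k (tr r (snd p))"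
          by (rule tendsto_continuous_comp_unit[OF Q_continuous[OF k] tr_LIMSEQ[OF r True] V_range tr_range[OF r]])
        then show ?thesis unfolding mult.commute[of "\<psi> (snd p)"]
          by (intro tendsto_intros)
      qed simp
    qed
    have "(\<lambda>p. V r (fst p / real (n + 2), snd p)) \<in> borel_measurable borel" for n
      by (rule measurable_compose[OF _ V_measurable]) (simp add: borel_prod[symmetric])
    from borel_measurable_continuous_comp_unit[OF Q_continuous[OF k] this V_range]
    have [measurable]: "(\<lambda>p. Q r k (V r (fst p / real (n + 2), snd p))) \<in> borel_measurable borel" for n .
    show "?J3 n \<in> borel_measurable lborel" for n by measurable
    have [measurable]: "(\<lambda>p. Q r k (tr r p)) \<in> borel_measurable borel"
      by (rule borel_measurable_continuous_comp_unit[OF Q_continuous[OF k] tr_measurable[OF r] tr_range[OF r]])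
    show "(\<lambda>p. \<psi> (snd p) * Q r k (tr r (snd p)) * smoothstep' (fst p - 1)) \<in> borel_measurable lborel"
      by measurable
  qed
  have int\<psi>Q: "integrable lborel (\<lambda>t. \<psi> t * Q r k (tr r t))"
    by (rule Q_tr_integrable[OF int\<psi> r k])
  have "(\<integral>p. (\<psi> (snd p) * Q r k (tr r (snd p))) * smoothstep' (fst p - 1) \<partial>lborel) = (\<integral>t. \<psi> t * Q r k (tr r t) \<partial>lborel)"
    using tensor_integral(2)[OF _ int\<psi>Q, of "\<lambda>y. smoothstep' (y - 1)"] ints by (simp add: has_bochner_integral_iff)
  note J3 = J3[unfolded this]
  have I3: "(\<integral>p. ?I3 n p \<partial>lborel) = (\<integral>p. ?J3 n p \<partial>lborel)"
    and I3i: "integrable lborel (?I3 n)" for n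
  proof -
    have eq: "?I3 n (1 / real (n + 2) * fst p, snd p) = real (n + 2) * ?J3 n p" for p
      by simp
    have "(\<integral>p. ?I3 n p \<partial>lborel) = \<bar>1 / real (n + 2)\<bar> * (\<integral>p. ?I3 n ((\<lambda>_. 0) (snd p) + 1 / real (n + 2) * fst p, snd p) \<partial>lborel)"
      by (rule integral_shear(1)) (auto simp del: of_nat_add)
    also have "\<dots> = (\<integral>p. ?J3 n p \<partial>lborel)"
      unfolding add_0 eq by simp
    finally show "(\<integral>p. ?I3 n p \<partial>lborel) = (\<integral>p. ?J3 n p \<partial>lborel)" .
    show "integrable lborel (?I3 n)"
    proof (rule Bochner_Integration.integrable_bound[OF integrable_mult_right[OF integrable_norm[OF V\<psi>(1)]]])
      show "AE p in lborel. norm (?I3 n p) \<le> norm (K * (real (n + 2) * 2) * norm (V r p * \<psi> (snd p)))"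
      proof (rule AE_I2)
        fix p
        have "\<bar>Q r k (V r p)\<bar> * \<bar>\<psi> (snd p)\<bar> * (real (n + 2) * smoothstep' (real (n + 2) * fst p - 1)) \<le>
            (K * V r p) * \<bar>\<psi> (snd p)\<bar> * (real (n + 2) * 2)"
          using V_range[of r p] K0 by (intro mult_mono QV smoothstep'_le) auto
        also have "\<dots> = K * (real (n + 2) * 2) * norm (V r p * \<psi> (snd p))"
          unfolding Vbound by (simp add: mult_ac)
        also have "\<dots> \<le> norm \<dots>" by (simp only: real_norm_def abs_ge_self)
        finally show "norm (?I3 n p) \<le> norm (K * (real (n + 2) * 2) * norm (V r p * \<psi> (snd p)))"
          by (simp only: real_norm_def abs_mult abs_of_nonneg smoothstep'_nonneg of_nat_0_le_iff)
      qed
    qed measurable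
  qed
  have "0 \<le> (\<integral>p. ?I1 n p \<partial>lborel) + (\<integral>p. ?J3 n p \<partial>lborel) - (\<integral>p. ?I2 n p \<partial>lborel)" for n
  proof -
    have I1i: "integrable lborel (?I1 n)"
      by (rule Bochner_Integration.integrable_bound[OF V\<psi>(2) _ dom1]) measurable
    have "AE p in lborel. norm (?I2 n p) \<le> norm (K * 2 * norm (V r p * \<psi> (snd p)))"
      using dom2[of n] by eventually_elim (erule order_trans, simp only: real_norm_def abs_ge_self)
    then have I2i: "integrable lborel (?I2 n)"
      by (rule Bochner_Integration.integrable_bound[OF integrable_mult_right[OF integrable_norm[OF V\<psi>(1)]], rotated]) measurable
    have "0 \<le> (\<integral>p. P k (V r p) * (\<psi>' (snd p) * \<eta> n (fst p)) + Q r k (V r p) * (\<psi> (snd p) * \<eta>' n (fst p)) \<partial>lborel)"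
      by (rule half_kruzhkov_sheared[OF \<psi> \<eta> _ \<eta>_nonneg r k]) simp
    also have "\<dots> = (\<integral>p. ?I1 n p + ?I3 n p - ?I2 n p \<partial>lborel)"
      by (intro Bochner_Integration.integral_cong) (simp_all add: \<eta>'_def algebra_simps)
    also have "\<dots> = (\<integral>p. ?I1 n p \<partial>lborel) + (\<integral>p. ?I3 n p \<partial>lborel) - (\<integral>p. ?I2 n p \<partial>lborel)"
      using I1i I2i I3i[of n] by simp
    finally show ?thesis unfolding I3 .
  qed
  moreover have "(\<lambda>n. (\<integral>p. ?I1 n p \<partial>lborel) + (\<integral>p. ?J3 n p \<partial>lborel) - (\<integral>p. ?I2 n p \<partial>lborel))
     \<longlonglongrightarrow> (\<integral>p. indicator {0<..} (fst p) * (P k (V r p) * \<psi>' (snd p)) \<partial>lborel)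
      + (\<integral>t. \<psi> t * Q r k (tr r t) \<partial>lborel) - (\<integral>p. 0 \<partial>(lborel :: (real \<times> real) measure))"
    by (intro tendsto_intros I1 J3 I2)
  ultimately show ?thesis
    by (auto intro: LIMSEQ_le_const)
qed

section \<open>The Rankine-Hugoniot relation at the curve\<close>

definition R :: "real \<Rightarrow> real" where
  "R t = f (tr 1 t) - \<alpha> * tr 1 t + f (tr (-1) t) + \<alpha> * tr (-1) t"

lemma f_tr_measurable:
  assumes r: "r = 1 \<or> r = -1"
  shows "(\<lambda>t. f (tr r t)) \<in> borel_measurable borel"
  by (rule borel_measurable_continuous_comp_unit[OF f_continuous tr_measurable[OF r] tr_range[OF r]])

lemma R_measurable [measurable]: "R \<in> borel_measurable borel"
  unfolding R_def[abs_def]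
  using f_tr_measurable[of 1] f_tr_measurable[of "-1"] tr_measurable[of 1] tr_measurable[of "-1"] by simp

lemma side_bound:
  assumes "u \<in> {0..1}" "\<bar>\<sigma>\<bar> \<le> 1"
  shows "\<bar>\<sigma> * f u - \<alpha> * u\<bar> \<le> L + \<bar>\<alpha>\<bar>"
proof -
  have "\<bar>\<sigma> * f u\<bar> \<le> 1 * L"
    unfolding abs_mult using assms by (intro mult_mono f_bound) auto
  moreover have "\<bar>\<alpha> * u\<bar> \<le> \<bar>\<alpha>\<bar>"
    unfolding abs_mult using assms by (intro mult_left_le) auto
  ultimately show ?thesis
    using abs_triangle_ineq4[of "\<sigma> * f u" "\<alpha> * u"] by linarith
qed

lemma R_bound: "\<bar>R t\<bar> \<le> 2 * (L + \<bar>\<alpha>\<bar>)"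
proof -
  \<comment> \<open>Relative flux on the right minus relative flux on the left, where the flux is
    \<open>- f\<close>.\<close>
  have "R t = (1 * f (tr 1 t) - \<alpha> * tr 1 t) - (- 1 * f (tr (-1) t) - \<alpha> * tr (-1) t)"
    by (simp add: R_def)
  moreover have "\<bar>1 * f (tr 1 t) - \<alpha> * tr 1 t\<bar> \<le> L + \<bar>\<alpha>\<bar>"
    by (rule side_bound) (auto intro: tr_range simp del: atLeastAtMost_iff)
  moreover have "\<bar>- 1 * f (tr (-1) t) - \<alpha> * tr (-1) t\<bar> \<le> L + \<bar>\<alpha>\<bar>"
    by (rule side_bound) (auto intro: tr_range simp del: atLeastAtMost_iff)
  ultimately show ?thesis
    using abs_triangle_ineq4[of "1 * f (tr 1 t) - \<alpha> * tr 1 t" "- 1 * f (tr (-1) t) - \<alpha> * tr (-1) t"]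
    by simp
qed

text \<open>Scaling keeps the side of the curve: \<open>y\<close> at scale \<open>1/(n+2)\<close> is
  the point at distance \<open>\<bar>y\<bar>/(n+2)\<close> on the side \<open>sgn y\<close>.\<close>

lemma V_scaled_LIMSEQ:
  assumes "y \<noteq> 0"
  shows "(\<lambda>n. V (1 / real (n + 2)) (y, t)) \<longlonglongrightarrow> tr (sgn y) t"
proof -
  have "V (1 / real (n + 2)) (y, t) = V (sgn y) (\<bar>y\<bar> / real (n + 2), t)" for n
    by (simp add: V_def sgn_mult_abs)
  moreover have "(\<lambda>n. V (sgn y) (\<bar>y\<bar> / real (n + 2), t)) \<longlonglongrightarrow> tr (sgn y) t"
    by (rule tr_LIMSEQ) (use assms in \<open>auto simp: sgn_if\<close>)
  ultimately show ?thesis by simp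
qed

text \<open>Blow-up of the weak formulation around the curve.\<close>

lemma rankine_hugoniot_integrated:
  assumes \<psi>: "C1_supp \<psi> \<psi>' a b" "s < a" "b < e"
  shows "(\<integral>t. \<psi> t * R t \<partial>lborel) = 0"
proof -
  note [measurable] = C1_suppD(6,7)[OF \<psi>(1)]
  note int\<psi> = C1_supp_integrable[OF \<psi>(1)]
  let ?rn = "\<lambda>n::nat. 1 / real (n + 2)"
  \<comment> \<open>A bump across the curve, rising on \<open>[-1, 0]\<close> and falling on
    \<open>[0, 1]\<close>. Its derivative vanishes at 0, so the curve itself contributes nothing to
    the limit.\<close>
  define \<eta> \<eta>' where "\<eta> y = smoothstep (1 * (y - (-1))) - smoothstep (1 * (y - 0))"
    and "\<eta>' y = 1 * smoothstep' (1 * (y - (-1))) - 1 * smoothstep' (1 * (y - 0))" for y :: real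
  have \<eta>: "C1_supp \<eta> \<eta>' (-1) 1"
    unfolding \<eta>_def[abs_def] \<eta>'_def[abs_def] by (rule C1_supp_smoothstep_diff) auto
  note [measurable] = C1_suppD(6,7)[OF \<eta>]
  note int\<eta> = C1_supp_integrable[OF \<eta>]
  define K where "K = L + \<bar>\<alpha>\<bar>"
  have K: "0 \<le> K" using L_nonneg by (simp add: K_def)
  let ?G = "\<lambda>n p. sgn (fst p) * f (V (?rn n) p) - \<alpha> * V (?rn n) p"
  \<comment> \<open>\<open>?A\<close> vanishes in the limit because of the factor
    \<open>?rn n\<close>; \<open>?B\<close> tends to the left and right relative fluxes, each
    weighted by a ramp derivative of unit mass.\<close>
  let ?A = "\<lambda>n p. ?rn n * V (?rn n) p * (\<psi>' (snd p) * \<eta> (fst p))"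
  let ?B = "\<lambda>n p. ?G n p * (\<psi> (snd p) * \<eta>' (fst p))"
  let ?l = "\<lambda>p. (- 1 * f (tr (-1) (snd p)) - \<alpha> * tr (-1) (snd p)) * \<psi> (snd p) * smoothstep' (fst p + 1)
      - (1 * f (tr 1 (snd p)) - \<alpha> * tr 1 (snd p)) * \<psi> (snd p) * smoothstep' (fst p)"
  have G: "\<bar>?G n p\<bar> \<le> K" for n p
    unfolding K_def by (rule side_bound[OF V_range]) (simp add: sgn_if)
  have zero: "(\<integral>p. ?A n p + ?B n p \<partial>lborel) = 0" for n
    by (rule weak_sheared[OF \<psi> \<eta>]) simp
  have "(\<lambda>n. \<integral>p. ?A n p + ?B n p \<partial>lborel) \<longlonglongrightarrow> (\<integral>p. ?l p \<partial>lborel)"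
  proof (rule integral_dominated_convergence)
    show "integrable lborel (\<lambda>p. \<bar>\<psi>' (snd p) * \<eta> (fst p)\<bar> + K * \<bar>\<psi> (snd p) * \<eta>' (fst p)\<bar>)"
      using tensor_integral(1)[OF int\<eta>(1) int\<psi>(2)] tensor_integral(1)[OF int\<eta>(2) int\<psi>(1)] by simp
    show "AE p in lborel. norm (?A n p + ?B n p) \<le> \<bar>\<psi>' (snd p) * \<eta> (fst p)\<bar> + K * \<bar>\<psi> (snd p) * \<eta>' (fst p)\<bar>" for n
    proof (rule AE_I2)
      fix p
      have "\<bar>?rn n * V (?rn n) p\<bar> \<le> 1 * 1"
        unfolding abs_mult using V_range[of "?rn n" p] by (intro mult_mono) auto
      then have "\<bar>?A n p\<bar> \<le> 1 * \<bar>\<psi>' (snd p) * \<eta> (fst p)\<bar>"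
        unfolding abs_mult[of "?rn n * V (?rn n) p"] by (intro mult_right_mono) auto
      moreover have "\<bar>?B n p\<bar> \<le> K * \<bar>\<psi> (snd p) * \<eta>' (fst p)\<bar>"
        unfolding abs_mult[of "?G n p"] by (intro mult_right_mono G) auto
      ultimately show "norm (?A n p + ?B n p) \<le> \<bar>\<psi>' (snd p) * \<eta> (fst p)\<bar> + K * \<bar>\<psi> (snd p) * \<eta>' (fst p)\<bar>"
        unfolding real_norm_def using abs_triangle_ineq[of "?A n p" "?B n p"] by linarith
    qed
    show "AE p in lborel. (\<lambda>n. ?A n p + ?B n p) \<longlonglongrightarrow> ?l p"
    proof (rule AE_I2)
      fix p :: "real \<times> real"
      obtain y t where p: "p = (y, t)" by (cases p)
      show "(\<lambda>n. ?A n p + ?B n p) \<longlonglongrightarrow> ?l p"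
      proof (cases "y = 0")
        case True
        have V0: "V r (0, t) = v (c + \<alpha> * t, t)" for r
          by (simp add: V_def)
        have "(\<lambda>n. ?rn n * (v (c + \<alpha> * t, t) * (\<psi>' t * \<eta> 0))) \<longlonglongrightarrow> 0 * (v (c + \<alpha> * t, t) * (\<psi>' t * \<eta> 0))"
          using LIMSEQ_ignore_initial_segment[OF lim_const_over_n[of 1], of 2] by (intro tendsto_intros) simp
        moreover have "\<eta>' 0 = 0" by (simp add: \<eta>'_def)
        ultimately show ?thesis by (simp add: p True V0)
      next
        case False
        have V: "(\<lambda>n. V (?rn n) p) \<longlonglongrightarrow> tr (sgn y) t"
          unfolding p by (rule V_scaled_LIMSEQ[OF False])
        have f: "(\<lambda>n. f (V (?rn n) p)) \<longlonglongrightarrow> f (tr (sgn y) t)"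
          by (rule tendsto_continuous_comp_unit[OF f_continuous V V_range tr_range]) (use False in \<open>auto simp: sgn_if\<close>)
        have "(\<lambda>n. ?A n p + ?B n p) \<longlonglongrightarrow> 0 * tr (sgn y) t * (\<psi>' (snd p) * \<eta> (fst p)) +
            (sgn (fst p) * f (tr (sgn y) t) - \<alpha> * tr (sgn y) t) * (\<psi> (snd p) * \<eta>' (fst p))"
          using LIMSEQ_ignore_initial_segment[OF lim_const_over_n[of 1], of 2]
          by (intro tendsto_intros V f) simp
        also have "0 * tr (sgn y) t * (\<psi>' (snd p) * \<eta> (fst p)) +
            (sgn (fst p) * f (tr (sgn y) t) - \<alpha> * tr (sgn y) t) * (\<psi> (snd p) * \<eta>' (fst p)) = ?l p"
          using False by (simp add: p \<eta>'_def sgn_if)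
        finally show ?thesis .
      qed
    qed
    show "(\<lambda>p. ?A n p + ?B n p) \<in> borel_measurable lborel" for n by measurable
    note [measurable] = f_tr_measurable[of 1] f_tr_measurable[of "-1"] tr_measurable[of 1] tr_measurable[of "-1"]
    show "?l \<in> borel_measurable lborel" by measurable
  qed
  then have "(\<integral>p. ?l p \<partial>lborel) = 0"
    unfolding zero by (simp add: LIMSEQ_const_iff)
  have ints: "integrable lborel smoothstep'" "(\<integral>y. smoothstep' y \<partial>lborel) = 1"
    "integrable lborel (\<lambda>y. smoothstep' (y + 1))" "(\<integral>y. smoothstep' (y + 1) \<partial>lborel) = 1"
    using has_bochner_integral_smoothstep' lborel_integrable_real_affine[of smoothstep' 1 1]
      lborel_integral_real_affine[of 1 smoothstep' 1]
    by (simp_all add: has_bochner_integral_iff add.commute)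
  have int: "integrable lborel (\<lambda>t. (\<sigma> * f (tr \<sigma> t) - \<alpha> * tr \<sigma> t) * \<psi> t)" if \<sigma>: "\<sigma> = 1 \<or> \<sigma> = -1" for \<sigma>
  proof (rule Bochner_Integration.integrable_bound)
    show "integrable lborel (\<lambda>t. K * \<psi> t)" using int\<psi> by simp
    show "AE t in lborel. norm ((\<sigma> * f (tr \<sigma> t) - \<alpha> * tr \<sigma> t) * \<psi> t) \<le> norm (K * \<psi> t)"
    proof (rule AE_I2)
      fix t
      have "\<bar>\<sigma> * f (tr \<sigma> t) - \<alpha> * tr \<sigma> t\<bar> \<le> K"
        unfolding K_def by (rule side_bound[OF tr_range[OF \<sigma>]]) (use \<sigma> in auto)
      then show "norm ((\<sigma> * f (tr \<sigma> t) - \<alpha> * tr \<sigma> t) * \<psi> t) \<le> norm (K * \<psi> t)"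
        using K by (simp add: abs_mult mult_right_mono)
    qed
    note [measurable] = f_tr_measurable[OF \<sigma>] tr_measurable[OF \<sigma>]
    show "(\<lambda>t. (\<sigma> * f (tr \<sigma> t) - \<alpha> * tr \<sigma> t) * \<psi> t) \<in> borel_measurable lborel" by measurable
  qed
  have "(\<integral>p. ?l p \<partial>lborel) = (\<integral>t. (- 1 * f (tr (-1) t) - \<alpha> * tr (-1) t) * \<psi> t \<partial>lborel)
      - (\<integral>t. (1 * f (tr 1 t) - \<alpha> * tr 1 t) * \<psi> t \<partial>lborel)"
    using tensor_integral[OF ints(3) int[of "-1"]] tensor_integral[OF ints(1) int[of 1]] ints by simp
  also have "\<dots> = (\<integral>t. - (\<psi> t * R t) \<partial>lborel)"
    using int[of "-1"] int[of 1]
    by (subst Bochner_Integration.integral_diff[symmetric])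
      (auto intro!: Bochner_Integration.integral_cong simp: R_def algebra_simps)
  finally show ?thesis
    using \<open>(\<integral>p. ?l p \<partial>lborel) = 0\<close> by simp
qed

text \<open>Ramps of vanishing width turn the integrated relation into vanishing integrals of
  \<open>R\<close> over half-open intervals, which forces \<open>R\<close> to vanish almost
  everywhere.\<close>

lemma rankine_hugoniot:
  assumes ab: "s < a" "b < e"
  shows "AE t in lborel. t \<in> {a<..b} \<longrightarrow> R t = 0"
proof -
  have int: "integrable lborel (\<lambda>t. indicator {c<..d} t * R t)" for c d
  proof (rule Bochner_Integration.integrable_bound)
    show "integrable lborel (\<lambda>t. 2 * (L + \<bar>\<alpha>\<bar>) * indicator {c..d} t)"
      by (intro integrable_mult_right integrable_real_indicator) (auto simp: emeasure_lborel_Icc_eq)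
    show "AE t in lborel. norm (indicator {c<..d} t * R t) \<le> norm (2 * (L + \<bar>\<alpha>\<bar>) * indicator {c..d} t)"
      using R_bound L_nonneg by (intro AE_I2) (auto simp: indicator_def intro: order_trans)
  qed measurable
  have "(\<integral>t. indicator {c<..d} t * R t \<partial>lborel) = 0" if cd: "s < c" "d < e" for c d
  proof (cases "c \<le> d")
    case True
    \<comment> \<open>The shift by \<open>n0\<close> makes the downward ramp, which begins at
      \<open>d\<close>, end before the strip does.\<close>
    obtain n0 :: nat where n0: "1 / (e - d) < real n0" using reals_Archimedean2 by blast
    define N where "N n = real (n + n0 + 1)" for n
    define g where "g n t = smoothstep (N n * (t - c)) - smoothstep (N n * (t - d))" for n t
    have N: "N n \<ge> 1" "1 / N n < e - d" for n
    proof -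
      show "N n \<ge> 1" by (simp add: N_def)
      have "1 / (e - d) < N n" using n0 by (simp add: N_def)
      then show "1 / N n < e - d" using cd \<open>N n \<ge> 1\<close> by (simp add: field_simps)
    qed
    have zero: "(\<integral>t. g n t * R t \<partial>lborel) = 0" for n
    proof (rule rankine_hugoniot_integrated)
      show "C1_supp (g n) (\<lambda>t. N n * smoothstep' (N n * (t - c)) - N n * smoothstep' (N n * (t - d))) c (d + 1 / N n)"
        unfolding g_def using N[of n] True by (intro C1_supp_smoothstep_diff) auto
    qed (use cd N[of n] in auto)
    have "(\<lambda>n. \<integral>t. g n t * R t \<partial>lborel) \<longlonglongrightarrow> (\<integral>t. indicator {c<..d} t * R t \<partial>lborel)"
    proof (rule integral_dominated_convergence)
      show "integrable lborel (\<lambda>t. 2 * (L + \<bar>\<alpha>\<bar>) * indicator {c..d + 1} t)"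
        by (intro integrable_mult_right integrable_real_indicator) (auto simp: emeasure_lborel_Icc_eq)
      show "AE t in lborel. norm (g n t * R t) \<le> 2 * (L + \<bar>\<alpha>\<bar>) * indicator {c..d + 1} t" for n
      proof (rule AE_I2)
        fix t
        show "norm (g n t * R t) \<le> 2 * (L + \<bar>\<alpha>\<bar>) * indicator {c..d + 1} t"
        proof (cases "t \<in> {c..d + 1}")
          case True
          have "\<bar>g n t\<bar> \<le> 1"
            using smoothstep_nonneg[of "N n * (t - c)"] smoothstep_nonneg[of "N n * (t - d)"]
              smoothstep_le_1[of "N n * (t - c)"] smoothstep_le_1[of "N n * (t - d)"]
            unfolding g_def by linarith
          then have "\<bar>g n t\<bar> * \<bar>R t\<bar> \<le> 1 * (2 * (L + \<bar>\<alpha>\<bar>))"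
            using R_bound by (intro mult_mono) auto
          then show ?thesis using True by (simp add: abs_mult)
        next
          case False
          have "g n t = 0"
          proof (cases "t < c")
            case True
            then have "N n * (t - c) \<le> 0" "N n * (t - d) \<le> 0"
              using N(1)[of n] \<open>c \<le> d\<close> by (auto simp: mult_le_0_iff)
            then show ?thesis by (simp add: g_def)
          next
            case 2: False
            then have "1 * 1 \<le> N n * (t - c)" "1 * 1 \<le> N n * (t - d)"
              using N(1)[of n] \<open>c \<le> d\<close> False
              by (intro mult_mono; force)+
            then show ?thesis by (simp add: g_def)
          qed
          then show ?thesis using L_nonneg by simp
        qed
      qed
      show "AE t in lborel. (\<lambda>n. g n t * R t) \<longlonglongrightarrow> indicator {c<..d} t * R t"
      proof (rule AE_I2)
        fix t
        \<comment> \<open>As \<open>smoothstep 0 = 0\<close>, the limit at \<open>x = 0\<close> is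
          0. The difference of two ramps thus converges at every point, and its limit is the
          indicator of a left-open, right-closed interval.\<close>
        have *: "\<forall>\<^sub>F n in sequentially. smoothstep (N n * x) = indicator {0<..} x" for x
        proof (cases "x > 0")
          case True
          obtain n1 :: nat where n1: "1 / x < real n1" using reals_Archimedean2 by blast
          have "N n * x \<ge> 1" if "n \<ge> n1" for n
          proof -
            have "1 / x < N n" using n1 that by (simp add: N_def)
            then show ?thesis using True by (simp add: field_simps)
          qed
          then show ?thesis using True by (intro eventually_sequentiallyI[of n1]) simp
        next
          case False
          then have "N n * x \<le> 0" for n using N(1)[of n] by (auto simp: mult_le_0_iff)
          then show ?thesis using False by simp
        qed
        have "\<forall>\<^sub>F n in sequentially. g n t * R t = indicator {c<..d} t * R t"
          using *[of "t - c"] *[of "t - d"]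
          by eventually_elim (use True in \<open>auto simp: g_def indicator_def\<close>)
        then show "(\<lambda>n. g n t * R t) \<longlonglongrightarrow> indicator {c<..d} t * R t"
          by (rule tendsto_eventually)
      qed
      show "(\<lambda>t. g n t * R t) \<in> borel_measurable lborel" for n
        unfolding g_def by measurable
    qed measurable
    then show ?thesis unfolding zero by (simp add: LIMSEQ_const_iff)
  qed simp
  note 0 = this
  have "AE t in lborel. indicator {a<..b} t * R t = 0"
  proof (rule AE_eq_0_if_interval_integrals_0[OF int])
    fix c d :: real
    have eq: "indicator {c<..d} t * (indicator {a<..b} t * R t) = indicator {max c a<..min d b} t * R t" for t
      by (auto simp: indicator_def)
    show "(\<integral>t. indicator {c<..d} t * (indicator {a<..b} t * R t) \<partial>lborel) = 0"
      unfolding eq by (rule 0) (use ab in auto)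
  qed
  then show ?thesis by eventually_elim (auto simp: indicator_def split: if_splits)
qed

text \<open>Let \<open>a\<close> and \<open>b\<close> be the left and right traces. If only
  \<open>b\<close> exceeds \<open>k\<close>, then \<open>f b - \<alpha> * b = - f a - \<alpha> * a
  \<le> f a - \<alpha> * a\<close> by \<open>f a \<ge> 0\<close>; hence
  \<open>f b - \<alpha> * b\<close> is the minimum of the concave function
  \<open>\<lambda>u. f u - \<alpha> * u\<close> on \<open>{a..b}\<close> and lies below its value at
  \<open>k\<close>. The case with only \<open>a\<close> above \<open>k\<close> is its mirror image,
  with \<open>\<alpha>\<close> negated.\<close>

lemma flux_dissipation:
  assumes f: "concave_on {0..1} f" "\<And>u. u \<in> {0..1} \<Longrightarrow> 0 \<le> f u"
    and k: "k \<in> {0..1}" and R: "R t = 0"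
  shows "Q 1 k (tr 1 t) + Q (-1) k (tr (-1) t) \<le> 0"
proof -
  let ?b = "tr 1 t" and ?a = "tr (-1) t"
  have ab: "?a \<in> {0..1}" "?b \<in> {0..1}" using tr_range by auto
  have R: "f ?b - \<alpha> * ?b + f ?a + \<alpha> * ?a = 0" using R by (simp add: R_def)
  have pos: "0 \<le> f ?a" "0 \<le> f ?b" "0 \<le> f k" using f(2) ab k by blast+
  consider "?a \<le> k" "?b \<le> k" | "?a \<le> k" "k < ?b" | "k < ?a" "?b \<le> k" | "k < ?a" "k < ?b"
    by linarith
  then show ?thesis
  proof cases
    case 1
    then show ?thesis by (simp add: Q_def max_absorb2)
  next
    case 2
    have "f ?b - \<alpha> * ?b \<le> f k - \<alpha> * k"
      by (rule concave_on_diff_linear_between[OF f(1) ab]) (use 2 R pos in auto)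
    with 2 show ?thesis by (simp add: Q_def max_absorb1 max_absorb2 algebra_simps)
  next
    case 3
    have "f ?a - (- \<alpha>) * ?a \<le> f k - (- \<alpha>) * k"
      by (rule concave_on_diff_linear_between[OF f(1) ab(2,1)]) (use 3 R pos in auto)
    with 3 show ?thesis by (simp add: Q_def max_absorb1 max_absorb2 algebra_simps)
  next
    case 4
    \<comment> \<open>All terms in the traces cancel by the Rankine-Hugoniot relation, and
      \<open>- 2 * f k\<close> remains.\<close>
    then show ?thesis using R pos by (simp add: Q_def max_absorb1 algebra_simps)
  qed
qed

section \<open>Decay of the excess and the maximum principle\<close>

lemma integral_excess:
  assumes \<psi>: "C1_supp \<psi> \<psi>' a b" "s < a" "b < e" and k: "k \<in> {0..1}"
  shows "integrable lborel (\<lambda>p. P k (v p) * \<psi>' (snd p))"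
    and "integrable lborel (\<lambda>t. \<psi>' t * E k t)"
    and "(\<integral>t. \<psi>' t * E k t \<partial>lborel) = (\<integral>p. P k (v p) * \<psi>' (snd p) \<partial>lborel)"
proof -
  note [measurable] = C1_suppD(6,7)[OF \<psi>(1)]
  obtain C where C: "\<And>t. \<bar>\<psi>' t\<bar> \<le> C" using C1_supp_bounded[OF \<psi>(1)] by metis
  show int: "integrable lborel (\<lambda>p. P k (v p) * \<psi>' (snd p))"
  proof (rule Bochner_Integration.integrable_bound)
    show "integrable lborel (\<lambda>p. v p * \<psi>' (snd p))"
      by (rule v_time_integrable[OF _ C _ \<psi>(2,3)]) (use C1_suppD(5)[OF \<psi>(1)] in auto)
    show "AE p in lborel. norm (P k (v p) * \<psi>' (snd p)) \<le> norm (v p * \<psi>' (snd p))"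
    proof (rule AE_I2)
      fix p
      have "\<bar>P k (v p)\<bar> \<le> \<bar>v p\<bar>"
        using P_bounds(1,2)[of k "v p"] k v_range[of p] by auto
      then show "norm (P k (v p) * \<psi>' (snd p)) \<le> norm (v p * \<psi>' (snd p))"
        by (simp add: abs_mult mult_right_mono)
    qed
  qed measurable
  have int': "integrable (lborel \<Otimes>\<^sub>M lborel) (\<lambda>(x, t). P k (v (x, t)) * \<psi>' t)"
    using int by (simp add: lborel_prod split_beta')
  have slice: "(\<integral>x. P k (v (x, t)) * \<psi>' t \<partial>lborel) = \<psi>' t * E k t" for t
    by (simp add: E_def mult.commute)
  show "integrable lborel (\<lambda>t. \<psi>' t * E k t)"
    using lborel_pair.integrable_snd[OF int'] by (simp only: slice)
  show "(\<integral>t. \<psi>' t * E k t \<partial>lborel) = (\<integral>p. P k (v p) * \<psi>' (snd p) \<partial>lborel)"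
    using lborel_pair.integral_snd[OF int'] by (simp only: slice lborel_prod split_beta' prod.collapse)
qed

text \<open>After the shear the curve is the null set \<open>fst p = 0\<close>; the half-plane to
  its left is reflected so that both parts match the two trace inequalities.\<close>

lemma split_along_curve:
  assumes \<psi>: "C1_supp \<psi> \<psi>' a b" "s < a" "b < e" and k: "k \<in> {0..1}"
  shows "(\<integral>p. P k (v p) * \<psi>' (snd p) \<partial>lborel) =
    (\<integral>p. indicator {0<..} (fst p) * (P k (V 1 p) * \<psi>' (snd p)) \<partial>lborel) +
    (\<integral>p. indicator {0<..} (fst p) * (P k (V (-1) p) * \<psi>' (snd p)) \<partial>lborel)"
proof -
  note [measurable] = C1_suppD(6,7)[OF \<psi>(1)]
  let ?F = "\<lambda>p. P k (V 1 p) * \<psi>' (snd p)"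
  have F [measurable]: "?F \<in> borel_measurable borel" by measurable
  have eq: "P k (v ((\<lambda>t. c + \<alpha> * t) (snd p) + 1 * fst p, snd p)) * \<psi>' (snd ((\<lambda>t. c + \<alpha> * t) (snd p) + 1 * fst p, snd p)) = ?F p" for p
    by (simp add: V_def)
  have int: "integrable lborel ?F"
    using integral_shear(2)[of "\<lambda>t. c + \<alpha> * t" "\<lambda>p. P k (v p) * \<psi>' (snd p)" 1] integral_excess(1)[OF \<psi> k]
    unfolding eq by simp
  have "(\<integral>p. P k (v p) * \<psi>' (snd p) \<partial>lborel) = (\<integral>p. ?F p \<partial>lborel)"
    using integral_shear(1)[of "\<lambda>t. c + \<alpha> * t" "\<lambda>p. P k (v p) * \<psi>' (snd p)" 1] unfolding eq by simp
  also have "\<dots> = (\<integral>p. indicator {0<..} (fst p) * ?F p + indicator {..<0} (fst p) * ?F p \<partial>lborel)"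
  proof (rule integral_cong_AE)
    have "AE p in (lborel :: real measure) \<Otimes>\<^sub>M (lborel :: real measure). fst p \<noteq> 0"
    proof (rule lborel_pair.AE_pair_measure)
      show "AE x in lborel. AE y in lborel. fst (x, y) \<noteq> (0::real)"
        using AE_lborel_singleton[of "0::real"] by eventually_elim simp
    qed measurable
    then have "AE p in (lborel :: (real \<times> real) measure). fst p \<noteq> 0"
      unfolding lborel_prod .
    then show "AE p in lborel. ?F p = indicator {0<..} (fst p) * ?F p + indicator {..<0} (fst p) * ?F p"
      by eventually_elim (auto simp: indicator_def)
  qed measurable
  also have "\<dots> = (\<integral>p. indicator {0<..} (fst p) * ?F p \<partial>lborel) + (\<integral>p. indicator {..<0} (fst p) * ?F p \<partial>lborel)"
  proof (rule Bochner_Integration.integral_add)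
    show "integrable lborel (\<lambda>p. indicator {0<..} (fst p) * ?F p)"
      by (rule Bochner_Integration.integrable_bound[OF int]) (auto simp: indicator_def)
    show "integrable lborel (\<lambda>p. indicator {..<0} (fst p) * ?F p)"
      by (rule Bochner_Integration.integrable_bound[OF int]) (auto simp: indicator_def)
  qed
  also have "(\<integral>p. indicator {..<0} (fst p) * ?F p \<partial>lborel) =
      (\<integral>p. indicator {0<..} (fst p) * (P k (V (-1) p) * \<psi>' (snd p)) \<partial>lborel)"
  proof -
    have eq: "indicator {..<0} (fst ((\<lambda>_. 0) (snd p) + (-1) * fst p, snd p)) * ?F ((\<lambda>_. 0) (snd p) + (-1) * fst p, snd p) =
      indicator {0<..} (fst p) * (P k (V (-1) p) * \<psi>' (snd p))" for p
      by (auto simp: V_def indicator_def)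
    show ?thesis
      using integral_shear(1)[of "\<lambda>_. 0" "\<lambda>p. indicator {..<0} (fst p) * ?F p" "-1"] unfolding eq by simp
  qed
  finally show ?thesis .
qed

text \<open>Adding the trace inequalities of the two sides leaves the interface term, which is
  nonpositive almost everywhere. Over all such \<open>\<psi>\<close> this says that
  \<open>E k\<close> is nonincreasing in the sense of distributions.\<close>

lemma excess_decreasing:
  assumes f: "concave_on {0..1} f" "\<And>u. u \<in> {0..1} \<Longrightarrow> 0 \<le> f u"
    and \<psi>: "C1_supp \<psi> \<psi>' a b" "s < a" "b < e" "\<And>t. \<psi> t \<ge> 0" and k: "k \<in> {0..1}"
  shows "0 \<le> (\<integral>t. \<psi>' t * E k t \<partial>lborel)"
proof -
  note int = C1_supp_integrable(1)[OF \<psi>(1)]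
  have "0 \<le> (\<integral>t. \<psi>' t * E k t \<partial>lborel) + ((\<integral>t. \<psi> t * Q 1 k (tr 1 t) \<partial>lborel) + (\<integral>t. \<psi> t * Q (-1) k (tr (-1) t) \<partial>lborel))"
    using trace_inequality[OF \<psi>, of 1 k] trace_inequality[OF \<psi>, of "-1" k] k
    unfolding integral_excess(3)[OF \<psi>(1,2,3) k] split_along_curve[OF \<psi>(1,2,3) k] by linarith
  also have "(\<integral>t. \<psi> t * Q 1 k (tr 1 t) \<partial>lborel) + (\<integral>t. \<psi> t * Q (-1) k (tr (-1) t) \<partial>lborel) \<le> 0"
  proof -
    have i: "integrable lborel (\<lambda>t. \<psi> t * Q 1 k (tr 1 t))" "integrable lborel (\<lambda>t. \<psi> t * Q (-1) k (tr (-1) t))"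
      by (rule Q_tr_integrable[OF int _ k]; simp)+
    \<comment> \<open>The relation is available on left-open intervals; starting halfway between
      \<open>s\<close> and \<open>a\<close> covers all of \<open>{a..b}\<close>.\<close>
    have "AE t in lborel. t \<in> {(s + a) / 2<..b} \<longrightarrow> R t = 0"
      by (rule rankine_hugoniot) (use \<psi> in auto)
    then have "AE t in lborel. \<psi> t * Q 1 k (tr 1 t) + \<psi> t * Q (-1) k (tr (-1) t) \<le> 0"
    proof eventually_elim
      case (elim t)
      show ?case
      proof (cases "t \<in> {a..b}")
        case True
        then have "R t = 0" using elim \<psi> by auto
        from flux_dissipation[OF f k this] have "\<psi> t * (Q 1 k (tr 1 t) + Q (-1) k (tr (-1) t)) \<le> 0"
          using \<psi>(4) by (intro mult_nonneg_nonpos)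
        then show ?thesis by (simp add: distrib_left)
      next
        case False
        then show ?thesis using C1_suppD(4)[OF \<psi>(1)] by simp
      qed
    qed
    then have "(\<integral>t. \<psi> t * Q 1 k (tr 1 t) + \<psi> t * Q (-1) k (tr (-1) t) \<partial>lborel) \<le> (\<integral>t. 0 \<partial>(lborel :: real measure))"
      using i by (intro integral_mono_AE) auto
    then show ?thesis using i by simp
  qed
  finally show ?thesis by simp
qed

text \<open>Where the datum is at most \<open>k\<close>, any excess of the solution above
  \<open>k\<close> is at most its distance to the datum, which tends to 0 in L1.\<close>

lemma excess_initial:
  assumes se: "s < e" and w0: "\<And>x. w0 x \<le> k" and k: "k \<in> {0..1}"
  shows "(E k \<longlongrightarrow> 0) (at_right s)"
proof (rule Lim_null_comparison)
  show "((\<lambda>t. LINT x|lborel. \<bar>w x t - w0 x\<bar>) \<longlongrightarrow> 0) (at_right s)"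
    using sol unfolding entropy_solution_def by blast
  show "\<forall>\<^sub>F t in at_right s. norm (E k t) \<le> (LINT x|lborel. \<bar>w x t - w0 x\<bar>)"
  proof -
    have "\<forall>\<^sub>F t in at_right s. t \<in> {s<..<e}"
      using se by (rule eventually_at_right_real)
    then show ?thesis
    proof eventually_elim
      case (elim t)
      have w: "integrable lborel (\<lambda>x. w x t)" "integrable lborel w0"
        using sol elim unfolding entropy_solution_def by blast+
      have "E k t \<le> (LINT x|lborel. \<bar>w x t - w0 x\<bar>)"
        unfolding E_def
      proof (rule integral_mono[OF P_v_slice[OF k]])
        show "P k (v (x, t)) \<le> \<bar>w x t - w0 x\<bar>" for x
          using w0[of x] elim by (auto simp: P_def v_def max_def)
      qed (use w in auto)
      then show ?case using E_nonneg[of k t] by simp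
    qed
  qed
qed

text \<open>Tested with a plateau in time, the weak monotonicity compares an average of
  \<open>E k\<close> just after \<open>s\<close> with one just before \<open>t0\<close>. Positive
  excess at \<open>t0\<close> would make the second at least twice a bound for the first.\<close>

lemma excess_eq_0:
  assumes f: "concave_on {0..1} f" "\<And>u. u \<in> {0..1} \<Longrightarrow> 0 \<le> f u"
    and w0: "\<And>x. w0 x \<le> k" and k: "k \<in> {0..1}" and t0: "t0 \<in> {s<..<e}"
  shows "E k t0 = 0"
proof (rule ccontr)
  assume "E k t0 \<noteq> 0"
  define q where "q = E k t0"
  have q: "q > 0" using \<open>E k t0 \<noteq> 0\<close> E_nonneg[of k t0] by (simp add: q_def)
  have "(E k \<longlongrightarrow> q) (at t0)"
    using E_isCont[OF k t0] by (simp add: isCont_def q_def)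
  then have "\<forall>\<^sub>F t in at t0. 2 * q / 3 < E k t"
    by (rule order_tendstoD) (use q in simp)
  then obtain d1 where d1: "d1 > 0" "\<And>t. t \<noteq> t0 \<Longrightarrow> dist t t0 < d1 \<Longrightarrow> 2 * q / 3 < E k t"
    unfolding eventually_at by auto
  have "s < e" using t0 by auto
  have "\<forall>\<^sub>F t in at_right s. E k t < q / 3"
    by (rule order_tendstoD(2)[OF excess_initial[OF \<open>s < e\<close> w0 k]]) (use q in simp)
  then obtain d2 where d2: "d2 > s" "\<And>t. s < t \<Longrightarrow> t < d2 \<Longrightarrow> E k t < q / 3"
    unfolding eventually_at_right_field by auto
  \<comment> \<open>The averages run over \<open>(s + h, s + 2 * h)\<close> and
    \<open>(t0 - h, t0)\<close>. The choice of \<open>h\<close> puts the first where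
    \<open>E k < q / 3\<close>, the second where \<open>E k > 2 * q / 3\<close>, and the first
    before the second; starting at \<open>s + h\<close> keeps the test function inside the open
    strip.\<close>
  define h where "h = min (d1 / 2) (min ((d2 - s) / 3) ((t0 - s) / 4))"
  have h: "h > 0" "h < d1" "s + 2 * h < d2" "3 * h < t0 - s"
  proof -
    have "h \<le> d1 / 2" "h \<le> (d2 - s) / 3" "h \<le> (t0 - s) / 4" by (simp_all only: h_def min.cobounded1 min.cobounded2 min.coboundedI2)
    moreover show "h > 0" using d1(1) d2(1) t0 by (auto simp: h_def)
    ultimately show "h < d1" "s + 2 * h < d2" "3 * h < t0 - s" using d1(1) d2(1) t0 by auto
  qed
  define a c' where "a = s + h" and "c' = t0 - h"
  define p where "p u t = 1 / h * smoothstep' (1 / h * (t - u))" for u t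
  define \<psi> where "\<psi> t = smoothstep (1 / h * (t - a)) - smoothstep (1 / h * (t - c'))" for t
  have \<psi>: "C1_supp \<psi> (\<lambda>t. p a t - p c' t) a t0"
    unfolding \<psi>_def[abs_def] p_def by (rule C1_supp_smoothstep_diff) (use h in \<open>auto simp: a_def c'_def\<close>)
  have \<psi>0: "\<psi> t \<ge> 0" for t
    unfolding \<psi>_def diff_ge_0_iff_ge
    by (intro smoothstep_mono mult_left_mono) (use h in \<open>auto simp: a_def c'_def\<close>)
  have p0: "p u t \<ge> 0" for u t using h by (simp add: p_def)
  have p_out: "p u t = 0" if "t \<notin> {u<..<u + h}" for u t
  proof -
    have "1 / h * (t - u) \<le> 0 \<or> 1 \<le> 1 / h * (t - u)"
      using that h by (auto simp: field_simps)
    then show ?thesis unfolding p_def by simp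
  qed
  have pint: "integrable lborel (p u)" "(\<integral>t. p u t \<partial>lborel) = 1" for u
  proof -
    have *: "- u / h + 1 / h * t = 1 / h * (t - u)" for t
      using h by (simp add: field_simps)
    have s: "integrable lborel smoothstep'" "(\<integral>t. smoothstep' t \<partial>lborel) = 1"
      using has_bochner_integral_smoothstep' by (auto simp: has_bochner_integral_iff)
    have "integrable lborel (\<lambda>t. smoothstep' (- u / h + 1 / h * t))"
      by (rule lborel_integrable_real_affine[OF s(1)]) (use h in simp)
    then show "integrable lborel (p u)" unfolding * p_def by simp
    have "(\<integral>t. smoothstep' t \<partial>lborel) = \<bar>1 / h\<bar> *\<^sub>R (\<integral>t. smoothstep' (- u / h + 1 / h * t) \<partial>lborel)"
      by (rule lborel_integral_real_affine) (use h in simp)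
    then show "(\<integral>t. p u t \<partial>lborel) = 1"
      using h unfolding * s(2) p_def by simp
  qed
  have \<psi>e: "C1_supp \<psi> (\<lambda>t. p a t - p c' t) a t0" "s < a" "t0 < e"
    using \<psi> h t0 by (auto simp: a_def)
  have "0 \<le> (\<integral>t. (p a t - p c' t) * E k t \<partial>lborel)"
    by (rule excess_decreasing[OF f \<psi>e \<psi>0 k])
  also have "\<dots> \<le> (\<integral>t. q / 3 * p a t - 2 * q / 3 * p c' t \<partial>lborel)"
  proof (rule integral_mono[OF integral_excess(2)[OF \<psi>e k]])
    show "integrable lborel (\<lambda>t. q / 3 * p a t - 2 * q / 3 * p c' t)"
      using pint by simp
    fix t
    have "p a t * E k t \<le> p a t * (q / 3)"
    proof (cases "t \<in> {a<..<a + h}")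
      case True
      then have "E k t < q / 3" using h by (intro d2(2)) (auto simp: a_def)
      then show ?thesis using p0 by (intro mult_left_mono) auto
    qed (simp add: p_out)
    moreover have "p c' t * (2 * q / 3) \<le> p c' t * E k t"
    proof (cases "t \<in> {c'<..<c' + h}")
      case True
      then have "2 * q / 3 < E k t" using h by (intro d1(2)) (auto simp: c'_def dist_real_def)
      then show ?thesis using p0 by (intro mult_left_mono) auto
    qed (simp add: p_out)
    ultimately show "(p a t - p c' t) * E k t \<le> q / 3 * p a t - 2 * q / 3 * p c' t"
      unfolding left_diff_distrib mult.commute[of "p a t" "q / 3"] mult.commute[of "p c' t" "2 * q / 3"]
      by linarith
  qed
  also have "\<dots> = q / 3 - 2 * q / 3" using pint by simp
  finally show False using q by simp
qed

text \<open>Zero excess gives the bound almost everywhere in space. By right-continuity a violation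
  at one point would persist on an interval of positive length.\<close>

theorem entropy_solution_le:
  assumes f: "concave_on {0..1} f" "\<And>u. u \<in> {0..1} \<Longrightarrow> 0 \<le> f u"
    and w0: "\<And>x. w0 x \<le> k" and k: "k \<in> {0..1}" and t: "t \<in> {s<..<e}"
  shows "w x t \<le> k"
proof (rule ccontr)
  assume "\<not> w x t \<le> k"
  moreover have "((\<lambda>y. w y t) \<longlongrightarrow> w x t) (at_right x)"
    using sol t unfolding entropy_solution_def by blast
  ultimately have "\<forall>\<^sub>F y in at_right x. k < w y t"
    by (intro order_tendstoD(1)[of _ "w x t"]) auto
  then obtain b where b: "b > x" "\<And>y. x < y \<Longrightarrow> y < b \<Longrightarrow> k < w y t"
    unfolding eventually_at_right_field by auto
  have "(\<integral>y. P k (v (y, t)) \<partial>lborel) = 0"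
    using excess_eq_0[OF f w0 k t] by (simp add: E_def)
  then have "AE y in lborel. P k (v (y, t)) = 0"
    using integral_nonneg_eq_0_iff_AE[OF P_v_slice[OF k]] P_bounds(1) by auto
  then have "AE y in lborel. y \<notin> {x<..<b}"
  proof eventually_elim
    case (elim y)
    then have "w y t \<le> k" using t by (simp add: P_def v_def max_def split: if_splits)
    then show ?case using b(2)[of y] by auto
  qed
  then have "{x<..<b} \<in> null_sets lborel"
    by (simp add: AE_iff_null_sets)
  then show False using b(1) by (simp add: null_sets_def)
qed

end

section \<open>Monotone updates\<close>

text \<open>The infimum is attained: each difference quotient is a lower bound of the set of
  admissible constants.\<close>

lemma lipschitz_on_lip_const:
  assumes "\<exists>L. L-lipschitz_on S g"
  shows "(lip_const g S)-lipschitz_on S g"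
proof (rule lipschitz_onI)
  let ?A = "{L. L-lipschitz_on S g}"
  have ne: "?A \<noteq> {}" using assms by auto
  show "0 \<le> lip_const g S"
    unfolding lip_const_def by (rule cInf_greatest[OF ne]) (auto dest: lipschitz_on_nonneg)
  fix x y assume xy: "x \<in> S" "y \<in> S"
  show "dist (g x) (g y) \<le> lip_const g S * dist x y"
  proof (cases "x = y")
    case False
    have "dist (g x) (g y) / dist x y \<le> lip_const g S"
      unfolding lip_const_def
    proof (rule cInf_greatest[OF ne])
      fix L assume "L \<in> ?A"
      then show "dist (g x) (g y) / dist x y \<le> L"
        using lipschitz_onD[of L S g x y] xy False by (simp add: divide_le_eq)
    qed
    then show ?thesis using False by (simp add: divide_le_eq)
  qed simp
qed

text \<open>The flux is an extremum of \<open>g\<close> over the segment between the states, and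
  there \<open>g\<close> stays within \<open>K\<close> times the length of its end values. The order
  of \<open>a\<close> and \<open>b\<close> decides which of the two errors is present.\<close>

lemma godunov_bounds:
  assumes g: "K-lipschitz_on {0..1} g" and ab: "a \<in> {0..1}" "b \<in> {0..1}"
  shows "g a - K * max 0 (b - a) \<le> godunov g a b" "g b - K * max 0 (b - a) \<le> godunov g a b"
    "godunov g a b \<le> g a + K * max 0 (a - b)" "godunov g a b \<le> g b + K * max 0 (a - b)"
proof -
  have K: "K \<ge> 0" using g by (rule lipschitz_on_nonneg)
  have lip: "\<bar>g u - g u'\<bar> \<le> K * \<bar>u - u'\<bar>" if "u \<in> {0..1}" "u' \<in> {0..1}" for u u'
    using lipschitz_onD[OF g that] by (simp add: dist_real_def)
  have near: "\<bar>g u - g u'\<bar> \<le> K * (y - x)" if "u \<in> {x..y}" "u' \<in> {x..y}" "{x..y} \<subseteq> {0..1}" for u u' x y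
  proof -
    have "K * \<bar>u - u'\<bar> \<le> K * (y - x)" using that K by (intro mult_left_mono) auto
    then show ?thesis using lip[of u u'] that by (meson order_trans subsetD)
  qed
  have bdd: "bdd_below (g ` {x..y})" "bdd_above (g ` {x..y})" if "{x..y} \<subseteq> {0..1}" for x y
  proof -
    have "bounded (g ` {0..1})"
      using compact_continuous_image[OF lipschitz_on_continuous_on[OF g]] compact_imp_bounded by blast
    then have "bounded (g ` {x..y})" using that by (meson bounded_subset image_mono)
    then show "bdd_below (g ` {x..y})" "bdd_above (g ` {x..y})"
      by (auto intro: bounded_imp_bdd_below bounded_imp_bdd_above)
  qed
  have "g a - K * max 0 (b - a) \<le> godunov g a b \<and> g b - K * max 0 (b - a) \<le> godunov g a b \<and>
    godunov g a b \<le> g a + K * max 0 (a - b) \<and> godunov g a b \<le> g b + K * max 0 (a - b)"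
  proof (cases "a \<le> b")
    case True
    have sub: "{a..b} \<subseteq> {0..1}" using ab by auto
    have eq: "godunov g a b = (INF r\<in>{a..b}. g r)" using True by (simp add: godunov_def)
    have "c - K * (b - a) \<le> godunov g a b" if "c = g a \<or> c = g b" for c
      unfolding eq
    proof (rule cINF_greatest)
      fix x assume "x \<in> {a..b}"
      then show "c - K * (b - a) \<le> g x"
        using that near[of a a b x] near[of b a b x] sub True by (auto simp: abs_le_iff)
    qed (use True in auto)
    moreover have "godunov g a b \<le> g x" if "x \<in> {a..b}" for x
      unfolding eq by (rule cINF_lower[OF bdd(1)[OF sub] that])
    ultimately show ?thesis using True by (simp add: max_absorb1 max_absorb2)
  next
    case False
    have sub: "{b..a} \<subseteq> {0..1}" using ab by auto
    have eq: "godunov g a b = (SUP r\<in>{b..a}. g r)" using False by (simp add: godunov_def)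
    have "godunov g a b \<le> c + K * (a - b)" if "c = g a \<or> c = g b" for c
      unfolding eq
    proof (rule cSUP_least)
      fix x assume "x \<in> {b..a}"
      then show "g x \<le> c + K * (a - b)"
        using that near[of a b a x] near[of b b a x] sub False by (auto simp: abs_le_iff)
    qed (use False in auto)
    moreover have "g x \<le> godunov g a b" if "x \<in> {b..a}" for x
      unfolding eq by (rule cSUP_upper[OF that bdd(2)[OF sub]])
    ultimately show ?thesis using False by (simp add: max_absorb1 max_absorb2)
  qed
  then show "g a - K * max 0 (b - a) \<le> godunov g a b" "g b - K * max 0 (b - a) \<le> godunov g a b"
    "godunov g a b \<le> g a + K * max 0 (a - b)" "godunov g a b \<le> g b + K * max 0 (a - b)" by blast+
qed

text \<open>A jump inside \<open>{0..M}\<close> is no longer than the distance of either state to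
  the appropriate end, so each error can be charged to one cell alone.\<close>

lemma godunov_range_bounds:
  assumes g: "K-lipschitz_on {0..1} g" and M: "M \<le> 1" and ab: "a \<in> {0..M}" "b \<in> {0..M}"
  shows "g a - K * (M - a) \<le> godunov g a b" "g b - K * b \<le> godunov g a b"
    "godunov g a b \<le> g a + K * a" "godunov g a b \<le> g b + K * (M - b)"
proof -
  have K: "K \<ge> 0" using g by (rule lipschitz_on_nonneg)
  have "K * max 0 (b - a) \<le> K * (M - a)" "K * max 0 (b - a) \<le> K * b"
    "K * max 0 (a - b) \<le> K * a" "K * max 0 (a - b) \<le> K * (M - b)"
    using ab K by (auto intro!: mult_left_mono)
  then show "g a - K * (M - a) \<le> godunov g a b" "g b - K * b \<le> godunov g a b"
    "godunov g a b \<le> g a + K * a" "godunov g a b \<le> g b + K * (M - b)"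
    using godunov_bounds[OF g, of a b] ab M by auto
qed

text \<open>Both fluxes are compared with \<open>g b\<close>. Their difference lies between
  \<open>- 2 * K * (M - b)\<close> and \<open>2 * K * b\<close>, and the bound \<open>1 / 2\<close>
  in the CFL condition absorbs the factor 2.\<close>

lemma standard_update_range:
  assumes g: "K-lipschitz_on {0..1} g" and M: "M \<le> 1"
    and abc: "a \<in> {0..M}" "b \<in> {0..M}" "c \<in> {0..M}" and q: "0 \<le> q" "q * K \<le> 1 / 2"
  shows "b - q * (godunov g b c - godunov g a b) \<in> {0..M}"
proof -
  note l = godunov_range_bounds[OF g M abc(1,2)] and r = godunov_range_bounds[OF g M abc(2,3)]
  have "q * (godunov g b c - godunov g a b) \<le> q * (2 * K * b)"
    using l r q by (intro mult_left_mono) auto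
  also have "\<dots> = 2 * (q * K) * b" by simp
  also have "\<dots> \<le> 1 * b" using q abc by (intro mult_right_mono) auto
  finally have 1: "0 \<le> b - q * (godunov g b c - godunov g a b)" by simp
  have "q * (godunov g a b - godunov g b c) \<le> q * (2 * K * (M - b))"
    using l r q by (intro mult_left_mono) auto
  also have "\<dots> = 2 * (q * K) * (M - b)" by simp
  also have "\<dots> \<le> 1 * (M - b)" using q abc by (intro mult_right_mono) auto
  finally have "b - q * (godunov g b c - godunov g a b) \<le> M" by (simp add: algebra_simps)
  with 1 show ?thesis by simp
qed

section \<open>The flux across the curve\<close>

lemma speed_nonneg:
  assumes "flux_data f" "u \<in> {0..1}"
  shows "0 \<le> speed f u"
proof (cases "u = 0")
  case True
  obtain l where l: "((\<lambda>\<rho>. f \<rho> / \<rho>) \<longlongrightarrow> l) (at_right 0)"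
    using assms by (auto simp: flux_data_def)
  have "\<forall>\<^sub>F \<rho> in at_right 0. 0 \<le> f \<rho> / \<rho>"
  proof -
    have "\<forall>\<^sub>F \<rho> in at_right 0. \<rho> \<in> {0<..<1::real}" by (rule eventually_at_right_real) simp
    then show ?thesis by eventually_elim (use assms in \<open>auto simp: flux_data_def\<close>)
  qed
  then have "0 \<le> l" by (intro tendsto_lowerbound[OF l]) auto
  moreover have "Lim (at_right 0) (\<lambda>\<rho>. f \<rho> / \<rho>) = l" by (rule tendsto_Lim[OF _ l]) simp
  ultimately show ?thesis using True by (simp add: speed_def)
next
  case False
  then show ?thesis using assms by (auto simp: speed_def flux_data_def)
qed

text \<open>The outer flux of the left cell is compared with \<open>- f a\<close> and that of the
  right cell with \<open>f b\<close>, so the curve flux is needed only relative to these. The terms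
  \<open>\<alpha> * M\<close> account for the mass that the state \<open>M\<close> gains or loses as
  the moving curve changes the cell lengths.\<close>

lemma curve_flux_bounds:
  assumes f: "flux_data f" and K: "K-lipschitz_on {0..1} f" "\<bar>\<alpha>\<bar> \<le> K"
    and M: "M \<le> 1" and ab: "a \<in> {0..M}" "b \<in> {0..M}"
  shows "- K * (M - a) \<le> curve_flux f a b \<alpha> + f a + \<alpha> * M" "curve_flux f a b \<alpha> + f a \<le> K * a"
    "- K * (M - b) \<le> f b - curve_flux f a b \<alpha> - \<alpha> * M" "f b - curve_flux f a b \<alpha> \<le> K * b"
proof -
  have f0: "f 0 = 0" using f by (simp add: flux_data_def)
  have ab1: "a \<in> {0..1}" "b \<in> {0..1}" using ab M by auto
  have pos: "0 \<le> f a" "0 \<le> f b" using f ab1 by (auto simp: flux_data_def)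
  have lin: "f a \<le> K * a" "f b \<le> K * b"
    using lipschitz_onD[OF K(1), of a 0] lipschitz_onD[OF K(1), of b 0] ab1 f0 by (auto simp: dist_real_def)
  \<comment> \<open>The speed thresholds of the curve flux as inequalities without division; at
    \<open>u = 0\<close> both sides vanish.\<close>
  have v: "\<beta> \<ge> speed f u \<Longrightarrow> f u \<le> \<beta> * u" "\<beta> \<le> speed f u \<Longrightarrow> \<beta> * u \<le> f u" if "u \<in> {0..1}" for u \<beta>
    using that f0 by (cases "u = 0"; simp add: speed_def field_simps)+
  have \<alpha>: "\<alpha> * (M - a) \<le> K * (M - a)" "- \<alpha> * (M - a) \<le> K * (M - a)" "\<alpha> * (M - b) \<le> K * (M - b)"
    "- \<alpha> * (M - b) \<le> K * (M - b)" "\<alpha> * b \<le> K * b" "- \<alpha> * a \<le> K * a"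
    by (rule mult_right_mono; use K(2) ab in auto)+
  have K0: "0 \<le> K * (M - a)" "0 \<le> K * (M - b)" using K ab by auto
  note sp = speed_nonneg[OF f ab1(1)] speed_nonneg[OF f ab1(2)]
  have "- K * (M - a) \<le> curve_flux f a b \<alpha> + f a + \<alpha> * M \<and> curve_flux f a b \<alpha> + f a \<le> K * a \<and>
    - K * (M - b) \<le> f b - curve_flux f a b \<alpha> - \<alpha> * M \<and> f b - curve_flux f a b \<alpha> \<le> K * b"
  proof -
    consider "speed f b \<le> \<alpha>" | "\<alpha> < speed f b" "\<alpha> \<le> - speed f a" | "\<alpha> < speed f b" "- speed f a < \<alpha>"
      by linarith
    then show ?thesis
    proof cases
      case 1
      then have h: "curve_flux f a b \<alpha> = f b - \<alpha> * b" by (simp add: curve_flux_def)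
      have "0 \<le> \<alpha> * (M - b)" using 1 sp ab by (intro mult_nonneg_nonneg) auto
      then show ?thesis using v(1)[OF ab1(2) 1] \<alpha> lin pos K0 unfolding h by (auto simp: algebra_simps)
    next
      case 2
      then have h: "curve_flux f a b \<alpha> = - f a - \<alpha> * a" by (simp add: curve_flux_def)
      have "0 \<le> - \<alpha> * (M - a)" using 2 sp ab by (intro mult_nonneg_nonneg) auto
      moreover have "f a \<le> - \<alpha> * a" by (rule v(1)[OF ab1(1)]) (use 2 in simp)
      ultimately show ?thesis using \<alpha> lin pos K0 unfolding h by (auto simp: algebra_simps)
    next
      case 3
      then have h: "curve_flux f a b \<alpha> = 0" by (simp add: curve_flux_def)
      have "- \<alpha> * a \<le> f a" by (rule v(2)[OF ab1(1)]) (use 3 in simp)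
      moreover have "\<alpha> * b \<le> f b" by (rule v(2)[OF ab1(2)]) (use 3 in simp)
      ultimately show ?thesis using \<alpha> lin pos K0 unfolding h by (auto simp: algebra_simps)
    qed
  qed
  then show "- K * (M - a) \<le> curve_flux f a b \<alpha> + f a + \<alpha> * M" "curve_flux f a b \<alpha> + f a \<le> K * a"
    "- K * (M - b) \<le> f b - curve_flux f a b \<alpha> - \<alpha> * M" "f b - curve_flux f a b \<alpha> \<le> K * b" by blast+
qed

section \<open>Balances over the cells next to the curve\<close>

lemma range_of_balance:
  fixes x :: real
  assumes "D > 0" "D * x = y" "0 \<le> y" "y \<le> D * M"
  shows "x \<in> {0..M}"
  using assms by (metis atLeastAtMost_iff mult_le_cancel_left_pos mult_zero_right)

text \<open>\<open>D\<close> is the length of the old cell next to the curve, which the motion of the curve changes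
  by \<open>\<tau> * \<alpha>\<close>.\<close>

context
  fixes f :: "real \<Rightarrow> real" and K \<alpha> M \<tau> \<delta> :: real
  assumes f: "flux_data f" and K: "K-lipschitz_on {0..1} f" "\<bar>\<alpha>\<bar> \<le> K"
    and M: "M \<le> 1" and \<tau>: "\<tau> > 0" "\<tau> * K \<le> \<delta> / 2" and \<delta>: "\<delta> > 0"
begin

lemma lip_minus: "K-lipschitz_on {0..1} (\<lambda>u. - f u)"
  using K(1) by (simp add: lipschitz_on_def)

text \<open>The CFL condition in the form in which it is spent: over one time step, a flux error
  \<open>K * y\<close> moves at most the mass of half a cell with value \<open>y\<close>.\<close>

lemma time_step_mult:
  assumes "x \<le> K * y" "0 \<le> y"
  shows "\<tau> * x \<le> \<delta> / 2 * y"
proof -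
  have "\<tau> * x \<le> \<tau> * (K * y)" using assms \<tau> by (intro mult_left_mono) auto
  also have "\<dots> = (\<tau> * K) * y" by simp
  also have "\<dots> \<le> \<delta> / 2 * y" using \<tau> assms by (intro mult_right_mono) auto
  finally show ?thesis .
qed

text \<open>Also covers the step in which the curve moves one cell to the right:
  \<open>D + \<tau> * \<alpha>\<close> is then the joint length of the two new cells that share the
  value \<open>x\<close>.\<close>

lemma left_update_range:
  assumes r: "z \<in> {0..M}" "a \<in> {0..M}" "b \<in> {0..M}" and D: "\<delta> \<le> D" "D + \<tau> * \<alpha> > 0"
    and eq: "(D + \<tau> * \<alpha>) * x = D * a - \<tau> * (curve_flux f a b \<alpha> - godunov (\<lambda>u. - f u) z a)"
  shows "x \<in> {0..M}"
proof (rule range_of_balance[OF D(2) eq])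
  note h = curve_flux_bounds[OF f K M r(2,3)] and g = godunov_range_bounds[OF lip_minus M r(1,2)]
  have "\<tau> * (curve_flux f a b \<alpha> - godunov (\<lambda>u. - f u) z a) \<le> \<delta> / 2 * (2 * a)"
    by (rule time_step_mult) (use h(2) g(2) r in auto)
  moreover have "\<delta> * a \<le> D * a" using r D by (intro mult_right_mono) auto
  ultimately show "0 \<le> D * a - \<tau> * (curve_flux f a b \<alpha> - godunov (\<lambda>u. - f u) z a)" by simp
  have "\<tau> * (godunov (\<lambda>u. - f u) z a - curve_flux f a b \<alpha> - \<alpha> * M) \<le> \<delta> / 2 * (2 * (M - a))"
    by (rule time_step_mult) (use h(1) g(4) r in \<open>auto simp: algebra_simps\<close>)
  moreover have "\<delta> * (M - a) \<le> D * (M - a)" using r D by (intro mult_right_mono) auto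
  ultimately show "D * a - \<tau> * (curve_flux f a b \<alpha> - godunov (\<lambda>u. - f u) z a) \<le> (D + \<tau> * \<alpha>) * M"
    by (simp add: algebra_simps)
qed

text \<open>The mirror image, which also covers the step in which the curve moves one cell to the
  left.\<close>

lemma right_update_range:
  assumes r: "a \<in> {0..M}" "b \<in> {0..M}" "z \<in> {0..M}" and D: "\<delta> \<le> D" "D - \<tau> * \<alpha> > 0"
    and eq: "(D - \<tau> * \<alpha>) * x = D * b - \<tau> * (godunov f b z - curve_flux f a b \<alpha>)"
  shows "x \<in> {0..M}"
proof (rule range_of_balance[OF D(2) eq])
  note h = curve_flux_bounds[OF f K M r(1,2)] and g = godunov_range_bounds[OF K(1) M r(2,3)]
  have "\<tau> * (godunov f b z - curve_flux f a b \<alpha>) \<le> \<delta> / 2 * (2 * b)"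
    by (rule time_step_mult) (use h(4) g(3) r in auto)
  moreover have "\<delta> * b \<le> D * b" using r D by (intro mult_right_mono) auto
  ultimately show "0 \<le> D * b - \<tau> * (godunov f b z - curve_flux f a b \<alpha>)" by simp
  have "\<tau> * (curve_flux f a b \<alpha> - godunov f b z + \<alpha> * M) \<le> \<delta> / 2 * (2 * (M - b))"
    by (rule time_step_mult) (use h(3) g(1) r in \<open>auto simp: algebra_simps\<close>)
  moreover have "\<delta> * (M - b) \<le> D * (M - b)" using r D by (intro mult_right_mono) auto
  ultimately show "D * b - \<tau> * (godunov f b z - curve_flux f a b \<alpha>) \<le> (D - \<tau> * \<alpha>) * M"
    by (simp add: algebra_simps)
qed

text \<open>In a merged cell no flux is computed at the interior edge. The two outer fluxes are
  compared with \<open>f\<close> at different states, and this bounds the mismatch.\<close>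

lemma f_diff_le:
  assumes "u \<in> {0..M}" "u' \<in> {0..M}"
  shows "f u - f u' \<le> K * (u + u')" "f u - f u' \<le> K * ((M - u) + (M - u'))"
proof -
  have K0: "K \<ge> 0" using K by (auto dest: lipschitz_on_nonneg)
  have "f u - f u' \<le> K * \<bar>u - u'\<bar>"
    using lipschitz_onD[OF K(1), of u u'] assms M by (auto simp: dist_real_def)
  moreover have "K * \<bar>u - u'\<bar> \<le> K * (u + u')" "K * \<bar>u - u'\<bar> \<le> K * ((M - u) + (M - u'))"
    using assms K0 by (auto intro!: mult_left_mono)
  ultimately show "f u - f u' \<le> K * (u + u')" "f u - f u' \<le> K * ((M - u) + (M - u'))" by auto
qed

text \<open>Each old cell contributes \<open>2 * K\<close> times its value to the outflow bound:
  half from its outer edge, half from the mismatch of \<open>f\<close> at the interior edge. Both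
  old cells have length at least \<open>\<delta>\<close>, which is enough to pay for it.\<close>

lemma right_merge_update_range:
  assumes r: "a \<in> {0..M}" "b \<in> {0..M}" "y \<in> {0..M}" "z \<in> {0..M}"
    and D: "\<delta> \<le> D" "D + \<delta> - \<tau> * \<alpha> > 0"
    and eq: "(D + \<delta> - \<tau> * \<alpha>) * x = D * b + \<delta> * y - \<tau> * (godunov f y z - curve_flux f a b \<alpha>)"
  shows "x \<in> {0..M}"
proof (rule range_of_balance[OF D(2) eq])
  note h = curve_flux_bounds[OF f K M r(1,2)] and g = godunov_range_bounds[OF K(1) M r(3,4)]
  have "\<tau> * (godunov f y z - curve_flux f a b \<alpha>) \<le> \<delta> / 2 * (2 * b + 2 * y)"
    by (rule time_step_mult) (use h(4) g(3) r f_diff_le(1)[OF r(3,2)] in \<open>auto simp: algebra_simps\<close>)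
  moreover have "\<delta> * b \<le> D * b" using r D by (intro mult_right_mono) auto
  ultimately show "0 \<le> D * b + \<delta> * y - \<tau> * (godunov f y z - curve_flux f a b \<alpha>)" by (simp add: distrib_left)
  have "\<tau> * (curve_flux f a b \<alpha> - godunov f y z + \<alpha> * M) \<le> \<delta> / 2 * (2 * (M - b) + 2 * (M - y))"
    by (rule time_step_mult) (use h(3) g(1) r f_diff_le(2)[OF r(2,3)] in \<open>auto simp: algebra_simps\<close>)
  moreover have "\<delta> * (M - b) \<le> D * (M - b)" using r D by (intro mult_right_mono) auto
  ultimately show "D * b + \<delta> * y - \<tau> * (godunov f y z - curve_flux f a b \<alpha>) \<le> (D + \<delta> - \<tau> * \<alpha>) * M"
    by (simp add: algebra_simps)
qed

lemma left_merge_update_range: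
  assumes r: "z \<in> {0..M}" "y \<in> {0..M}" "a \<in> {0..M}" "b \<in> {0..M}"
    and D: "\<delta> \<le> D" "D + \<delta> + \<tau> * \<alpha> > 0"
    and eq: "(D + \<delta> + \<tau> * \<alpha>) * x = D * a + \<delta> * y - \<tau> * (curve_flux f a b \<alpha> - godunov (\<lambda>u. - f u) z y)"
  shows "x \<in> {0..M}"
proof (rule range_of_balance[OF D(2) eq])
  note h = curve_flux_bounds[OF f K M r(3,4)] and g = godunov_range_bounds[OF lip_minus M r(1,2)]
  have "\<tau> * (curve_flux f a b \<alpha> - godunov (\<lambda>u. - f u) z y) \<le> \<delta> / 2 * (2 * a + 2 * y)"
    by (rule time_step_mult) (use h(2) g(2) r f_diff_le(1)[OF r(2,3)] in \<open>auto simp: algebra_simps\<close>)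
  moreover have "\<delta> * a \<le> D * a" using r D by (intro mult_right_mono) auto
  ultimately show "0 \<le> D * a + \<delta> * y - \<tau> * (curve_flux f a b \<alpha> - godunov (\<lambda>u. - f u) z y)" by (simp add: distrib_left)
  have "\<tau> * (godunov (\<lambda>u. - f u) z y - curve_flux f a b \<alpha> - \<alpha> * M) \<le> \<delta> / 2 * (2 * (M - a) + 2 * (M - y))"
    by (rule time_step_mult) (use h(1) g(4) r f_diff_le(2)[OF r(3,2)] in \<open>auto simp: algebra_simps\<close>)
  moreover have "\<delta> * (M - a) \<le> D * (M - a)" using r D by (intro mult_right_mono) auto
  ultimately show "D * a + \<delta> * y - \<tau> * (curve_flux f a b \<alpha> - godunov (\<lambda>u. - f u) z y) \<le> (D + \<delta> + \<tau> * \<alpha>) * M"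
    by (simp add: algebra_simps)
qed

end

section \<open>The moving mesh\<close>

lemma dx_pos: "dx N > 0"
  by (simp add: dx_def)

lemma edge_add: "edge N (j + i) = edge N j + of_int i * dx N"
  by (simp add: edge_def algebra_simps)

text \<open>Shows that the cells partition the line, so the description in \<open>curve_idx\<close>
  denotes, and turns questions about indices into estimates of floors.\<close>

lemma mem_cell_iff: "x \<in> cell N j \<longleftrightarrow> j = \<lfloor>x / dx N + 1 / 2\<rfloor>"
proof -
  have "x \<in> cell N j \<longleftrightarrow> of_int j \<le> x / dx N + 1 / 2 \<and> x / dx N + 1 / 2 < of_int j + 1"
  proof -
    have "(a - 1 / 2) * d \<le> x \<longleftrightarrow> a \<le> x / d + 1 / 2" "x < (a + 1 / 2) * d \<longleftrightarrow> x / d + 1 / 2 < a + 1"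
      if "d > 0" for a d :: real
      using that by (auto simp: field_simps)
    from this[OF dx_pos[of N], of "of_int j"] show ?thesis
      by (simp add: cell_def edge_def algebra_simps)
  qed
  also have "\<dots> \<longleftrightarrow> j = \<lfloor>x / dx N + 1 / 2\<rfloor>"
    by (subst eq_commute) (simp add: floor_eq_iff)
  finally show ?thesis .
qed

lemma curve_in_cell: "\<xi> (tm \<tau> n) \<in> cell N (curve_idx \<xi> N \<tau> n)"
  unfolding curve_idx_def by (rule theI'[of "\<lambda>j. \<xi> (tm \<tau> n) \<in> cell N j"]) (simp add: mem_cell_iff)

lemma dx_mult_power: "2 ^ N * dx N = 1"
  by (simp add: dx_def)

section \<open>The initial datum\<close>

lemma cell_average_range:
  fixes g :: "real \<Rightarrow> real"
  assumes g: "AE x in lebesgue. g x \<in> {0..M}" and ab: "a < b" and M: "M \<ge> 0"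
  shows "(LINT x:{a..<b}|lebesgue. g x) / measure lebesgue {a..<b} \<in> {0..M}"
proof -
  have m: "measure lebesgue {a..<b} = b - a" using ab by simp
  have "0 \<le> (LINT x:{a..<b}|lebesgue. g x)"
    unfolding set_lebesgue_integral_def
    by (rule integral_nonneg_AE) (use g in eventually_elim, auto simp: indicator_def)
  moreover have "(LINT x:{a..<b}|lebesgue. g x) \<le> M * (b - a)"
  proof (cases "integrable lebesgue (\<lambda>x. indicator {a..<b} x *\<^sub>R g x)")
    case True
    have i: "integrable lebesgue (\<lambda>x. M * indicator {a..<b} x)"
      using ab by (intro integrable_mult_right integrable_real_indicator) auto
    have "(LINT x:{a..<b}|lebesgue. g x) \<le> (\<integral>x. M * indicator {a..<b} x \<partial>lebesgue)"
      unfolding set_lebesgue_integral_def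
      by (rule integral_mono_AE[OF True i]) (use g in eventually_elim, auto simp: indicator_def)
    also have "\<dots> = M * (b - a)" using ab by simp
    finally show ?thesis .
  next
    \<comment> \<open>A non-integrable function has integral 0 by convention, so
      \<open>M \<ge> 0\<close> gives the bound.\<close>
    case False
    then show ?thesis
      using M ab by (simp add: set_lebesgue_integral_def not_integrable_integral_eq)
  qed
  ultimately show ?thesis using ab unfolding m by (simp add: divide_le_eq)
qed

lemma initial_data_esssup:
  assumes "initial_data \<rho>0"
  obtains M where "0 \<le> M" "M \<le> 1"
    "esssup (lebesgue_on {-1<..<1}) (\<lambda>x. ereal \<bar>\<rho>0 x\<bar>) = ereal M"
    "AE x in lebesgue. ext0 {-1<..<1} \<rho>0 x \<in> {0..M}"
proof -
  let ?\<mu> = "lebesgue_on {-1<..<1::real}"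
  define A where "A = esssup ?\<mu> (\<lambda>x. ereal \<bar>\<rho>0 x\<bar>)"
  have meas: "(\<lambda>x. ereal \<bar>\<rho>0 x\<bar>) \<in> borel_measurable ?\<mu>"
    and r01: "AE x in ?\<mu>. \<rho>0 x \<in> {0..1}"
    using assms by (auto simp: initial_data_def)
  have "A \<le> 1" unfolding A_def
    by (rule esssup_I[OF meas]) (use r01 in eventually_elim, auto simp: one_ereal_def)
  \<comment> \<open>On a null space the essential supremum of the constant 0 would not be 0;
    positive measure is what yields \<open>0 \<le> A\<close>.\<close>
  have "emeasure ?\<mu> (space ?\<mu>) \<noteq> 0"
    by (simp add: emeasure_restrict_space)
  from esssup_const[OF this, of "0 :: ereal"]
  have "0 = esssup ?\<mu> (\<lambda>x. 0 :: ereal)" by simp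
  also have "\<dots> \<le> A" unfolding A_def by (rule esssup_mono) auto
  finally have "0 \<le> A" .
  then obtain M where M: "A = ereal M" using \<open>A \<le> 1\<close> by (cases A) auto
  show ?thesis
  proof (rule that)
    show "0 \<le> M" "M \<le> 1" using \<open>0 \<le> A\<close> \<open>A \<le> 1\<close> M by (auto simp: one_ereal_def)
    show "esssup ?\<mu> (\<lambda>x. ereal \<bar>\<rho>0 x\<bar>) = ereal M" using M A_def by simp
    have "AE x in ?\<mu>. \<rho>0 x \<in> {0..M}"
      using r01 esssup_AE[of "\<lambda>x. ereal \<bar>\<rho>0 x\<bar>" ?\<mu>] unfolding A_def[symmetric] M
      by eventually_elim auto
    then have "AE x in lebesgue. x \<in> {-1<..<1} \<longrightarrow> \<rho>0 x \<in> {0..M}"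
      by (subst (asm) AE_restrict_space_iff) auto
    then show "AE x in lebesgue. ext0 {-1<..<1} \<rho>0 x \<in> {0..M}"
      by eventually_elim (use \<open>0 \<le> M\<close> in \<open>auto simp: ext0_def\<close>)
  qed
qed

locale moving_mesh =
  fixes f \<xi> :: "real \<Rightarrow> real" and N :: nat and \<tau> :: real
  assumes f: "flux_data f" and \<xi>: "curve_data \<xi>" and mesh: "fine_mesh \<xi> N"
    and \<tau>: "\<tau> > 0" and cfl: "CFL f \<xi> N \<tau>"
begin

abbreviation \<delta> :: real where "\<delta> \<equiv> dx N"
abbreviation J :: int where "J \<equiv> 2 ^ N"
abbreviation m :: "nat \<Rightarrow> int" where "m \<equiv> curve_idx \<xi> N \<tau>"
abbreviation pos :: "nat \<Rightarrow> real" where "pos n \<equiv> \<xi> (tm \<tau> n)"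

definition K :: real where
  "K = max (lip_const f {0..1}) (lip_const \<xi> {0..})"

lemma lip: "K-lipschitz_on {0..1} f" "K-lipschitz_on {0..} \<xi>"
  using lipschitz_on_lip_const[of "{0..1}" f] lipschitz_on_lip_const[of "{0..}" \<xi>] f \<xi>
  by (auto simp: K_def flux_data_def curve_data_def intro: lipschitz_on_mono)

lemma K_cfl: "\<tau> * K \<le> \<delta> / 2"
  using cfl by (simp add: CFL_def K_def)

lemma pos_bounds:
  assumes "t \<ge> 0"
  shows "\<bar>\<xi> t\<bar> < 1 - \<delta> / 2"
proof -
  have "bdd_above ((\<lambda>t. \<bar>\<xi> t\<bar>) ` {0..})"
    using \<xi> by (intro bdd_aboveI[of _ 1]) (auto simp: curve_data_def abs_le_iff less_imp_le)
  then have "\<bar>\<xi> t\<bar> \<le> (SUP t\<in>{0..}. \<bar>\<xi> t\<bar>)"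
    using assms by (intro cSUP_upper) auto
  also have "\<dots> < 1 - \<delta> / 2"
    using mesh by (simp add: fine_mesh_def)
  finally show ?thesis .
qed

lemma edge_J: "edge N (J - 1) = 1 - \<delta> / 2" "edge N (- J) = \<delta> / 2 - 1"
  using dx_mult_power[of N] by (simp_all add: edge_def algebra_simps)

lemma tm_nonneg: "0 \<le> tm \<tau> n"
  using \<tau> by (simp add: tm_def)

text \<open>Both neighbours of the curve are thus genuine mesh cells, and their neighbours in turn
  reach at most the outermost cells, where the boundary value 0 is prescribed.\<close>

lemma m_range: "- J + 1 \<le> m n" "m n \<le> J - 1"
proof -
  have c: "edge N (m n - 1) \<le> pos n" "pos n < edge N (m n)"
    using curve_in_cell[of \<xi> \<tau> n N] by (auto simp: cell_def)
  note p = pos_bounds[OF tm_nonneg[of n]]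
  have mono: "i < j" if "edge N i < edge N j" for i j
    using that dx_pos[of N] by (simp add: edge_def)
  show "- J + 1 \<le> m n" using mono[of "- J" "m n"] c p edge_J by linarith
  show "m n \<le> J - 1" using mono[of "m n - 1" "J - 1"] c p edge_J by linarith
qed

lemma tm_Suc: "tm \<tau> (Suc n) = tm \<tau> n + \<tau>"
  by (simp add: tm_def algebra_simps)

lemma slope_mult: "\<tau> * slope \<xi> \<tau> n = pos (Suc n) - pos n"
  using \<tau> by (simp add: slope_def)

lemma pos_step: "\<bar>pos (Suc n) - pos n\<bar> \<le> \<tau> * K"
  using lipschitz_onD[OF lip(2), of "tm \<tau> (Suc n)" "tm \<tau> n"] tm_nonneg \<tau>
  by (simp add: dist_real_def tm_Suc mult.commute)

lemma slope_bound: "\<bar>slope \<xi> \<tau> n\<bar> \<le> K"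
proof -
  have "\<tau> * \<bar>slope \<xi> \<tau> n\<bar> \<le> \<tau> * K"
    using pos_step[of n] \<tau> by (simp add: slope_mult[symmetric] abs_mult)
  then show ?thesis using \<tau> by simp
qed

text \<open>By the CFL condition the curve moves at most half a cell per step, so the three cases of
  the scheme are exhaustive.\<close>

lemma m_Suc: "m (Suc n) = m n \<or> m (Suc n) = m n + 1 \<or> m (Suc n) = m n - 1"
proof -
  have "\<bar>pos (Suc n) - pos n\<bar> \<le> \<delta> / 2" using pos_step[of n] K_cfl by linarith
  then have "\<bar>(pos (Suc n) / \<delta> + 1 / 2) - (pos n / \<delta> + 1 / 2)\<bar> \<le> 1 / 2"
    using dx_pos[of N] by (simp add: diff_divide_distrib[symmetric] abs_divide divide_le_eq)
  moreover have "m n = \<lfloor>pos n / \<delta> + 1 / 2\<rfloor>" "m (Suc n) = \<lfloor>pos (Suc n) / \<delta> + 1 / 2\<rfloor>"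
    using curve_in_cell[of \<xi> \<tau> n N] curve_in_cell[of \<xi> \<tau> "Suc n" N] by (simp_all only: mem_cell_iff)
  ultimately show ?thesis by linarith
qed

definition \<Delta>L :: "nat \<Rightarrow> real" where "\<Delta>L n = pos n - edge N (m n - 2)"
definition \<Delta>R :: "nat \<Rightarrow> real" where "\<Delta>R n = edge N (m n + 1) - pos n"

lemma \<Delta>_bounds: "\<delta> \<le> \<Delta>L n" "\<delta> \<le> \<Delta>R n"
  using curve_in_cell[of \<xi> \<tau> n N] edge_add[of N "m n - 2" 1] edge_add[of N "m n" 1]
  by (auto simp: cell_def \<Delta>L_def \<Delta>R_def)

lemma \<Delta>_positive: "0 < \<Delta>L n" "0 < \<Delta>R n"
  using \<Delta>_bounds[of n] dx_pos[of N] by linarith+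

lemma measure_curve_cells:
  "measure lebesgue (mcell \<xi> N \<tau> n (m n - 1)) = \<Delta>L n"
  "measure lebesgue (mcell \<xi> N \<tau> n (m n + 1)) = \<Delta>R n"
  using \<Delta>_positive[of n] by (simp_all add: mcell_def \<Delta>L_def \<Delta>R_def)

lemma mcell_interval: "\<exists>a b. a < b \<and> mcell \<xi> N \<tau> n j = {a..<b}"
proof -
  have "edge N (j - 1) < edge N j" using edge_add[of N "j - 1" 1] dx_pos[of N] by simp
  then show ?thesis
    using \<Delta>_positive[of n] unfolding mcell_def cell_def Let_def \<Delta>L_def \<Delta>R_def
    by (cases "j = m n - 1"; cases "j = m n + 1") auto
qed

text \<open>The cell containing the curve is cut at the curve and each piece is attached to the
  neighbour on its side, so no point is lost.\<close>

lemma cell_cover: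
  assumes "x \<in> domain N"
  shows "(\<exists>j\<in>mesh_idx \<xi> N \<tau> n. x \<in> mcell \<xi> N \<tau> n j) \<or> x \<in> cell N (1 + J) \<union> cell N (- (1 + J))"
proof -
  define j where "j = \<lfloor>x / \<delta> + 1 / 2\<rfloor>"
  have j: "x \<in> cell N j" by (simp add: mem_cell_iff j_def)
  then have e: "edge N (j - 1) \<le> x" "x < edge N j" by (auto simp: cell_def)
  have mono: "i < j" if "edge N i < edge N j" for i j
    using that dx_pos[of N] by (simp add: edge_def)
  have eJ: "edge N (J + 1) = 1 + 3 / 2 * \<delta>" "edge N (- J - 2) = - 1 - 3 / 2 * \<delta>"
    using dx_mult_power[of N] by (simp_all add: edge_def algebra_simps)
  have "j - 1 < J + 1" using mono[of "j - 1" "J + 1"] e eJ assms by (simp add: domain_def)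
  moreover have "- J - 2 < j" using mono[of "- J - 2" j] e eJ assms by (simp add: domain_def)
  ultimately have jJ: "- J - 1 \<le> j" "j \<le> J + 1" by linarith+
  show ?thesis
  proof (cases "j = J + 1 \<or> j = - J - 1")
    case True
    then have "j = 1 + J \<or> j = - (1 + J)" by linarith
    then show ?thesis using j by blast
  next
    case False
    have mm: "m n - 1 \<in> mesh_idx \<xi> N \<tau> n" "m n + 1 \<in> mesh_idx \<xi> N \<tau> n"
      using m_range[of n] by (auto simp: mesh_idx_def)
    have shift: "edge N (m n - 2) < edge N (m n - 1)" "edge N (m n) < edge N (m n + 1)"
      using edge_add[of N "m n - 2" 1] edge_add[of N "m n" 1] dx_pos[of N] by auto
    have c: "edge N (m n - 1) \<le> pos n" "pos n < edge N (m n)"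
      using curve_in_cell[of \<xi> \<tau> n N] by (auto simp: cell_def)
    have L: "mcell \<xi> N \<tau> n (m n - 1) = {edge N (m n - 2)..<pos n}"
      and R: "mcell \<xi> N \<tau> n (m n + 1) = {pos n..<edge N (m n + 1)}"
      by (simp_all add: mcell_def)
    consider "j = m n \<or> j = m n - 1" "x < pos n" | "j = m n \<or> j = m n + 1" "pos n \<le> x" | "j \<noteq> m n" "j \<noteq> m n - 1" "j \<noteq> m n + 1"
    proof -
      have "x < pos n" if "j = m n - 1" using e c that by auto
      moreover have "pos n \<le> x" if "j = m n + 1" using e c that by auto
      ultimately show ?thesis using that by linarith
    qed
    then show ?thesis
    proof cases
      case 1
      then have "x \<in> mcell \<xi> N \<tau> n (m n - 1)" using e shift unfolding L by auto
      then show ?thesis using mm by blast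
    next
      case 2
      then have "x \<in> mcell \<xi> N \<tau> n (m n + 1)" using e shift unfolding R by auto
      then show ?thesis using mm by blast
    next
      case 3
      then have "x \<in> mcell \<xi> N \<tau> n j" using j by (simp add: mcell_def)
      moreover have "j \<in> mesh_idx \<xi> N \<tau> n" using 3 False jJ by (auto simp: mesh_idx_def)
      ultimately show ?thesis by blast
    qed
  qed
qed

text \<open>In each case the new lengths equal the old ones, with an absorbed cell added where there
  is one, plus or minus \<open>\<tau> * slope \<xi> \<tau> n\<close>. This puts every balance in the
  form of one of the four update lemmas.\<close>

lemma scheme_step_range:
  assumes st: "scheme_step f \<xi> N \<tau> n r r'" and M: "M \<le> 1"
    and r: "\<And>j. - J - 1 \<le> j \<Longrightarrow> j \<le> J + 1 \<Longrightarrow> j \<noteq> m n \<Longrightarrow> r j \<in> {0..M}"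
    and j: "j \<in> mesh_idx \<xi> N \<tau> (Suc n)"
  shows "r' j \<in> {0..M}"
proof -
  let ?\<alpha> = "slope \<xi> \<tau> n" and ?hm = "godunov (\<lambda>u. - f u)" and ?hp = "godunov f"
  let ?h0 = "curve_flux f (r (m n - 1)) (r (m n + 1)) ?\<alpha>"
  let ?S = "\<lambda>h j. r j - \<tau> / \<delta> * (h (r j) (r (j + 1)) - h (r (j - 1)) (r j))"
  note mr = m_range[of n] m_range[of "Suc n"]
  note par = f lip(1) slope_bound[of n] M \<tau> K_cfl dx_pos[of N]
  have near: "r (m n - 2) \<in> {0..M}" "r (m n - 1) \<in> {0..M}" "r (m n + 1) \<in> {0..M}" "r (m n + 2) \<in> {0..M}"
    by (rule r; use mr in simp)+
  have jr: "- J \<le> j" "j \<le> J" "j \<noteq> m (Suc n)" using j by (auto simp: mesh_idx_def)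
  have q: "0 \<le> \<tau> / \<delta>" "\<tau> / \<delta> * K \<le> 1 / 2"
    using \<tau> K_cfl dx_pos[of N] by (simp_all add: field_simps)
  have Sp: "?S ?hp i \<in> {0..M}" if "i \<ge> m n + 2" "i \<le> J" for i
    by (rule standard_update_range[OF lip(1) M _ _ _ q]) (use that mr in \<open>auto intro!: r simp del: atLeastAtMost_iff\<close>)
  have Sm: "?S ?hm i \<in> {0..M}" if "i \<le> m n - 2" "i \<ge> - J" for i
    by (rule standard_update_range[OF _ M _ _ _ q])
      (use that mr lip(1) in \<open>auto intro!: r simp: lipschitz_on_def simp del: atLeastAtMost_iff\<close>)
  have st': "(m (Suc n) = m n \<longrightarrow>
         (\<forall>j\<in>{-J..m (Suc n) - 2}. r' j = ?S ?hm j) \<and>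
         (\<forall>j\<in>{m (Suc n) + 2..J}. r' j = ?S ?hp j) \<and>
         \<Delta>L (Suc n) * r' (m (Suc n) - 1) = \<Delta>L n * r (m n - 1) - \<tau> * (?h0 - ?hm (r (m n - 2)) (r (m n - 1))) \<and>
         \<Delta>R (Suc n) * r' (m (Suc n) + 1) = \<Delta>R n * r (m n + 1) - \<tau> * (?hp (r (m n + 1)) (r (m n + 2)) - ?h0)) \<and>
      (m (Suc n) = m n + 1 \<longrightarrow>
         (\<forall>j\<in>{-J..m (Suc n) - 3}. r' j = ?S ?hm j) \<and>
         (\<forall>j\<in>{m (Suc n) + 2..J}. r' j = ?S ?hp j) \<and>
         r' (m (Suc n) - 2) = r' (m (Suc n) - 1) \<and>
         (\<delta> + \<Delta>L (Suc n)) * r' (m (Suc n) - 1) =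
           \<Delta>L n * r (m n - 1) - \<tau> * (?h0 - ?hm (r (m n - 2)) (r (m n - 1))) \<and>
         \<Delta>R (Suc n) * r' (m (Suc n) + 1) =
           \<Delta>R n * r (m n + 1) + \<delta> * r (m n + 2) - \<tau> * (?hp (r (m n + 2)) (r (m n + 3)) - ?h0)) \<and>
      (m (Suc n) = m n - 1 \<longrightarrow>
         (\<forall>j\<in>{-J..m (Suc n) - 2}. r' j = ?S ?hm j) \<and>
         (\<forall>j\<in>{m (Suc n) + 3..J}. r' j = ?S ?hp j) \<and>
         \<Delta>L (Suc n) * r' (m (Suc n) - 1) =
           \<Delta>L n * r (m n - 1) + \<delta> * r (m n - 2) - \<tau> * (?h0 - ?hm (r (m n - 3)) (r (m n - 2))) \<and>
         r' (m (Suc n) + 2) = r' (m (Suc n) + 1) \<and>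
         (\<delta> + \<Delta>R (Suc n)) * r' (m (Suc n) + 1) =
           \<Delta>R n * r (m n + 1) - \<tau> * (?hp (r (m n + 1)) (r (m n + 2)) - ?h0))"
    using st unfolding scheme_step_def Let_def measure_curve_cells .
  note dpos = \<Delta>_positive[of "Suc n"] dx_pos[of N]
  consider "m (Suc n) = m n" | "m (Suc n) = m n + 1" | "m (Suc n) = m n - 1"
    using m_Suc[of n] by blast
  then show ?thesis
  proof cases
    case 1
    have D: "\<Delta>L n + \<tau> * ?\<alpha> = \<Delta>L (Suc n)" "\<Delta>R n - \<tau> * ?\<alpha> = \<Delta>R (Suc n)"
      by (simp_all add: slope_mult \<Delta>L_def \<Delta>R_def 1)
    have L: "r' (m n - 1) \<in> {0..M}"
    proof (rule left_update_range[OF par near(1,2,3) \<Delta>_bounds(1)])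
      show "0 < \<Delta>L n + \<tau> * ?\<alpha>" unfolding D by (rule dpos)
      show "(\<Delta>L n + \<tau> * ?\<alpha>) * r' (m n - 1) = \<Delta>L n * r (m n - 1) - \<tau> * (?h0 - ?hm (r (m n - 2)) (r (m n - 1)))"
        unfolding D using st' 1 by simp
    qed
    have R: "r' (m n + 1) \<in> {0..M}"
    proof (rule right_update_range[OF par near(2,3,4) \<Delta>_bounds(2)])
      show "0 < \<Delta>R n - \<tau> * ?\<alpha>" unfolding D by (rule dpos)
      show "(\<Delta>R n - \<tau> * ?\<alpha>) * r' (m n + 1) = \<Delta>R n * r (m n + 1) - \<tau> * (?hp (r (m n + 1)) (r (m n + 2)) - ?h0)"
        unfolding D using st' 1 by simp
    qed
    consider "j \<le> m n - 2" | "j = m n - 1" | "j = m n + 1" | "j \<ge> m n + 2" using jr 1 by linarith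
    then show ?thesis
      using L R Sm[of j] Sp[of j] st' 1 jr by cases simp_all
  next
    case 2
    \<comment> \<open>As the curve passes an edge, the enlarged left cell is divided into two new
      cells, and the right cell takes over its neighbour of length \<open>\<delta>\<close>.\<close>
    have D: "\<Delta>L n + \<tau> * ?\<alpha> = \<delta> + \<Delta>L (Suc n)" "\<Delta>R n + \<delta> - \<tau> * ?\<alpha> = \<Delta>R (Suc n)"
      using edge_add[of N "m n - 2" 1] edge_add[of N "m n + 1" 1]
      by (simp_all add: slope_mult \<Delta>L_def \<Delta>R_def 2)
    have L: "r' (m n) \<in> {0..M}"
    proof (rule left_update_range[OF par near(1,2,3) \<Delta>_bounds(1)])
      show "0 < \<Delta>L n + \<tau> * ?\<alpha>" unfolding D using dpos by simp
      show "(\<Delta>L n + \<tau> * ?\<alpha>) * r' (m n) = \<Delta>L n * r (m n - 1) - \<tau> * (?h0 - ?hm (r (m n - 2)) (r (m n - 1)))"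
        unfolding D using st' 2 by simp
    qed
    have L2: "r' (m n - 1) = r' (m n)" using 2 st' by simp
    have R: "r' (m n + 2) \<in> {0..M}"
    proof (rule right_merge_update_range[OF par near(2,3,4) _ \<Delta>_bounds(2)])
      \<comment> \<open>Here \<open>m n + 1\<close> is itself a curve index, so
        \<open>m n + 3 \<le> J + 1\<close>: the stencil reaches the boundary value at worst.\<close>
      show "r (m n + 3) \<in> {0..M}" by (rule r) (use 2 mr in auto)
      show "0 < \<Delta>R n + \<delta> - \<tau> * ?\<alpha>" unfolding D by (rule dpos)
      show "(\<Delta>R n + \<delta> - \<tau> * ?\<alpha>) * r' (m n + 2) =
          \<Delta>R n * r (m n + 1) + \<delta> * r (m n + 2) - \<tau> * (?hp (r (m n + 2)) (r (m n + 3)) - ?h0)"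
        unfolding D using st' 2 by (simp add: add.commute)
    qed
    consider "j \<le> m n - 2" | "j = m n - 1" | "j = m n" | "j = m n + 2" | "j \<ge> m n + 3" using jr 2 by linarith
    then show ?thesis
      using L L2 R Sm[of j] Sp[of j] st' 2 jr by cases simp_all
  next
    case 3
    have D: "\<Delta>L n + \<delta> + \<tau> * ?\<alpha> = \<Delta>L (Suc n)" "\<Delta>R n - \<tau> * ?\<alpha> = \<delta> + \<Delta>R (Suc n)"
      using edge_add[of N "m n - 3" 1] edge_add[of N "m n" 1]
      by (simp_all add: slope_mult \<Delta>L_def \<Delta>R_def 3)
    have R: "r' (m n) \<in> {0..M}"
    proof (rule right_update_range[OF par near(2,3,4) \<Delta>_bounds(2)])
      show "0 < \<Delta>R n - \<tau> * ?\<alpha>" unfolding D using dpos by simp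
      show "(\<Delta>R n - \<tau> * ?\<alpha>) * r' (m n) = \<Delta>R n * r (m n + 1) - \<tau> * (?hp (r (m n + 1)) (r (m n + 2)) - ?h0)"
        unfolding D using st' 3 by simp
    qed
    have R2: "r' (m n + 1) = r' (m n)" using 3 st' by (simp add: add.commute)
    have L: "r' (m n - 2) \<in> {0..M}"
    proof (rule left_merge_update_range[OF par _ near(1,2,3) \<Delta>_bounds(1)])
      show "r (m n - 3) \<in> {0..M}" by (rule r) (use 3 mr in auto)
      show "0 < \<Delta>L n + \<delta> + \<tau> * ?\<alpha>" unfolding D by (rule dpos)
      show "(\<Delta>L n + \<delta> + \<tau> * ?\<alpha>) * r' (m n - 2) =
          \<Delta>L n * r (m n - 1) + \<delta> * r (m n - 2) - \<tau> * (?h0 - ?hm (r (m n - 3)) (r (m n - 2)))"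
        unfolding D using st' 3 by simp
    qed
    consider "j \<le> m n - 3" | "j = m n - 2" | "j = m n" | "j = m n + 1" | "j \<ge> m n + 2" using jr 3 by linarith
    then show ?thesis
      using L R R2 Sm[of j] Sp[of j] st' 3 jr by cases simp_all
  qed
qed

section \<open>Induction over the time steps and passage between them\<close>

lemma interp_eq:
  assumes "t \<in> {tm \<tau> n<..<tm \<tau> (Suc n)}"
  shows "interp \<xi> \<tau> t = (pos n - slope \<xi> \<tau> n * tm \<tau> n) + slope \<xi> \<tau> n * t"
proof -
  have "\<lfloor>t / \<tau>\<rfloor> = int n"
    using assms \<tau> by (intro floor_unique) (auto simp: tm_def field_simps)
  then show ?thesis by (simp add: interp_def Let_def algebra_simps)
qed

lemma scheme_range:
  assumes sch: "scheme f \<xi> N \<tau> \<rho>0 r"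
    and \<rho>0: "AE x in lebesgue. ext0 {-1<..<1} \<rho>0 x \<in> {0..M}" and M: "0 \<le> M" "M \<le> 1"
  shows "\<forall>j\<in>mesh_idx \<xi> N \<tau> n. r n j \<in> {0..M}"
proof (induction n)
  case 0
  show ?case
  proof
    fix j assume j: "j \<in> mesh_idx \<xi> N \<tau> 0"
    obtain a b where "a < b" "mcell \<xi> N \<tau> 0 j = {a..<b}" using mcell_interval by blast
    then show "r 0 j \<in> {0..M}"
      using cell_average_range[OF \<rho>0 \<open>a < b\<close> M(1)] sch j by (simp add: scheme_def scheme_init_def)
  qed
next
  case (Suc n)
  have bd: "r n (1 + J) = 0" "r n (- (1 + J)) = 0"
    using sch unfolding scheme_def by blast+
  have "r n j \<in> {0..M}" if "- J - 1 \<le> j" "j \<le> J + 1" "j \<noteq> m n" for j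
  proof (cases "j = J + 1 \<or> j = - J - 1")
    case True
    then have "j = 1 + J \<or> j = - (1 + J)" by linarith
    then have "r n j = 0" using bd by metis
    then show ?thesis using M by simp
  next
    case False
    then have "j \<in> mesh_idx \<xi> N \<tau> n" using that by (auto simp: mesh_idx_def)
    then show ?thesis using Suc by blast
  qed
  moreover have "scheme_step f \<xi> N \<tau> n (r n) (r (Suc n))" using sch by (simp add: scheme_def)
  ultimately show ?case using scheme_step_range[OF _ M(2)] by blast
qed

lemma numerical_solution_range:
  assumes sol: "numerical_solution f \<xi> N \<tau> \<rho>0 u"
    and \<rho>0: "AE x in lebesgue. ext0 {-1<..<1} \<rho>0 x \<in> {0..M}" and M: "0 \<le> M" "M \<le> 1"
    and x: "x \<in> domain N" and t: "t \<ge> 0"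
  shows "u x t \<in> {0..M}"
proof -
  obtain r where r: "scheme f \<xi> N \<tau> \<rho>0 r"
    and cells: "\<And>n j x. j \<in> mesh_idx \<xi> N \<tau> n \<Longrightarrow> x \<in> mcell \<xi> N \<tau> n j \<Longrightarrow> u x (tm \<tau> n) = r n j"
    and outer: "\<And>n x. x \<in> cell N (1 + J) \<union> cell N (- (1 + J)) \<Longrightarrow> u x (tm \<tau> n) = 0"
    and ex: "\<And>n. \<exists>w. entropy_solution f (interp \<xi> \<tau>) (tm \<tau> n) (tm \<tau> (Suc n))
                 (ext0 (domain N) (\<lambda>x. u x (tm \<tau> n))) w \<and>
               (\<forall>t\<in>{tm \<tau> n<..<tm \<tau> (Suc n)}. \<forall>x\<in>domain N. u x t = w x t)"
    using sol unfolding numerical_solution_def by blast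
  have mesh_time: "u x (tm \<tau> n) \<in> {0..M}" if "x \<in> domain N" for x n
    using cell_cover[OF that, of n]
  proof
    assume "\<exists>j\<in>mesh_idx \<xi> N \<tau> n. x \<in> mcell \<xi> N \<tau> n j"
    then show ?thesis using cells scheme_range[OF r \<rho>0 M, of n] by force
  next
    assume "x \<in> cell N (1 + J) \<union> cell N (- (1 + J))"
    from outer[OF this] show ?thesis using M by simp
  qed
  define n where "n = nat \<lfloor>t / \<tau>\<rfloor>"
  have "real n = of_int \<lfloor>t / \<tau>\<rfloor>" using t \<tau> by (simp add: n_def)
  then have "real n \<le> t / \<tau>" "t / \<tau> < real n + 1" by linarith+
  then have n: "tm \<tau> n \<le> t" "t < tm \<tau> (Suc n)" using \<tau> by (auto simp: tm_def field_simps)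
  show ?thesis
  proof (cases "t = tm \<tau> n")
    case True
    then show ?thesis using mesh_time[OF x] by simp
  next
    case False
    then have t: "t \<in> {tm \<tau> n<..<tm \<tau> (Suc n)}" using n by auto
    obtain w where w: "entropy_solution f (interp \<xi> \<tau>) (tm \<tau> n) (tm \<tau> (Suc n))
                 (ext0 (domain N) (\<lambda>x. u x (tm \<tau> n))) w"
      and uw: "u x t = w x t"
      using ex[of n] t x by blast
    interpret entropy_strip f "interp \<xi> \<tau>" "ext0 (domain N) (\<lambda>x. u x (tm \<tau> n))" w "tm \<tau> n" "tm \<tau> (Suc n)"
      "pos n - slope \<xi> \<tau> n * tm \<tau> n" "slope \<xi> \<tau> n" K
      by unfold_locales (use f lip(1) w interp_eq in \<open>auto simp: flux_data_def\<close>)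
    have "w x t \<le> M"
    proof (rule entropy_solution_le[OF _ _ _ _ t])
      show "concave_on {0..1} f" "\<And>u. u \<in> {0..1} \<Longrightarrow> 0 \<le> f u"
        using f by (auto simp: flux_data_def)
      \<comment> \<open>The maximum principle needs the bound on the whole line; outside the domain
        the datum is 0, and \<open>0 \<le> M\<close>.\<close>
      show "ext0 (domain N) (\<lambda>x. u x (tm \<tau> n)) y \<le> M" for y
        using mesh_time M by (auto simp: ext0_def)
      show "M \<in> {0..1}" using M by simp
    qed
    moreover have "0 \<le> w x t" using w t by (auto simp: entropy_solution_def)
    ultimately show ?thesis using uw by simp
  qed
qed

end

theorem proposition4p1:
  fixes f \<xi> \<rho>0 :: "real \<Rightarrow> real" and \<rho> :: "real \<Rightarrow> real \<Rightarrow> real"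
    and N :: nat and \<tau> T :: real
  assumes "flux_data f" and "curve_data \<xi>" and "initial_data \<rho>0"
    and "fine_mesh \<xi> N" and "\<tau> > 0" and "CFL f \<xi> N \<tau>"
    and "numerical_solution f \<xi> N \<tau> \<rho>0 \<rho>"
    and "T > 0"
  shows "\<forall>t\<in>{0..T}. \<forall>x\<in>{-1..1}.
           0 \<le> \<rho> x t \<and>
           ereal (\<rho> x t) \<le> esssup (lebesgue_on {-1<..<1}) (\<lambda>x. ereal \<bar>\<rho>0 x\<bar>)"
proof (intro ballI)
  fix t x :: real assume t: "t \<in> {0..T}" and x: "x \<in> {-1..1}"
  obtain M where M: "0 \<le> M" "M \<le> 1"
    and ess: "esssup (lebesgue_on {-1<..<1}) (\<lambda>x. ereal \<bar>\<rho>0 x\<bar>) = ereal M"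
    and ae: "AE x in lebesgue. ext0 {-1<..<1} \<rho>0 x \<in> {0..M}"
    using initial_data_esssup[OF assms(3)] by blast
  interpret moving_mesh f \<xi> N \<tau>
    using assms by unfold_locales
  have "x \<in> domain N" using x dx_pos[of N] by (auto simp: domain_def)
  then have "\<rho> x t \<in> {0..M}"
    using t by (intro numerical_solution_range[OF assms(7) ae M]) auto
  then show "0 \<le> \<rho> x t \<and> ereal (\<rho> x t) \<le> esssup (lebesgue_on {-1<..<1}) (\<lambda>x. ereal \<bar>\<rho>0 x\<bar>)"
    by (simp add: ess)
qed

end
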